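(* For every $R>0$ there exists a constant $C(R)$ such that for every $u_0\in\mathcal{H}^{1,1}=\mathcal{H}^{1,1}(\mathbb{R})$ with $\|u_0\|_{\mathcal{H}^{1,1}}\le R$, the Cauchy problem $$\Big(i\partial_t+\tfrac12\partial_x^2\Big)u=u|u|^2,\quad t\ge0,\ x\in\mathbb{R},\qquad u(0)=u_0,$$ has a unique global solution $u\in C([0,+\infty);\mathcal{H}^{1,1})$, and this solution satisfies $$\|u(t,\cdot)\|_{L^\infty(\mathbb{R})}\le C(R)\,t^{-1/3}\qquad\text{for all } t\ge1 .$$
   Context: $u$ is complex-valued. $\mathcal{H}^{1,1}(\mathbb{R})=H^1(\mathbb{R})\cap\mathcal{F}(H^1(\mathbb{R}))$, where $\mathcal{F}$ is the Fourier transform, i.e. the space of $f\in H^1(\mathbb{R})$ with $xf\in L^2(\mathbb{R})$, with the natural intersection norm $\|f\|_{\mathcal{H}^{1,1}}=\|f\|_{H^1}+\|\langle x\rangle f\|_{L^2}$, $\langle x\rangle=(1+|x|^2)^{1/2}$. Solutions are understood in the mild sense: $u(t)=U(t)u_0-i\int_0^tU(t-\tau)\,u(\tau)|u(\tau)|^2\,d\tau$ with $U(t)=e^{i\frac t2\partial_x^2}$. *)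

theory Defs
  imports "HOL-Analysis.Analysis" "HOL-Probability.Essential_Supremum"
begin

text \<open>Elements of the function spaces are represented by Borel functions on the real line;
  two such functions denote the same element iff they agree almost everywhere.\<close>

definition L2 :: "(real \<Rightarrow> complex) set" where
  "L2 = {f \<in> borel_measurable lborel. integrable lborel (\<lambda>x. (cmod (f x))\<^sup>2)}"

definition L2_norm :: "(real \<Rightarrow> complex) \<Rightarrow> real" where
  "L2_norm f = sqrt (LINT x|lborel. (cmod (f x))\<^sup>2)"

definition Linf_norm :: "(real \<Rightarrow> complex) \<Rightarrow> ereal" where
  "Linf_norm f = esssup lborel (\<lambda>x. ereal (cmod (f x)))"

definition test_function :: "(real \<Rightarrow> real) \<Rightarrow> bool" where
  "test_function \<phi> \<longleftrightarrow>
     (\<forall>k x. ((deriv ^^ k) \<phi>) differentiable (at x)) \<and> compact (closure {x. \<phi> x \<noteq> 0})"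

text \<open>Real-valued test functions suffice, since the defining identity is complex linear in the
  test function.\<close>

definition is_weak_deriv :: "(real \<Rightarrow> complex) \<Rightarrow> (real \<Rightarrow> complex) \<Rightarrow> bool" where
  "is_weak_deriv f g \<longleftrightarrow> (\<forall>\<phi>. test_function \<phi> \<longrightarrow>
     (LINT x|lborel. f x * of_real (deriv \<phi> x)) = - (LINT x|lborel. g x * of_real (\<phi> x)))"

definition H1 :: "(real \<Rightarrow> complex) set" where
  "H1 = {f \<in> L2. \<exists>g \<in> L2. is_weak_deriv f g}"

text \<open>The weak derivative is determined only almost everywhere; its norm does not depend on the
  chosen representative.\<close>

definition weak_deriv :: "(real \<Rightarrow> complex) \<Rightarrow> real \<Rightarrow> complex" where
  "weak_deriv f = (SOME g. g \<in> L2 \<and> is_weak_deriv f g)"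

definition H1_norm :: "(real \<Rightarrow> complex) \<Rightarrow> real" where
  "H1_norm f = sqrt ((L2_norm f)\<^sup>2 + (L2_norm (weak_deriv f))\<^sup>2)"

definition H11 :: "(real \<Rightarrow> complex) set" where
  "H11 = {f \<in> H1. (\<lambda>x. of_real x * f x) \<in> L2}"

definition H11_norm :: "(real \<Rightarrow> complex) \<Rightarrow> real" where
  "H11_norm f = H1_norm f + L2_norm (\<lambda>x. of_real (sqrt (1 + x\<^sup>2)) * f x)"

text \<open>Continuity of a curve \<open>[0,\<infinity>) \<rightarrow> H11\<close> for the norm; values at negative times are
  irrelevant.\<close>

definition continuous_H11 :: "(real \<Rightarrow> real \<Rightarrow> complex) \<Rightarrow> bool" where
  "continuous_H11 u \<longleftrightarrow>
     (\<forall>t\<ge>0. u t \<in> H11 \<and>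
        ((\<lambda>s. H11_norm (\<lambda>x. u s x - u t x)) \<longlongrightarrow> 0) (at t within {0..}))"

definition fourier :: "(real \<Rightarrow> complex) \<Rightarrow> real \<Rightarrow> complex" where
  "fourier f \<xi> = of_real (1 / sqrt (2 * pi)) * (LINT x|lborel. exp (- \<i> * of_real (x * \<xi>)) * f x)"

text \<open>The group \<open>U(t) = exp (i t/2 \<partial>\<^sub>x\<^sup>2)\<close> is the Fourier multiplier with symbol
  \<open>exp (-i t \<xi>\<^sup>2/2)\<close>. It is only used on H11. There \<open>f\<close> is integrable because
  \<open>sqrt (1 + x\<^sup>2) f\<close> is in L2, and its Fourier transform is integrable because \<open>f\<close> is
  in H1, so both integrals converge absolutely and no extension by density is needed.\<close>

definition schroedinger_group :: "real \<Rightarrow> (real \<Rightarrow> complex) \<Rightarrow> real \<Rightarrow> complex" where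
  "schroedinger_group t f x = of_real (1 / sqrt (2 * pi)) *
     (LINT \<xi>|lborel. exp (\<i> * of_real (x * \<xi>)) * (exp (- \<i> * of_real (t * \<xi>\<^sup>2 / 2)) * fourier f \<xi>))"

text \<open>Mild solutions of \<open>(i \<partial>\<^sub>t + 1/2 \<partial>\<^sub>x\<^sup>2) u = u |u|\<^sup>2\<close> on \<open>[0,\<infinity>)\<close> in the class
  \<open>C([0,\<infinity>); H11)\<close>. The Duhamel identity is an equality of elements of the space for every
  time, hence almost everywhere in \<open>x\<close>. Its integral is evaluated pointwise in \<open>x\<close>: for
  \<open>u\<close> in this class the integrand is a continuous curve in H1, and H1 embeds into the bounded
  continuous functions, so the integrand at \<open>x\<close> is continuous in \<open>\<tau>\<close> and the
  vector-valued integral is evaluated at \<open>x\<close>. The initial condition is the case \<open>t = 0\<close>.\<close>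

definition mild_NLS_solution :: "(real \<Rightarrow> complex) \<Rightarrow> (real \<Rightarrow> real \<Rightarrow> complex) \<Rightarrow> bool" where
  "mild_NLS_solution u0 u \<longleftrightarrow>
     continuous_H11 u \<and>
     (\<forall>t\<ge>0. AE x in lborel.
        u t x = schroedinger_group t u0 x
          - \<i> * (LINT \<tau>:{0..t}|lborel.
                schroedinger_group (t - \<tau>) (\<lambda>y. u \<tau> y * of_real ((cmod (u \<tau> y))\<^sup>2)) x))"

end

theory Submission
  imports Defs "HOL-Probability.Sinc_Integral" "HOL-Probability.Characteristic_Functions"
begin

text \<open>The profile \<open>w(t) = U(-t) u(t)\<close> of a mild solution solves an ordinary differential equation
  \<open>w' = -i U(-t) (|u|\<^sup>2 u)\<close> with locally Lipschitz right-hand side in the Hilbert space H11, because H11 is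
  an algebra and \<open>U(t)\<close> is a strongly continuous group on it. Along it, mass and energy are conserved,
  and with \<open>J = x + i t \<partial>\<^sub>x = U(t) x U(-t)\<close> the pseudoconformal quantity
  \<open>E(t) = \<parallel>J u\<parallel>\<^sup>2 + t\<^sup>2 \<parallel>u\<parallel>\<^sub>4\<^sup>4\<close> satisfies \<open>E' = t \<parallel>u\<parallel>\<^sub>4\<^sup>4\<close>. These bounds prevent
  blow-up. Moreover \<open>E' \<le> E / t\<close>, so \<open>E(t) \<le> t E(1)\<close> for \<open>t \<ge> 1\<close>, and the Gagliardo-Nirenberg
  inequality \<open>\<parallel>u\<parallel>\<^sub>\<infinity>\<^sup>3 \<le> 4 \<parallel>u\<parallel>\<^sub>4\<^sup>2 \<parallel>J u\<parallel> / t \<le> 4 E(1) / t\<close> gives the decay rate.\<close>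

section \<open>Square integrable functions\<close>

text \<open>What shapes the proof is that \<open>u\<close> is not differentiable in time with values
  in H11, since the generator costs two derivatives; only the profile is. The mass and the kinetic
  form are invariant under \<open>U(t)\<close>, and \<open>\<parallel>J u\<parallel>\<close> equals
  \<open>\<parallel>x w\<parallel>\<close>, so these can be differentiated on the profile. The
  quartic term has no such invariance. Its increments are factored exactly as a pairing with the
  increment of \<open>u\<close>, and the generator is used only inside that pairing, with one
  derivative on each side, so that the regularity of H11 is enough. The resulting flux occurs with
  the opposite sign in the derivative of the kinetic energy, and with the factor
  \<open>- t\<^sup>2\<close> in that of \<open>\<parallel>J u\<parallel>\<^sup>2\<close>, which is
  why it cancels from both identities.

  The defocusing sign makes both summands of \<open>E\<close> nonnegative;
  \<open>E' \<le> E / t\<close> says no more than that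
  \<open>t\<^sup>2 \<parallel>u\<parallel>\<^sub>4\<^sup>4\<close> is one of them. As this
  inequality degenerates at \<open>t = 0\<close>, the value \<open>E(1)\<close> is bounded through
  energy conservation instead.\<close>

lemma L2I: "f \<in> borel_measurable borel \<Longrightarrow> integrable lborel (\<lambda>x. (cmod (f x))\<^sup>2) \<Longrightarrow> f \<in> L2"
  by (simp add: L2_def)

lemma L2_measurable: "f \<in> L2 \<Longrightarrow> f \<in> borel_measurable borel"
  by (simp add: L2_def)

lemma L2_integrable: "f \<in> L2 \<Longrightarrow> integrable lborel (\<lambda>x. (cmod (f x))\<^sup>2)"
  by (simp add: L2_def)

lemma L2_norm_nonneg [simp]: "0 \<le> L2_norm f"
  by (simp add: L2_norm_def integral_nonneg_AE)

lemma L2_norm_power2: "(L2_norm f)\<^sup>2 = (LINT x|lborel. (cmod (f x))\<^sup>2)"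
  by (simp add: L2_norm_def integral_nonneg_AE)

lemma L2_bound:
  assumes g: "g \<in> L2" and f[measurable]: "f \<in> borel_measurable borel"
    and le: "AE x in lborel. cmod (f x) \<le> C * cmod (g x)"
  shows "f \<in> L2"
proof (rule L2I[OF f])
  show "integrable lborel (\<lambda>x. (cmod (f x))\<^sup>2)"
  proof (rule Bochner_Integration.integrable_bound)
    show "integrable lborel (\<lambda>x. C\<^sup>2 * (cmod (g x))\<^sup>2)"
      using L2_integrable[OF g] by simp
    show "AE x in lborel. norm ((cmod (f x))\<^sup>2) \<le> norm (C\<^sup>2 * (cmod (g x))\<^sup>2)"
      using le
    proof eventually_elim
      case (elim x)
      have "(cmod (f x))\<^sup>2 \<le> (C * cmod (g x))\<^sup>2" by (rule power_mono[OF elim]) simp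
      then show ?case by (simp add: power_mult_distrib)
    qed
  qed simp
qed

lemma L2_norm_mono:
  assumes g: "g \<in> L2" and f[measurable]: "f \<in> borel_measurable borel" and C: "0 \<le> C"
    and le: "AE x in lborel. cmod (f x) \<le> C * cmod (g x)"
  shows "L2_norm f \<le> C * L2_norm g"
proof -
  have "(LINT x|lborel. (cmod (f x))\<^sup>2) \<le> (LINT x|lborel. C\<^sup>2 * (cmod (g x))\<^sup>2)"
  proof (rule integral_mono_AE)
    show "integrable lborel (\<lambda>x. (cmod (f x))\<^sup>2)" using L2_bound[OF g f le] by (rule L2_integrable)
    show "integrable lborel (\<lambda>x. C\<^sup>2 * (cmod (g x))\<^sup>2)"
      using L2_integrable[OF g] by simp
    show "AE x in lborel. (cmod (f x))\<^sup>2 \<le> C\<^sup>2 * (cmod (g x))\<^sup>2"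
      using le
    proof eventually_elim
      case (elim x)
      have "(cmod (f x))\<^sup>2 \<le> (C * cmod (g x))\<^sup>2" by (rule power_mono[OF elim]) simp
      then show ?case by (simp add: power_mult_distrib)
    qed
  qed
  then have "(L2_norm f)\<^sup>2 \<le> (C * L2_norm g)\<^sup>2" by (simp add: L2_norm_power2 power_mult_distrib)
  then show ?thesis by (rule power2_le_imp_le) (simp add: C)
qed

lemma L2_add: assumes "f \<in> L2" "g \<in> L2" shows "(\<lambda>x. f x + g x) \<in> L2"
proof (rule L2I)
  note [measurable] = assms[THEN L2_measurable]
  show "(\<lambda>x. f x + g x) \<in> borel_measurable borel" by measurable
  show "integrable lborel (\<lambda>x. (cmod (f x + g x))\<^sup>2)"
  proof (rule Bochner_Integration.integrable_bound)
    show "integrable lborel (\<lambda>x. 2 * (cmod (f x))\<^sup>2 + 2 * (cmod (g x))\<^sup>2)"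
      using assms[THEN L2_integrable] by simp
    have "(cmod (f x + g x))\<^sup>2 \<le> 2 * (cmod (f x))\<^sup>2 + 2 * (cmod (g x))\<^sup>2" for x
    proof -
      have "(cmod (f x + g x))\<^sup>2 \<le> (cmod (f x) + cmod (g x))\<^sup>2"
        by (intro power_mono norm_triangle_ineq) simp
      also have "\<dots> \<le> 2 * (cmod (f x))\<^sup>2 + 2 * (cmod (g x))\<^sup>2"
        using sum_squares_bound[of "cmod (f x)" "cmod (g x)"] by (simp add: power2_sum)
      finally show ?thesis .
    qed
    then show "AE x in lborel. norm ((cmod (f x + g x))\<^sup>2) \<le> norm (2 * (cmod (f x))\<^sup>2 + 2 * (cmod (g x))\<^sup>2)"
      by (auto intro!: AE_I2)
  qed simp
qed

lemma L2_mult_bounded: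
  assumes f: "f \<in> L2" and [measurable]: "\<phi> \<in> borel_measurable borel" and b: "\<And>x. cmod (\<phi> x) \<le> C"
  shows "(\<lambda>x. \<phi> x * f x) \<in> L2"
proof (rule L2_bound[OF f])
  note [measurable] = L2_measurable[OF f]
  show "(\<lambda>x. \<phi> x * f x) \<in> borel_measurable borel" by measurable
  show "AE x in lborel. cmod (\<phi> x * f x) \<le> C * cmod (f x)"
    by (intro AE_I2) (simp add: norm_mult b mult_right_mono)
qed

lemma L2_cmult: "f \<in> L2 \<Longrightarrow> (\<lambda>x. c * f x) \<in> L2"
  by (rule L2_mult_bounded[where C="cmod c"]) auto

lemma L2_uminus: "f \<in> L2 \<Longrightarrow> (\<lambda>x. - f x) \<in> L2"
  using L2_cmult[of f "-1"] by simp

lemma L2_diff: "f \<in> L2 \<Longrightarrow> g \<in> L2 \<Longrightarrow> (\<lambda>x. f x - g x) \<in> L2"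
  using L2_add[of f "\<lambda>x. - g x"] L2_uminus[of g] by simp

lemma L2_scaleR: "f \<in> L2 \<Longrightarrow> (\<lambda>x. r *\<^sub>R f x) \<in> L2"
  using L2_cmult[of f "of_real r"] by (simp add: scaleR_conv_of_real)

lemma L2_cnj: assumes "f \<in> L2" shows "(\<lambda>x. cnj (f x)) \<in> L2"
proof (rule L2_bound[OF assms, where C=1])
  show "(\<lambda>x. cnj (f x)) \<in> borel_measurable borel"
    by (rule borel_measurable_continuous_on[OF _ L2_measurable[OF assms]]) (intro continuous_intros)
qed simp

lemma L2_zero: "(\<lambda>x. 0) \<in> L2"
  by (rule L2I) auto

lemma L2_cong_AE: "f \<in> L2 \<Longrightarrow> g \<in> borel_measurable borel \<Longrightarrow> AE x in lborel. f x = g x \<Longrightarrow> g \<in> L2"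
  by (rule L2_bound[where C=1]) auto

lemma L2_norm_cong_AE:
  "f \<in> borel_measurable borel \<Longrightarrow> g \<in> borel_measurable borel \<Longrightarrow> AE x in lborel. f x = g x
   \<Longrightarrow> L2_norm f = L2_norm g"
  unfolding L2_norm_def by (rule arg_cong[where f=sqrt], rule integral_cong_AE) auto

lemma L2_mult_integrable:
  assumes "f \<in> L2" "g \<in> L2" shows "integrable lborel (\<lambda>x. cmod (f x) * cmod (g x))"
proof (rule Bochner_Integration.integrable_bound)
  note [measurable] = assms[THEN L2_measurable]
  show "(\<lambda>x. cmod (f x) * cmod (g x)) \<in> borel_measurable lborel" by measurable
  show "integrable lborel (\<lambda>x. (cmod (f x))\<^sup>2 + (cmod (g x))\<^sup>2)"
    using assms[THEN L2_integrable] by simp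
  have "cmod (f x) * cmod (g x) \<le> (cmod (f x))\<^sup>2 + (cmod (g x))\<^sup>2" for x
    using sum_squares_bound[of "cmod (f x)" "cmod (g x)"] 
      mult_nonneg_nonneg[of "cmod (f x)" "cmod (g x)"] by (simp del: mult_nonneg_nonneg)
  then show "AE x in lborel. norm (cmod (f x) * cmod (g x)) \<le> norm ((cmod (f x))\<^sup>2 + (cmod (g x))\<^sup>2)"
    by (auto intro!: AE_I2)
qed

lemma L2_Cauchy_Schwarz:
  assumes "f \<in> L2" "g \<in> L2"
  shows "(LINT x|lborel. cmod (f x) * cmod (g x)) \<le> L2_norm f * L2_norm g"
proof -
  note [measurable] = assms[THEN L2_measurable]
  have pos: "0 \<le> (LINT x|lborel. cmod (f x) * cmod (g x))" by (intro integral_nonneg_AE) auto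
  have "(\<integral>\<^sup>+x. ennreal (cmod (f x)) * ennreal (cmod (g x)) \<partial>lborel)\<^sup>2
      \<le> (\<integral>\<^sup>+x. (ennreal (cmod (f x)))\<^sup>2 \<partial>lborel) * (\<integral>\<^sup>+x. (ennreal (cmod (g x)))\<^sup>2 \<partial>lborel)"
    by (rule Cauchy_Schwarz_nn_integral) auto
  also have "(\<integral>\<^sup>+x. (ennreal (cmod (f x)))\<^sup>2 \<partial>lborel) = ennreal ((L2_norm f)\<^sup>2)"
    unfolding L2_norm_power2
    by (subst nn_integral_eq_integral[symmetric, OF L2_integrable[OF assms(1)]]) (auto simp: ennreal_power)
  also have "(\<integral>\<^sup>+x. (ennreal (cmod (g x)))\<^sup>2 \<partial>lborel) = ennreal ((L2_norm g)\<^sup>2)"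
    unfolding L2_norm_power2
    by (subst nn_integral_eq_integral[symmetric, OF L2_integrable[OF assms(2)]]) (auto simp: ennreal_power)
  also have "(\<integral>\<^sup>+x. ennreal (cmod (f x)) * ennreal (cmod (g x)) \<partial>lborel) 
      = ennreal (LINT x|lborel. cmod (f x) * cmod (g x))"
    by (subst nn_integral_eq_integral[symmetric, OF L2_mult_integrable[OF assms]]) (auto simp: ennreal_mult)
  finally have "ennreal ((LINT x|lborel. cmod (f x) * cmod (g x))\<^sup>2) \<le> ennreal ((L2_norm f * L2_norm g)\<^sup>2)"
    using pos by (simp add: ennreal_power ennreal_mult power_mult_distrib)
  then have "(LINT x|lborel. cmod (f x) * cmod (g x))\<^sup>2 \<le> (L2_norm f * L2_norm g)\<^sup>2" by simp
  then show ?thesis by (rule power2_le_imp_le) simp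
qed

section \<open>The real inner product of square integrable functions\<close>

definition ip :: "(real \<Rightarrow> complex) \<Rightarrow> (real \<Rightarrow> complex) \<Rightarrow> real" where
  "ip f g = (LINT x|lborel. inner (f x) (g x))"

lemma ip_integrable:
  assumes "f \<in> L2" "g \<in> L2" shows "integrable lborel (\<lambda>x. inner (f x) (g x))"
proof (rule Bochner_Integration.integrable_bound[OF L2_mult_integrable[OF assms]])
  note [measurable] = assms[THEN L2_measurable]
  show "(\<lambda>x. inner (f x) (g x)) \<in> borel_measurable lborel" by measurable
  show "AE x in lborel. norm (inner (f x) (g x)) \<le> norm (cmod (f x) * cmod (g x))"
    using Cauchy_Schwarz_ineq2 by auto
qed

lemma ip_self: "ip f f = (L2_norm f)\<^sup>2"
  by (simp add: ip_def L2_norm_power2 power2_norm_eq_inner)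

lemma ip_commute: "ip f g = ip g f"
  by (simp add: ip_def inner_commute)

lemma ip_add_left: "f \<in> L2 \<Longrightarrow> g \<in> L2 \<Longrightarrow> h \<in> L2 \<Longrightarrow> ip (\<lambda>x. f x + g x) h = ip f h + ip g h"
  by (simp add: ip_def inner_add_left ip_integrable)

lemma ip_add_right: "f \<in> L2 \<Longrightarrow> g \<in> L2 \<Longrightarrow> h \<in> L2 \<Longrightarrow> ip h (\<lambda>x. f x + g x) = ip h f + ip h g"
  by (simp add: ip_def inner_add_right ip_integrable)

lemma ip_scaleR_left: "ip (\<lambda>x. r *\<^sub>R f x) h = r * ip f h"
  by (simp add: ip_def)

lemma ip_cong_AE:
  assumes "f \<in> borel_measurable borel" "f' \<in> borel_measurable borel"
    "g \<in> borel_measurable borel" "g' \<in> borel_measurable borel"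
    "AE x in lborel. f x = f' x" "AE x in lborel. g x = g' x"
  shows "ip f g = ip f' g'"
  unfolding ip_def
proof (rule integral_cong_AE)
  note [measurable] = assms(1-4)
  show "(\<lambda>x. inner (f x) (g x)) \<in> borel_measurable lborel" "(\<lambda>x. inner (f' x) (g' x)) \<in> borel_measurable lborel"
    by measurable
  show "AE x in lborel. inner (f x) (g x) = inner (f' x) (g' x)"
    using assms(5,6) by eventually_elim simp
qed

lemma ip_le: assumes "f \<in> L2" "g \<in> L2" shows "\<bar>ip f g\<bar> \<le> L2_norm f * L2_norm g"
proof -
  have "\<bar>ip f g\<bar> \<le> (LINT x|lborel. \<bar>inner (f x) (g x)\<bar>)"
    unfolding ip_def by (rule integral_abs_bound)
  also have "\<dots> \<le> (LINT x|lborel. cmod (f x) * cmod (g x))"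
    using ip_integrable[OF assms] L2_mult_integrable[OF assms]
    by (intro integral_mono) (auto simp: Cauchy_Schwarz_ineq2)
  also have "\<dots> \<le> L2_norm f * L2_norm g" by (rule L2_Cauchy_Schwarz[OF assms])
  finally show ?thesis .
qed

lemma L2_norm_triangle: assumes "f \<in> L2" "g \<in> L2" 
  shows "L2_norm (\<lambda>x. f x + g x) \<le> L2_norm f + L2_norm g"
proof -
  have "(L2_norm (\<lambda>x. f x + g x))\<^sup>2 = (L2_norm f)\<^sup>2 + 2 * ip f g + (L2_norm g)\<^sup>2"
    using assms by (simp add: ip_self[symmetric] ip_add_left ip_add_right L2_add ip_commute[of g f])
  also have "\<dots> \<le> (L2_norm f + L2_norm g)\<^sup>2"
    using ip_le[OF assms] by (simp add: power2_sum)
  finally show ?thesis by (rule power2_le_imp_le) simp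
qed

lemma L2_norm_uminus: "L2_norm (\<lambda>x. - f x) = L2_norm f"
  by (simp add: L2_norm_def)

lemma L2_norm_diff_triangle: assumes "f \<in> L2" "g \<in> L2" 
  shows "L2_norm (\<lambda>x. f x - g x) \<le> L2_norm f + L2_norm g"
  using L2_norm_triangle[OF assms(1) L2_uminus[OF assms(2)]] by (simp add: L2_norm_uminus)

lemma L2_norm_cmult: "L2_norm (\<lambda>x. c * f x) = cmod c * L2_norm f"
proof -
  have "(LINT x|lborel. (cmod (c * f x))\<^sup>2) = (cmod c)\<^sup>2 * (LINT x|lborel. (cmod (f x))\<^sup>2)"
    by (simp add: norm_mult power_mult_distrib)
  then show ?thesis by (simp add: L2_norm_def real_sqrt_mult)
qed

lemma L2_norm_eq_0_AE: assumes "f \<in> L2" "L2_norm f = 0" shows "AE x in lborel. f x = 0"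
proof -
  have "(LINT x|lborel. (cmod (f x))\<^sup>2) = 0" using assms(2) by (simp add: L2_norm_power2[symmetric])
  then have "AE x in lborel. (cmod (f x))\<^sup>2 = 0"
    using integral_nonneg_eq_0_iff_AE[OF L2_integrable[OF assms(1)]] by auto
  then show ?thesis by simp
qed

lemma L2_norm_dominated_tendsto_0:
  assumes h: "h \<in> L2" and f[measurable]: "\<And>n. f n \<in> borel_measurable borel"
    and b: "\<And>n. AE x in lborel. cmod (f n x) \<le> C * cmod (h x)"
    and lim: "AE x in lborel. (\<lambda>n. f n x) \<longlonglongrightarrow> 0"
  shows "(\<lambda>n. L2_norm (f n)) \<longlonglongrightarrow> 0"
proof -
  have "(\<lambda>n. LINT x|lborel. (cmod (f n x))\<^sup>2) \<longlonglongrightarrow> (LINT x::real|lborel. (0::real))"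
  proof (rule integral_dominated_convergence[where w="\<lambda>x. C\<^sup>2 * (cmod (h x))\<^sup>2" and s="\<lambda>n x. (cmod (f n x))\<^sup>2" and f="\<lambda>x. 0"])
    show "integrable lborel (\<lambda>x. C\<^sup>2 * (cmod (h x))\<^sup>2)" using L2_integrable[OF h] by simp
    show "AE x in lborel. (\<lambda>n. (cmod (f n x))\<^sup>2) \<longlonglongrightarrow> 0"
      using lim
    proof eventually_elim
      case (elim x)
      then have "(\<lambda>n. (cmod (f n x))\<^sup>2) \<longlonglongrightarrow> (cmod 0)\<^sup>2" by (intro tendsto_intros)
      then show ?case by simp
    qed
    show "AE x in lborel. norm ((cmod (f n x))\<^sup>2) \<le> C\<^sup>2 * (cmod (h x))\<^sup>2" for n
      using b[of n]
    proof eventually_elim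
      case (elim x)
      have "(cmod (f n x))\<^sup>2 \<le> (C * cmod (h x))\<^sup>2" by (rule power_mono[OF elim]) simp
      then show ?case by (simp add: power_mult_distrib)
    qed
  qed auto
  then have "(\<lambda>n. sqrt (LINT x|lborel. (cmod (f n x))\<^sup>2)) \<longlonglongrightarrow> sqrt 0"
    by (intro tendsto_real_sqrt) simp
  then show ?thesis by (simp add: L2_norm_def)
qed

lemma L2_norm_nn_integral:
  assumes "f \<in> L2" shows "(\<integral>\<^sup>+x. ennreal ((cmod (f x))\<^sup>2) \<partial>lborel) = ennreal ((L2_norm f)\<^sup>2)"
  unfolding L2_norm_power2 by (rule nn_integral_eq_integral[OF L2_integrable[OF assms]]) auto

lemma L2I_nn_integral:
  assumes f[measurable]: "f \<in> borel_measurable borel" and C: "0 \<le> C" 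
    and le: "(\<integral>\<^sup>+x. ennreal ((cmod (f x))\<^sup>2) \<partial>lborel) \<le> ennreal (C\<^sup>2)"
  shows "f \<in> L2" "L2_norm f \<le> C"
proof -
  show fL: "f \<in> L2"
  proof (rule L2I[OF f], rule integrableI_bounded)
    show "(\<integral>\<^sup>+x. ennreal (norm ((cmod (f x))\<^sup>2)) \<partial>lborel) < \<infinity>"
      using le by (auto simp: le_less_trans ennreal_less_top)
  qed simp
  have "ennreal ((L2_norm f)\<^sup>2) \<le> ennreal (C\<^sup>2)" using le by (simp add: L2_norm_nn_integral[OF fL])
  then have "(L2_norm f)\<^sup>2 \<le> C\<^sup>2" by simp
  then show "L2_norm f \<le> C" by (rule power2_le_imp_le[OF _ C])
qed

text \<open>Norm bounds pass to almost everywhere limits without norm convergence. In both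
  completeness proofs below, this turns the Cauchy condition into an estimate against a pointwise
  limit.\<close>

lemma L2_Fatou:
  assumes f: "\<And>n. f n \<in> L2" and [measurable]: "g \<in> borel_measurable borel"
    and b: "\<forall>\<^sub>F n in sequentially. L2_norm (f n) \<le> C" and lim: "AE x in lborel. (\<lambda>n. f n x) \<longlonglongrightarrow> g x"
  shows "g \<in> L2" "L2_norm g \<le> C"
proof -
  note [measurable] = f[THEN L2_measurable]
  obtain n where "L2_norm (f n) \<le> C" using eventually_happens[OF b] by auto
  then have C: "0 \<le> C" using L2_norm_nonneg[of "f n"] by linarith
  have "(\<integral>\<^sup>+x. ennreal ((cmod (g x))\<^sup>2) \<partial>lborel) 
    = (\<integral>\<^sup>+x. liminf (\<lambda>n. ennreal ((cmod (f n x))\<^sup>2)) \<partial>lborel)"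
  proof (rule nn_integral_cong_AE)
    show "AE x in lborel. ennreal ((cmod (g x))\<^sup>2) = liminf (\<lambda>n. ennreal ((cmod (f n x))\<^sup>2))"
      using lim
    proof eventually_elim
      case (elim x)
      then have "(\<lambda>n. ennreal ((cmod (f n x))\<^sup>2)) \<longlonglongrightarrow> ennreal ((cmod (g x))\<^sup>2)"
        by (intro tendsto_intros)
      then show ?case by (rule lim_imp_Liminf[symmetric, rotated]) simp
    qed
  qed
  also have "\<dots> \<le> liminf (\<lambda>n. \<integral>\<^sup>+x. ennreal ((cmod (f n x))\<^sup>2) \<partial>lborel)"
    by (rule nn_integral_liminf) auto
  also have "\<dots> \<le> ennreal (C\<^sup>2)"
  proof -
    have "liminf (\<lambda>n. \<integral>\<^sup>+x. ennreal ((cmod (f n x))\<^sup>2) \<partial>lborel) \<le> liminf (\<lambda>n::nat. ennreal (C\<^sup>2))"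
    proof (rule Liminf_mono)
      show "\<forall>\<^sub>F n in sequentially. (\<integral>\<^sup>+x. ennreal ((cmod (f n x))\<^sup>2) \<partial>lborel) \<le> ennreal (C\<^sup>2)"
        using b by eventually_elim (simp add: L2_norm_nn_integral[OF f] ennreal_leI power_mono)
    qed
    then show ?thesis by (simp add: Liminf_const)
  qed
  finally have le: "(\<integral>\<^sup>+x. ennreal ((cmod (g x))\<^sup>2) \<partial>lborel) \<le> ennreal (C\<^sup>2)" .
  show "g \<in> L2" "L2_norm g \<le> C" by (rule L2I_nn_integral[OF _ C le], simp)+
qed

lemma weight_integrable: "integrable lborel (\<lambda>x::real. 1 / (1 + x\<^sup>2))"
  using integrable_inverse_1_plus_square by (simp add: set_integrable_def inverse_eq_divide)

lemma weight_L2: "(\<lambda>x::real. of_real (1 / (1 + x\<^sup>2))) \<in> L2"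
proof (rule L2I)
  show "integrable lborel (\<lambda>x::real. (cmod (of_real (1 / (1 + x\<^sup>2))))\<^sup>2)"
  proof (rule Bochner_Integration.integrable_bound[OF weight_integrable])
    have "(1 / (1 + x\<^sup>2))\<^sup>2 \<le> 1 / (1 + x\<^sup>2)" for x :: real
      by (auto simp: power2_eq_square divide_simps add_nonneg_eq_0_iff) 
    then show "AE x in lborel. norm ((cmod (of_real (1 / (1 + x\<^sup>2))))\<^sup>2) \<le> norm (1 / (1 + x\<^sup>2)::real)"
      by (auto intro!: AE_I2 simp: norm_divide simp del: of_real_divide)
  qed measurable
qed measurable

text \<open>Riesz-Fischer. Along a subsequence the increments have norm at most
  \<open>(1/2)^k\<close>. On the line L2 is not contained in L1, so the increments are first
  multiplied by a strictly positive weight from L2: by Cauchy-Schwarz the products are summable in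
  L1, hence almost everywhere. Fatou then controls the whole sequence.\<close>

lemma L2_complete:
  assumes f: "\<And>n. f n \<in> L2" 
    and C: "\<And>e. e > 0 \<Longrightarrow> \<exists>N. \<forall>m\<ge>N. \<forall>n\<ge>N. L2_norm (\<lambda>x. f m x - f n x) < e"
  shows "\<exists>g\<in>L2. (\<lambda>n. L2_norm (\<lambda>x. f n x - g x)) \<longlonglongrightarrow> 0"
proof -
  note [measurable] = f[THEN L2_measurable]
  have "\<exists>N. \<forall>m\<ge>N. \<forall>n\<ge>N. L2_norm (\<lambda>x. f m x - f n x) < (1/2)^k" for k by (rule C) simp
  then obtain N where N: "\<And>k m n. m \<ge> N k \<Longrightarrow> n \<ge> N k \<Longrightarrow> L2_norm (\<lambda>x. f m x - f n x) < (1/2)^k"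
    by metis
  \<comment> \<open>Summing makes \<open>r\<close> monotone and at least \<open>N k\<close>; the
    extra \<open>k\<close> makes it tend to infinity.\<close>
  define r where "r k = (\<Sum>i\<le>k. N i) + k" for k
  have rN: "r k \<ge> N k" for k
  proof -
    have "N k \<le> (\<Sum>i\<le>k. N i)" by (rule member_le_sum) auto
    then show ?thesis by (simp add: r_def)
  qed
  have rS: "r (Suc k) \<ge> r k" for k by (simp add: r_def)
  have rk: "r k \<ge> k" for k by (simp add: r_def)
  define d where "d k x = f (r (Suc k)) x - f (r k) x" for k x
  have dL: "d k \<in> L2" for k unfolding d_def using L2_diff[OF f f] by simp
  note [measurable] = dL[THEN L2_measurable]
  have dn: "L2_norm (d k) \<le> (1/2)^k" for k
    unfolding d_def using N[of k "r (Suc k)" "r k"] rN[of k] rS[of k] by simp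
  define w where "w x = (of_real (1 / (1 + x\<^sup>2)) :: complex)" for x :: real
  have wL: "w \<in> L2" unfolding w_def by (rule weight_L2)
  note [measurable] = wL[THEN L2_measurable]
  have "(\<integral>\<^sup>+x. (\<Sum>k. ennreal (cmod (w x) * cmod (d k x))) \<partial>lborel) 
     = (\<Sum>k. \<integral>\<^sup>+x. ennreal (cmod (w x) * cmod (d k x)) \<partial>lborel)"
    by (rule nn_integral_suminf) auto
  also have "\<dots> \<le> (\<Sum>k. ennreal (L2_norm w * (1/2)^k))"
  proof (rule suminf_le)
    fix k
    have "(\<integral>\<^sup>+x. ennreal (cmod (w x) * cmod (d k x)) \<partial>lborel) = ennreal (LINT x|lborel. cmod (w x) * cmod (d k x))"
      by (rule nn_integral_eq_integral[OF L2_mult_integrable[OF wL dL]]) auto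
    also have "\<dots> \<le> ennreal (L2_norm w * (1/2)^k)"
    proof (rule ennreal_leI)
      have "(LINT x|lborel. cmod (w x) * cmod (d k x)) \<le> L2_norm w * L2_norm (d k)"
        by (rule L2_Cauchy_Schwarz[OF wL dL])
      also have "\<dots> \<le> L2_norm w * (1/2)^k" by (rule mult_left_mono[OF dn]) simp
      finally show "(LINT x|lborel. cmod (w x) * cmod (d k x)) \<le> L2_norm w * (1/2)^k" .
    qed
    finally show "(\<integral>\<^sup>+x. ennreal (cmod (w x) * cmod (d k x)) \<partial>lborel) \<le> ennreal (L2_norm w * (1/2)^k)" .
  qed auto
  also have "\<dots> = ennreal (\<Sum>k. L2_norm w * (1/2)^k)"
    by (rule suminf_ennreal2) (auto intro!: summable_mult summable_geometric)
  also have "\<dots> < \<infinity>" by simp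
  finally have "(\<integral>\<^sup>+x. (\<Sum>k. ennreal (cmod (w x) * cmod (d k x))) \<partial>lborel) \<noteq> \<infinity>" by simp
  then have "AE x in lborel. (\<Sum>k. ennreal (cmod (w x) * cmod (d k x))) \<noteq> \<infinity>"
    by (intro nn_integral_PInf_AE) auto
  then have AEc: "AE x in lborel. (\<lambda>k. f (r k) x) \<longlonglongrightarrow> lim (\<lambda>k. f (r k) x)"
  proof eventually_elim
    case (elim x)
    have wpos: "cmod (w x) > 0"
      unfolding w_def by (simp add: add_nonneg_eq_0_iff add_pos_nonneg del: of_real_divide)
    have "summable (\<lambda>k. cmod (w x) * cmod (d k x))"
      by (rule summable_suminf_not_top) (use elim in auto)
    then have "summable (\<lambda>k. cmod (d k x))" using wpos by (simp add: summable_cmult_iff)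
    then have "summable (\<lambda>k. d k x)" by (rule summable_norm_cancel)
    then obtain l where "(\<lambda>k. \<Sum>i<k. d i x) \<longlonglongrightarrow> l" by (auto simp: summable_def sums_def)
    moreover have "(\<Sum>i<k. d i x) = f (r k) x - f (r 0) x" for k
      unfolding d_def by (rule sum_lessThan_telescope)
    ultimately have "(\<lambda>k. f (r k) x - f (r 0) x + f (r 0) x) \<longlonglongrightarrow> l + f (r 0) x"
      by (intro tendsto_add) auto
    then have "convergent (\<lambda>k. f (r k) x)" by (auto simp: convergent_def)
    then show ?case by (simp add: convergent_LIMSEQ_iff)
  qed
  define g where "g x = lim (\<lambda>k. f (r k) x)" for x
  have [measurable]: "g \<in> borel_measurable borel" unfolding g_def by measurable
  have est: "(\<lambda>x. f n x - g x) \<in> L2 \<and> L2_norm (\<lambda>x. f n x - g x) \<le> e" 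
    if e: "\<forall>m\<ge>M. \<forall>n\<ge>M. L2_norm (\<lambda>x. f m x - f n x) < e" and n: "n \<ge> M" for n M e
  proof -
    have ev: "\<forall>\<^sub>F k in sequentially. L2_norm (\<lambda>x. f n x - f (r k) x) \<le> e"
      unfolding eventually_sequentially
    proof (intro exI allI impI)
      fix k assume "k \<ge> M"
      then have "r k \<ge> M" using rk[of k] by simp
      then show "L2_norm (\<lambda>x. f n x - f (r k) x) \<le> e" using e n by (auto intro: less_imp_le)
    qed
    have lim: "AE x in lborel. (\<lambda>k. f n x - f (r k) x) \<longlonglongrightarrow> f n x - g x"
      using AEc unfolding g_def by eventually_elim (intro tendsto_intros)
    have m: "(\<lambda>x. f n x - g x) \<in> borel_measurable borel" by measurable
    show ?thesis
      using L2_Fatou[OF _ m ev lim] L2_diff[OF f f] by blast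
  qed
  obtain M1 where "\<forall>m\<ge>M1. \<forall>n\<ge>M1. L2_norm (\<lambda>x. f m x - f n x) < 1" using C[of 1] by auto
  from est[OF this order_refl] have "(\<lambda>x. f M1 x - g x) \<in> L2" by simp
  from L2_diff[OF f[of M1] this] have gL: "g \<in> L2" by simp
  have "(\<lambda>n. L2_norm (\<lambda>x. f n x - g x)) \<longlonglongrightarrow> 0"
  proof (rule LIMSEQ_I)
    fix e :: real assume "e > 0"
    then obtain M where "\<forall>m\<ge>M. \<forall>n\<ge>M. L2_norm (\<lambda>x. f m x - f n x) < e/2" using C[of "e/2"] by auto
    from est[OF this] have "\<forall>n\<ge>M. norm (L2_norm (\<lambda>x. f n x - g x) - 0) < e" using \<open>e > 0\<close> by fastforce
    then show "\<exists>no. \<forall>n\<ge>no. norm (L2_norm (\<lambda>x. f n x - g x) - 0) < e" by blast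
  qed
  with gL show ?thesis by blast
qed

section \<open>Locally absolutely continuous functions\<close>

text \<open>The relation says that \<open>f\<close> is locally absolutely continuous with almost everywhere derivative \<open>g\<close>.\<close>

definition ac_deriv :: "(real \<Rightarrow> complex) \<Rightarrow> (real \<Rightarrow> complex) \<Rightarrow> bool" where
  "ac_deriv f g \<longleftrightarrow> g \<in> borel_measurable borel \<and>
     (\<forall>a b. a \<le> b \<longrightarrow> set_integrable lborel {a..b} g \<and> f b - f a = (LINT x:{a..b}|lborel. g x))"

lemma ac_deriv_measurable: "ac_deriv f g \<Longrightarrow> g \<in> borel_measurable borel"
  by (simp add: ac_deriv_def)

lemma ac_deriv_set_integrable: "ac_deriv f g \<Longrightarrow> set_integrable lborel {a..b} g"
  by (cases "a \<le> b") (auto simp: ac_deriv_def set_integrable_def)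

lemma ac_deriv_eq: "ac_deriv f g \<Longrightarrow> a \<le> b \<Longrightarrow> f b - f a = (LINT x:{a..b}|lborel. g x)"
  by (simp add: ac_deriv_def)

lemma ac_deriv_cong_AE:
  assumes "ac_deriv f g" "g' \<in> borel_measurable borel" "AE x in lborel. g x = g' x"
  shows "ac_deriv f g'"
  unfolding ac_deriv_def
proof (intro conjI allI impI)
  fix a b :: real assume ab: "a \<le> b"
  note [measurable] = ac_deriv_measurable[OF assms(1)] assms(2)
  have eq: "AE x in lborel. indicator {a..b} x *\<^sub>R g x = indicator {a..b} x *\<^sub>R g' x"
    using assms(3) by eventually_elim simp
  show "set_integrable lborel {a..b} g'"
    using ac_deriv_set_integrable[OF assms(1), of a b] unfolding set_integrable_def
    by (rule integrable_cong_AE_imp) (use eq in auto)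
  show "f b - f a = (LINT x:{a..b}|lborel. g' x)"
    unfolding ac_deriv_eq[OF assms(1) ab] set_lebesgue_integral_def
    by (rule integral_cong_AE) (use eq in auto)
qed (use assms in auto)

lemma ac_deriv_continuous: assumes "ac_deriv f g" shows "continuous_on S f"
proof -
  have "continuous_on {-M<..<M} f" for M :: real
  proof (cases "M > 0")
    case True
    have int: "g integrable_on {-M..M}"
      by (rule set_borel_integral_eq_integral(1)[OF ac_deriv_set_integrable[OF assms]])
    have "continuous_on {-M..M} (\<lambda>x. f (-M) + integral {-M..x} g)"
      by (intro continuous_intros indefinite_integral_continuous_1 int)
    moreover have "f (-M) + integral {-M..x} g = f x" if "x \<in> {-M..M}" for x
      using ac_deriv_eq[OF assms, of "-M" x] set_borel_integral_eq_integral(2)[OF ac_deriv_set_integrable[OF assms, of "-M" x]] that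
      by (simp add: algebra_simps)
    ultimately have "continuous_on {-M..M} f" by (blast intro: continuous_on_eq)
    then show ?thesis by (rule continuous_on_subset) auto
  qed simp
  then have "continuous_on (\<Union>M. {-M<..<M}) f" by (intro continuous_on_open_UN) auto
  moreover have "(\<Union>M::real. {-M<..<M}) = UNIV"
  proof -
    have "x \<in> {-(\<bar>x\<bar>+1)<..<\<bar>x\<bar>+1}" for x :: real by auto
    then show ?thesis by blast
  qed
  ultimately have "continuous_on UNIV f" by simp
  then show ?thesis by (rule continuous_on_subset) simp
qed

lemma ac_deriv_borel: "ac_deriv f g \<Longrightarrow> f \<in> borel_measurable borel"
  by (rule borel_measurable_continuous_onI) (rule ac_deriv_continuous)

lemma set_integrable_bound_mult:
  fixes f G :: "real \<Rightarrow> complex"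
  assumes f: "set_integrable lborel {a..b} f" and G: "continuous_on UNIV G"
  shows "set_integrable lborel {a..b} (\<lambda>x. f x * G x)"
proof -
  have "compact (G ` {a..b})" by (rule compact_continuous_image) (use G continuous_on_subset in auto)
  then obtain C where C: "\<And>x. x \<in> {a..b} \<Longrightarrow> cmod (G x) \<le> C"
    using compact_imp_bounded bounded_iff by (metis imageI)
  have [measurable]: "G \<in> borel_measurable borel" using G by (rule borel_measurable_continuous_onI)
  have [measurable]: "(\<lambda>x. indicator {a..b} x *\<^sub>R f x) \<in> borel_measurable lborel"
    using f unfolding set_integrable_def by (rule borel_measurable_integrable)
  have eq: "(\<lambda>x. indicator {a..b} x *\<^sub>R (f x * G x)) = (\<lambda>x. (indicator {a..b} x *\<^sub>R f x) * G x)"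
    by (auto simp: fun_eq_iff)
  show ?thesis
    unfolding set_integrable_def eq
  proof (rule Bochner_Integration.integrable_bound)
    show "integrable lborel (\<lambda>x. C * cmod (indicator {a..b} x *\<^sub>R f x))"
      by (intro integrable_mult_right integrable_norm f[unfolded set_integrable_def])
    show "(\<lambda>x. (indicator {a..b} x *\<^sub>R f x) * G x) \<in> borel_measurable lborel" by measurable
    have "cmod ((indicator {a..b} x *\<^sub>R f x) * G x) \<le> norm (C * cmod (indicator {a..b} x *\<^sub>R f x))" for x
    proof (cases "x \<in> {a..b}")
      case True
      then have "cmod (f x) * cmod (G x) \<le> cmod (f x) * \<bar>C\<bar>"
        using C[OF True] by (intro mult_left_mono) auto
      then show ?thesis using True by (simp add: norm_mult abs_mult mult.commute)
    qed simp
    then show "AE x in lborel. cmod ((indicator {a..b} x *\<^sub>R f x) * G x) \<le> norm (C * cmod (indicator {a..b} x *\<^sub>R f x))"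
      by simp
  qed
qed

lemma ac_deriv_add: "ac_deriv f f' \<Longrightarrow> ac_deriv g g' \<Longrightarrow> ac_deriv (\<lambda>x. f x + g x) (\<lambda>x. f' x + g' x)"
  by (auto simp: ac_deriv_def algebra_simps intro!: set_integral_add)

lemma ac_deriv_linear:
  assumes T: "bounded_linear T" and "ac_deriv f g" shows "ac_deriv (\<lambda>x. T (f x)) (\<lambda>x. T (g x))"
proof -
  interpret bounded_linear T by fact
  show ?thesis unfolding ac_deriv_def
  proof (intro conjI allI impI)
    show "(\<lambda>x. T (g x)) \<in> borel_measurable borel"
      using borel_measurable_continuous_on[OF linear_continuous_on[OF T] ac_deriv_measurable[OF assms(2)]] .
    fix a b :: real assume ab: "a \<le> b"
    have int: "integrable lborel (\<lambda>x. indicator {a..b} x *\<^sub>R g x)"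
      using ac_deriv_set_integrable[OF assms(2), of a b] unfolding set_integrable_def .
    show "set_integrable lborel {a..b} (\<lambda>x. T (g x))"
      using integrable_bounded_linear[OF T int] by (simp add: set_integrable_def scaleR)
    have "T (f b) - T (f a) = T (LINT x:{a..b}|lborel. g x)"
      using ac_deriv_eq[OF assms(2) ab] by (simp add: diff[symmetric])
    also have "\<dots> = (LINT x:{a..b}|lborel. T (g x))"
      unfolding set_lebesgue_integral_def
      using integral_bounded_linear[OF T int] by (simp add: scaleR)
    finally show "T (f b) - T (f a) = (LINT x:{a..b}|lborel. T (g x))" .
  qed
qed

lemma ac_deriv_cmult: "ac_deriv f g \<Longrightarrow> ac_deriv (\<lambda>x. c * f x) (\<lambda>x. c * g x)"
  by (rule ac_deriv_linear[OF bounded_linear_mult_right])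

lemma ac_deriv_scaleR: "ac_deriv f g \<Longrightarrow> ac_deriv (\<lambda>x. r *\<^sub>R f x) (\<lambda>x. r *\<^sub>R g x)"
  by (rule ac_deriv_linear[OF bounded_linear_scaleR_right])

lemma ac_deriv_cnj: "ac_deriv f g \<Longrightarrow> ac_deriv (\<lambda>x. cnj (f x)) (\<lambda>x. cnj (g x))"
  by (rule ac_deriv_linear[OF bounded_linear_cnj])

lemma ac_deriv_diff: "ac_deriv f f' \<Longrightarrow> ac_deriv g g' \<Longrightarrow> ac_deriv (\<lambda>x. f x - g x) (\<lambda>x. f' x - g' x)"
  using ac_deriv_add[of f f' "\<lambda>x. - g x" "\<lambda>x. - g' x"] ac_deriv_cmult[of g g' "-1"] by simp

lemma ac_deriv_const: "ac_deriv (\<lambda>x. c) (\<lambda>x. 0)"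
  by (simp add: ac_deriv_def set_integrable_def set_lebesgue_integral_def)

lemma ac_deriv_reflect:
  assumes "ac_deriv f g" shows "ac_deriv (\<lambda>x. f (- x)) (\<lambda>x. - g (- x))"
  unfolding ac_deriv_def
proof (intro conjI allI impI)
  note [measurable] = ac_deriv_measurable[OF assms]
  show "(\<lambda>x. - g (- x)) \<in> borel_measurable borel" by measurable
  fix a b :: real assume ab: "a \<le> b"
  have int: "integrable lborel (\<lambda>x. indicator {-b..-a} x *\<^sub>R g x)"
    using ac_deriv_set_integrable[OF assms, of "-b" "-a"] unfolding set_integrable_def .
  have ind: "indicator {-b..-a} (- x) = (indicator {a..b} x :: real)" for x
    by (auto simp: indicator_def)
  have "integrable lborel (\<lambda>x. indicator {-b..-a} (- x) *\<^sub>R g (- x))"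
    using lborel_integrable_real_affine[OF int, of "-1" 0] by simp
  then show "set_integrable lborel {a..b} (\<lambda>x. - g (- x))"
    unfolding set_integrable_def ind by simp
  have "f (- b) - f (- a) = - (LINT x|lborel. indicator {-b..-a} x *\<^sub>R g x)"
    using ac_deriv_eq[OF assms, of "-b" "-a"] ab by (simp add: set_lebesgue_integral_def algebra_simps)
  also have "\<dots> = - (LINT x|lborel. indicator {-b..-a} (- x) *\<^sub>R g (- x))"
    by (subst lborel_integral_real_affine[of "-1" _ 0]) auto
  also have "\<dots> = (LINT x:{a..b}|lborel. - g (- x))"
    unfolding ind set_lebesgue_integral_def by simp
  finally show "f (- b) - f (- a) = (LINT x:{a..b}|lborel. - g (- x))" .
qed

lemma ac_deriv_C1:
  assumes "\<And>x. (f has_vector_derivative g x) (at x)" "continuous_on UNIV g"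
  shows "ac_deriv f g"
  unfolding ac_deriv_def
proof (intro conjI allI impI)
  show "g \<in> borel_measurable borel" using assms(2) by (rule borel_measurable_continuous_onI)
  fix a b :: real assume ab: "a \<le> b"
  have c: "continuous_on {a..b} g" using assms(2) continuous_on_subset by auto
  show "set_integrable lborel {a..b} g" by (rule borel_integrable_atLeastAtMost'[OF c])
  show "f b - f a = (LINT x:{a..b}|lborel. g x)"
    unfolding set_lebesgue_integral_def
    by (rule integral_FTC_Icc[OF ab _ c, symmetric]) (use assms(1) has_vector_derivative_at_within in blast)
qed

lemma integrable_product_pair:
  fixes p q :: "real \<Rightarrow> complex"
  assumes p: "integrable lborel p" and q: "integrable lborel q"
  shows "integrable (lborel \<Otimes>\<^sub>M lborel) (\<lambda>(x, y). p x * q y)"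
proof (rule lborel_pair.Fubini_integrable)
  note [measurable] = borel_measurable_integrable[OF p] borel_measurable_integrable[OF q]
  show "(\<lambda>(x, y). p x * q y) \<in> borel_measurable (lborel \<Otimes>\<^sub>M lborel)" by measurable
  show "integrable lborel (\<lambda>x. LINT y|lborel. norm (case (x, y) of (x, y) \<Rightarrow> p x * q y))"
    using p by (simp add: norm_mult)
  show "AE x in lborel. integrable lborel (\<lambda>y. case (x, y) of (x, y) \<Rightarrow> p x * q y)"
    using q by simp
qed

text \<open>Fubini takes the place of pointwise differentiation. The double integral of
  \<open>f x * g y\<close> over the square is \<open>(F b - F a) * (G b - G a)\<close>; cutting the
  square along its diagonal gives two triangles, and integrating the inner variable over each one
  reproduces \<open>G - G a\<close> and \<open>F - F a\<close>.\<close>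

lemma ac_deriv_mult:
  assumes F: "ac_deriv F f" and G: "ac_deriv G g"
  shows "ac_deriv (\<lambda>x. F x * G x) (\<lambda>x. f x * G x + F x * g x)"
  unfolding ac_deriv_def
proof (intro conjI allI impI)
  note [measurable] = ac_deriv_measurable[OF F] ac_deriv_measurable[OF G] ac_deriv_borel[OF F] ac_deriv_borel[OF G]
  show "(\<lambda>x. f x * G x + F x * g x) \<in> borel_measurable borel" by measurable
  fix a b :: real assume ab: "a \<le> b"
  have i1: "set_integrable lborel {a..b} (\<lambda>x. f x * G x)"
    by (rule set_integrable_bound_mult[OF ac_deriv_set_integrable[OF F] ac_deriv_continuous[OF G]])
  have "set_integrable lborel {a..b} (\<lambda>x. g x * F x)"
    by (rule set_integrable_bound_mult[OF ac_deriv_set_integrable[OF G] ac_deriv_continuous[OF F]])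
  then have i2: "set_integrable lborel {a..b} (\<lambda>x. F x * g x)" by (simp add: mult.commute)
  show "set_integrable lborel {a..b} (\<lambda>x. f x * G x + F x * g x)"
    by (rule set_integral_add(1)[OF i1 i2])
  define p where "p x = indicator {a..b} x *\<^sub>R f x" for x
  define q where "q x = indicator {a..b} x *\<^sub>R g x" for x
  have p: "integrable lborel p" and q: "integrable lborel q"
    using ac_deriv_set_integrable[OF F, of a b] ac_deriv_set_integrable[OF G, of a b] 
    by (simp_all add: set_integrable_def p_def[abs_def] q_def[abs_def])
  note [measurable] = borel_measurable_integrable[OF p] borel_measurable_integrable[OF q]
  have Ip: "(LINT x|lborel. p x) = F b - F a" and Iq: "(LINT x|lborel. q x) = G b - G a"
    using ac_deriv_eq[OF F ab] ac_deriv_eq[OF G ab] by (simp_all add: p_def q_def set_lebesgue_integral_def)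
  have H: "integrable (lborel \<Otimes>\<^sub>M lborel) (\<lambda>(x, y). p x * q y)"
    by (rule integrable_product_pair[OF p q])
  define A where "A = {z :: real \<times> real. snd z \<le> fst z}"
  have [measurable]: "A \<in> sets (lborel \<Otimes>\<^sub>M lborel)"
    unfolding A_def lborel_prod sets_lborel by (intro borel_closed closed_Collect_le continuous_intros)
  have "- A = space (lborel \<Otimes>\<^sub>M lborel) - A" by (auto simp: space_pair_measure)
  then have mA: "- A \<in> sets (lborel \<Otimes>\<^sub>M lborel)" by (metis sets.compl_sets \<open>A \<in> sets (lborel \<Otimes>\<^sub>M lborel)\<close>)
  have K1: "integrable (lborel \<Otimes>\<^sub>M lborel) (\<lambda>z. indicator A z *\<^sub>R (case z of (x, y) \<Rightarrow> p x * q y))"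
    by (rule integrable_mult_indicator[OF _ H]) measurable
  have K2: "integrable (lborel \<Otimes>\<^sub>M lborel) (\<lambda>z. indicator (-A) z *\<^sub>R (case z of (x, y) \<Rightarrow> p x * q y))"
    by (rule integrable_mult_indicator[OF mA H])
  have Gx: "G x = G a + (LINT y|lborel. indicator A (x, y) *\<^sub>R q y)" if "x \<in> {a..b}" for x
  proof -
    have "G x - G a = (LINT y:{a..x}|lborel. g y)" using that by (intro ac_deriv_eq[OF G]) auto
    also have "\<dots> = (LINT y|lborel. indicator A (x, y) *\<^sub>R q y)"
      unfolding set_lebesgue_integral_def q_def A_def 
      by (intro Bochner_Integration.integral_cong) (use that in \<open>auto simp: indicator_def\<close>)
    finally show ?thesis by (simp add: algebra_simps)
  qed
  have Fy: "F y = F a + (LINT x|lborel. indicator (-A) (x, y) *\<^sub>R p x)" if "y \<in> {a..b}" for y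
  proof -
    have "F y - F a = (LINT x:{a..y}|lborel. f x)" using that by (intro ac_deriv_eq[OF F]) auto
    also have "\<dots> = (LINT x|lborel. indicator (-A) (x, y) *\<^sub>R p x)"
      unfolding set_lebesgue_integral_def 
    proof (rule integral_cong_AE)
      \<comment> \<open>The complement of \<open>A\<close> is the open triangle, so the section
        misses the point \<open>x = y\<close> of the closed interval; hence equality only almost
        everywhere.\<close>
      show "AE x in lborel. indicator {a..y} x *\<^sub>R f x = indicator (- A) (x, y) *\<^sub>R p x"
        using AE_lborel_singleton[of y]
        by eventually_elim (use that in \<open>auto simp: indicator_def A_def p_def\<close>)
      show "(\<lambda>x. indicator (- A) (x, y) *\<^sub>R p x) \<in> borel_measurable lborel"
        unfolding A_def by measurable
    qed simp
    finally show ?thesis by (simp add: algebra_simps)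
  qed
  have "(LINT x:{a..b}|lborel. f x * G x) = (LINT x|lborel. p x * G a + (LINT y|lborel. indicator A (x, y) *\<^sub>R (p x * q y)))"
    unfolding set_lebesgue_integral_def
  proof (rule Bochner_Integration.integral_cong[OF refl])
    fix x
    have "(LINT y|lborel. indicator A (x, y) *\<^sub>R (p x * q y)) = p x * (LINT y|lborel. indicator A (x, y) *\<^sub>R q y)"
      by (subst integral_mult_right_zero[symmetric]) (simp add: algebra_simps)
    then show "indicator {a..b} x *\<^sub>R (f x * G x) = p x * G a + (LINT y|lborel. indicator A (x, y) *\<^sub>R (p x * q y))"
      using Gx[of x] by (cases "x \<in> {a..b}") (auto simp: p_def algebra_simps)
  qed
  also have "\<dots> = (F b - F a) * G a + (LINT x|lborel. LINT y|lborel. indicator A (x, y) *\<^sub>R (p x * q y))"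
    using lborel_pair.integrable_fst'[OF K1] p by (subst Bochner_Integration.integral_add) (auto simp: Ip)
  finally have E1: "(LINT x:{a..b}|lborel. f x * G x) = (F b - F a) * G a + (LINT x|lborel. LINT y|lborel. indicator A (x, y) *\<^sub>R (p x * q y))" .
  have sw: "integrable lborel (\<lambda>y. LINT x|lborel. indicator (-A) (x, y) *\<^sub>R (p x * q y))"
    using lborel_pair.integrable_snd[of "\<lambda>x y. indicator (-A) (x, y) *\<^sub>R (p x * q y)"] K2 by (simp add: case_prod_beta')
  have "(LINT x:{a..b}|lborel. F x * g x) = (LINT y|lborel. q y * F a + (LINT x|lborel. indicator (-A) (x, y) *\<^sub>R (p x * q y)))"
    unfolding set_lebesgue_integral_def
  proof (rule Bochner_Integration.integral_cong[OF refl])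
    fix y
    have "(LINT x|lborel. indicator (-A) (x, y) *\<^sub>R (p x * q y)) = (LINT x|lborel. indicator (-A) (x, y) *\<^sub>R p x) * q y"
      by (subst integral_mult_left_zero[symmetric]) (simp add: algebra_simps)
    then show "indicator {a..b} y *\<^sub>R (F y * g y) = q y * F a + (LINT x|lborel. indicator (-A) (x, y) *\<^sub>R (p x * q y))"
      using Fy[of y] by (cases "y \<in> {a..b}") (auto simp: q_def algebra_simps)
  qed
  also have "\<dots> = (G b - G a) * F a + (LINT y|lborel. LINT x|lborel. indicator (-A) (x, y) *\<^sub>R (p x * q y))"
    using sw q by (subst Bochner_Integration.integral_add) (auto simp: Iq)
  also have "(LINT y|lborel. LINT x|lborel. indicator (-A) (x, y) *\<^sub>R (p x * q y))
      = (LINT x|lborel. LINT y|lborel. indicator (-A) (x, y) *\<^sub>R (p x * q y))"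
    using lborel_pair.Fubini_integral[of "\<lambda>x y. indicator (-A) (x, y) *\<^sub>R (p x * q y)"] K2 by (simp add: case_prod_beta')
  finally have E2: "(LINT x:{a..b}|lborel. F x * g x) = (G b - G a) * F a + (LINT x|lborel. LINT y|lborel. indicator (-A) (x, y) *\<^sub>R (p x * q y))" .
  have "(LINT x|lborel. LINT y|lborel. indicator A (x, y) *\<^sub>R (p x * q y)) + (LINT x|lborel. LINT y|lborel. indicator (-A) (x, y) *\<^sub>R (p x * q y))
     = (LINT z|(lborel \<Otimes>\<^sub>M lborel). indicator A z *\<^sub>R (case z of (x, y) \<Rightarrow> p x * q y)) 
       + (LINT z|(lborel \<Otimes>\<^sub>M lborel). indicator (-A) z *\<^sub>R (case z of (x, y) \<Rightarrow> p x * q y))"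
    using lborel_pair.integral_fst'[OF K1] lborel_pair.integral_fst'[OF K2] by simp
  also have "\<dots> = (LINT z|(lborel \<Otimes>\<^sub>M lborel). (case z of (x, y) \<Rightarrow> p x * q y))"
    by (subst Bochner_Integration.integral_add[symmetric, OF K1 K2])
       (intro Bochner_Integration.integral_cong refl, auto simp: indicator_def)
  also have "\<dots> = (LINT x|lborel. LINT y|lborel. p x * q y)"
    using lborel_pair.integral_fst'[OF H] by simp
  also have "\<dots> = (F b - F a) * (G b - G a)" by (simp add: Ip Iq)
  finally show "F b * G b - F a * G a = (LINT x:{a..b}|lborel. f x * G x + F x * g x)"
    unfolding set_integral_add(2)[OF i1 i2] E1 E2 by (simp add: algebra_simps)
qed

text \<open>The positive and negative parts of \<open>h\<close> are densities of two finite measures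
  that agree on all half lines, hence are equal; uniqueness of densities then identifies the two
  parts.\<close>

lemma AE_zero_if_tail_integrals_zero:
  fixes h :: "real \<Rightarrow> real"
  assumes h: "integrable lborel h" and z: "\<And>a. (LINT x:{a<..}|lborel. h x) = 0"
  shows "AE x in lborel. h x = 0"
proof -
  have [measurable]: "h \<in> borel_measurable borel" using borel_measurable_integrable[OF h] by simp
  have em: "emeasure (density lborel (\<lambda>x. ennreal (k x))) {a<..} = ennreal (LINT x:{a<..}|lborel. k x)"
    if k: "integrable lborel k" and nn: "\<And>x. 0 \<le> k x" for a and k :: "real \<Rightarrow> real"
  proof -
    have [measurable]: "k \<in> borel_measurable borel" using borel_measurable_integrable[OF k] by simp
    have "emeasure (density lborel (\<lambda>x. ennreal (k x))) {a<..} = (\<integral>\<^sup>+x. ennreal (indicator {a<..} x *\<^sub>R k x) \<partial>lborel)"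
      by (subst emeasure_density) (auto intro!: nn_integral_cong simp: indicator_def)
    also have "\<dots> = ennreal (LINT x:{a<..}|lborel. k x)"
      unfolding set_lebesgue_integral_def
      by (rule nn_integral_eq_integral[OF integrable_mult_indicator[OF _ k]]) (auto simp: nn)
    finally show ?thesis .
  qed
  have i1: "integrable lborel (\<lambda>x. max 0 (h x))" and i2: "integrable lborel (\<lambda>x. max 0 (- h x))"
    using h by (auto intro!: integrable_max)
  have eq: "(LINT x:{a<..}|lborel. max 0 (h x)) = (LINT x:{a<..}|lborel. max 0 (- h x))" for a
  proof -
    have s1: "set_integrable lborel {a<..} (\<lambda>x. max 0 (h x))" and s2: "set_integrable lborel {a<..} (\<lambda>x. max 0 (- h x))"
      unfolding set_integrable_def by (rule integrable_mult_indicator[OF _ i1], simp, rule integrable_mult_indicator[OF _ i2], simp)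
    have "(LINT x:{a<..}|lborel. h x) = (LINT x:{a<..}|lborel. max 0 (h x) - max 0 (- h x))"
      by (rule set_lebesgue_integral_cong) auto
    then show ?thesis using z[of a] set_integral_diff(2)[OF s1 s2] by simp
  qed
  have "density lborel (\<lambda>x. ennreal (max 0 (h x))) = density lborel (\<lambda>x. ennreal (max 0 (- h x)))"
  proof (rule measure_eqI_lessThan)
    have e1: "emeasure (density lborel (\<lambda>x. ennreal (max 0 (h x)))) {a<..} = ennreal (LINT x:{a<..}|lborel. max 0 (h x))" for a
      by (rule em[OF i1]) simp
    have e2: "emeasure (density lborel (\<lambda>x. ennreal (max 0 (- h x)))) {a<..} = ennreal (LINT x:{a<..}|lborel. max 0 (- h x))" for a
      by (rule em[OF i2]) simp
    show "emeasure (density lborel (\<lambda>x. ennreal (max 0 (h x)))) {a<..} < \<infinity>" for a unfolding e1 by simp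
    show "emeasure (density lborel (\<lambda>x. ennreal (max 0 (h x)))) {a<..} = emeasure (density lborel (\<lambda>x. ennreal (max 0 (- h x)))) {a<..}" for a
      unfolding e1 e2 eq ..
  qed simp_all
  then have "AE x in lborel. ennreal (max 0 (h x)) = ennreal (max 0 (- h x))"
    by (intro sigma_finite_measure.density_unique[OF sigma_finite_lborel]) auto
  then show ?thesis by eventually_elim (auto simp: max_def split: if_splits)
qed

lemma AE_zero_if_interval_integrals_zero_real:
  fixes g :: "real \<Rightarrow> real"
  assumes [measurable]: "g \<in> borel_measurable borel"
    and i: "\<And>a b. a \<le> b \<Longrightarrow> set_integrable lborel {a..b} g" 
    and z: "\<And>a b. a \<le> b \<Longrightarrow> (LINT x:{a..b}|lborel. g x) = 0"
  shows "AE x in lborel. g x = 0"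
proof -
  have "AE x in lborel. indicator {- real n..real n} x *\<^sub>R g x = 0" for n
  proof (rule AE_zero_if_tail_integrals_zero)
    show "integrable lborel (\<lambda>x. indicator {- real n..real n} x *\<^sub>R g x)"
      using i[of "- real n" "real n"] by (simp add: set_integrable_def)
    fix a
    \<comment> \<open>The outer \<open>max\<close> keeps the endpoints ordered, so that
      \<open>z\<close> applies even when \<open>a\<close> exceeds \<open>real n\<close>; in that
      case the second term cancels the first.\<close>
    have "(LINT x:{a<..}|lborel. indicator {- real n..real n} x *\<^sub>R g x) = (LINT x:{max a (- real n)..max (max a (- real n)) (real n)}|lborel. g x) - 
        (if max a (- real n) \<le> real n then 0 else (LINT x:{max a (- real n)..max (max a (- real n)) (real n)}|lborel. g x))"
    proof (cases "max a (- real n) \<le> real n")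
      case True
      have "(LINT x|lborel. indicator {a<..} x *\<^sub>R (indicator {- real n..real n} x *\<^sub>R g x)) =
          (LINT x|lborel. indicator {max a (- real n)..max (max a (- real n)) (real n)} x *\<^sub>R g x)"
      proof (rule integral_cong_AE)
        show "AE x in lborel. indicator {a<..} x *\<^sub>R (indicator {- real n..real n} x *\<^sub>R g x) =
          indicator {max a (- real n)..max (max a (- real n)) (real n)} x *\<^sub>R g x"
          using AE_lborel_singleton[of a] by eventually_elim (use True in \<open>auto simp: indicator_def max_def\<close>)
      qed measurable
      then show ?thesis using True by (simp add: set_lebesgue_integral_def)
    next
      case False
      then have "(LINT x:{a<..}|lborel. indicator {- real n..real n} x *\<^sub>R g x) = (LINT x:{a<..}|lborel. 0)"
        by (intro set_lebesgue_integral_cong) (auto simp: indicator_def)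
      then show ?thesis using False by (simp add: set_lebesgue_integral_def)
    qed
    then show "(LINT x:{a<..}|lborel. indicator {- real n..real n} x *\<^sub>R g x) = 0"
      using z[of a a] by (simp add: z)
  qed
  then have "AE x in lborel. \<forall>n. indicator {- real n..real n} x *\<^sub>R g x = 0" by (subst AE_all_countable) blast
  then show ?thesis
  proof eventually_elim
    case (elim x)
    obtain n where "\<bar>x\<bar> \<le> real n" using real_arch_simple by blast
    then have "x \<in> {- real n..real n}" by auto
    then show ?case using elim[rule_format, of n] by simp
  qed
qed

lemma AE_zero_if_interval_integrals_zero:
  fixes g :: "real \<Rightarrow> complex"
  assumes [measurable]: "g \<in> borel_measurable borel"
    and i: "\<And>a b. a \<le> b \<Longrightarrow> set_integrable lborel {a..b} g" 
    and z: "\<And>a b. a \<le> b \<Longrightarrow> (LINT x:{a..b}|lborel. g x) = 0"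
  shows "AE x in lborel. g x = 0"
proof -
  have "AE x in lborel. Re (g x) = 0"
  proof (rule AE_zero_if_interval_integrals_zero_real)
    fix a b :: real assume ab: "a \<le> b"
    have int: "integrable lborel (\<lambda>x. indicator {a..b} x *\<^sub>R g x)" using i[OF ab] by (simp add: set_integrable_def)
    show "set_integrable lborel {a..b} (\<lambda>x. Re (g x))" using integrable_Re[OF int] by (simp add: set_integrable_def)
    show "(LINT x:{a..b}|lborel. Re (g x)) = 0" using integral_Re[OF int] z[OF ab] by (simp add: set_lebesgue_integral_def)
  qed measurable
  moreover have "AE x in lborel. Im (g x) = 0"
  proof (rule AE_zero_if_interval_integrals_zero_real)
    fix a b :: real assume ab: "a \<le> b"
    have int: "integrable lborel (\<lambda>x. indicator {a..b} x *\<^sub>R g x)" using i[OF ab] by (simp add: set_integrable_def)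
    show "set_integrable lborel {a..b} (\<lambda>x. Im (g x))" using integrable_Im[OF int] by (simp add: set_integrable_def)
    show "(LINT x:{a..b}|lborel. Im (g x)) = 0" using integral_Im[OF int] z[OF ab] by (simp add: set_lebesgue_integral_def)
  qed measurable
  ultimately show ?thesis by eventually_elim (simp add: complex_eq_iff)
qed

lemma ac_deriv_unique:
  assumes "ac_deriv f g" "ac_deriv f g'" shows "AE x in lborel. g x = g' x"
proof -
  have "ac_deriv (\<lambda>x. 0) (\<lambda>x. g x - g' x)" using ac_deriv_diff[OF assms] by simp
  then have "AE x in lborel. g x - g' x = 0"
    by (intro AE_zero_if_interval_integrals_zero)
      (auto simp: ac_deriv_measurable ac_deriv_set_integrable dest: ac_deriv_eq[symmetric])
  then show ?thesis by simp
qed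

lemma L2_set_integrable: assumes "g \<in> L2" shows "set_integrable lborel {a..b::real} g"
proof -
  note [measurable] = L2_measurable[OF assms]
  have "set_integrable lborel {a..b} (\<lambda>x::real. 1::real)"
    by (rule borel_integrable_atLeastAtMost') auto
  then have "integrable lborel (\<lambda>x. indicator {a..b} x * 1 + (cmod (g x))\<^sup>2 :: real)"
    using L2_integrable[OF assms] by (intro Bochner_Integration.integrable_add) (auto simp: set_integrable_def)
  then show ?thesis
    unfolding set_integrable_def
  proof (rule Bochner_Integration.integrable_bound)
    have "cmod (indicator {a..b} x *\<^sub>R g x) \<le> indicator {a..b} x * 1 + (cmod (g x))\<^sup>2" for x
    proof (cases "x \<in> {a..b}")
      case True
      have "2 * cmod (g x) * 1 \<le> (cmod (g x))\<^sup>2 + 1\<^sup>2" by (rule sum_squares_bound)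
      then have "2 * cmod (g x) \<le> (cmod (g x))\<^sup>2 + 1" by simp
      then have "cmod (g x) \<le> 1 + (cmod (g x))\<^sup>2" using norm_ge_zero[of "g x"] by linarith
      then show ?thesis using True by simp
    qed simp
    then show "AE x in lborel. cmod (indicator {a..b} x *\<^sub>R g x) \<le> norm (indicator {a..b} x * 1 + (cmod (g x))\<^sup>2)"
      by (auto intro!: AE_I2)
  qed measurable
qed

lemma set_integral_combine:
  fixes g :: "real \<Rightarrow> complex"
  assumes "\<And>a b. set_integrable lborel {a..b} g" "a \<le> b" "b \<le> c"
  shows "(LINT x:{a..c}|lborel. g x) = (LINT x:{a..b}|lborel. g x) + (LINT x:{b..c}|lborel. g x)"
  using Henstock_Kurzweil_Integration.integral_combine[OF assms(2,3) set_borel_integral_eq_integral(1)[OF assms(1)]]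
  by (simp add: set_borel_integral_eq_integral(2)[OF assms(1)])

lemma ac_deriv_exists:
  assumes g: "g \<in> borel_measurable borel" and i: "\<And>a b. set_integrable lborel {a..b} g"
  shows "\<exists>F. ac_deriv F g"
proof -
  define F where "F x = (if 0 \<le> x then (LINT y:{0..x}|lborel. g y) else - (LINT y:{x..0}|lborel. g y))" for x
  have "F b - F a = (LINT x:{a..b}|lborel. g x)" if "a \<le> b" for a b
    using set_integral_combine[OF i, of a b 0] set_integral_combine[OF i, of a 0 b] set_integral_combine[OF i, of 0 a b] that
    by (auto simp: F_def)
  then have "ac_deriv F g" unfolding ac_deriv_def using g i by blast
  then show ?thesis by blast
qed

section \<open>Weak derivatives and absolute continuity\<close>

text \<open>The powers of \<open>1 / x\<close> are present because differentiation produces them: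
  with them the linear span of the family is closed under derivatives, and smoothness at the origin
  has to be checked for one derivative only.\<close>

definition pexp :: "real \<Rightarrow> nat \<Rightarrow> real \<Rightarrow> real" where
  "pexp c k x = (if x > 0 then (1 / x) ^ k * exp (- c / x) else 0)"

lemma pexp_tendsto_0: 
  assumes c: "c > 0" shows "((\<lambda>x. (1 / x) ^ k * exp (- c / x)) \<longlongrightarrow> 0) (at_right (0::real))"
proof -
  have l: "filterlim (\<lambda>x::real. c / x) at_top (at_right 0)"
    using filterlim_tendsto_pos_mult_at_top[OF tendsto_const c filterlim_inverse_at_top_right]
    by (simp add: divide_inverse)
  have "((\<lambda>x::real. (c / x) ^ k / exp (c / x)) \<longlongrightarrow> 0) (at_right 0)"
    by (rule filterlim_compose[OF tendsto_power_div_exp_0 l])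
  then have "((\<lambda>x::real. (1 / c) ^ k * ((c / x) ^ k / exp (c / x))) \<longlongrightarrow> (1 / c) ^ k * 0) (at_right 0)"
    by (rule tendsto_mult_left)
  then show ?thesis
    using c by (simp add: field_simps exp_minus)
qed

lemma pexp_DERIV:
  assumes c: "c > 0"
  shows "(pexp c k has_real_derivative (c * pexp c (k + 2) x - k * pexp c (k + 1) x)) (at x)"
proof -
  consider "x > 0" | "x < 0" | "x = 0" by linarith
  then show ?thesis
  proof cases
    case 1
    have "((\<lambda>x. (1 / x) ^ k * exp (- c / x)) has_real_derivative 
        (k * (1 / x) ^ (k - 1) * (- 1 / x\<^sup>2)) * exp (- c / x) + (1 / x) ^ k * (exp (- c / x) * (c / x\<^sup>2))) (at x)"
      using 1 by (auto intro!: derivative_eq_intros simp: power2_eq_square)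
    moreover have "(k * (1 / x) ^ (k - 1) * (- 1 / x\<^sup>2)) * exp (- c / x) + (1 / x) ^ k * (exp (- c / x) * (c / x\<^sup>2))
       = c * pexp c (k + 2) x - k * pexp c (k + 1) x"
      using 1 by (cases k) (auto simp: pexp_def power2_eq_square field_simps)
    ultimately have "((\<lambda>x. (1 / x) ^ k * exp (- c / x)) has_real_derivative (c * pexp c (k + 2) x - k * pexp c (k + 1) x)) (at x)"
      by simp
    then show ?thesis
      by (rule has_field_derivative_transform_within_open[of _ _ _ "{0<..}"]) (use 1 in \<open>auto simp: pexp_def\<close>)
  next
    case 2
    have "((\<lambda>x. 0) has_real_derivative 0) (at x)" by simp
    then have "(pexp c k has_real_derivative 0) (at x)"
      by (rule has_field_derivative_transform_within_open[of _ _ _ "{..<0}"]) (use 2 in \<open>auto simp: pexp_def\<close>)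
    then show ?thesis using 2 by (simp add: pexp_def)
  next
    case 3
    have "((\<lambda>h. (pexp c k h - pexp c k 0) / (h - 0)) \<longlongrightarrow> 0) (at 0)"
    proof (rule filterlim_split_at)
      have "((\<lambda>h::real. 0::real) \<longlongrightarrow> 0) (at_left 0)" by simp
      then show "((\<lambda>h. (pexp c k h - pexp c k 0) / (h - 0)) \<longlongrightarrow> 0) (at_left 0)"
        by (rule Lim_transform_eventually) 
          (auto simp: pexp_def eventually_at_filter intro!: always_eventually)
      \<comment> \<open>From the right, the difference quotient at 0 is
        \<open>pexp c (k + 1) h\<close> itself.\<close>
      show "((\<lambda>h. (pexp c k h - pexp c k 0) / (h - 0)) \<longlongrightarrow> 0) (at_right 0)"
        by (rule Lim_transform_eventually[OF pexp_tendsto_0[OF c, of "k + 1"]])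
          (auto simp: pexp_def eventually_at_filter intro!: always_eventually)
    qed
    then show ?thesis using 3 by (simp add: has_field_derivative_iff pexp_def)
  qed
qed

text \<open>The algebra is closed under differentiation, hence consists of smooth functions, and it contains
  the bumps \<open>exp (- c / (x - a) - c / (b - x))\<close>, which increase to the indicator of the interval
  \<open>(a, b)\<close> as \<open>c\<close> tends to 0.\<close>

inductive_set bump_algebra :: "(real \<Rightarrow> real) set" where
  "c > 0 \<Longrightarrow> (\<lambda>x. pexp c k (x - a)) \<in> bump_algebra"
| "c > 0 \<Longrightarrow> (\<lambda>x. pexp c k (b - x)) \<in> bump_algebra"
| "(\<lambda>x. r) \<in> bump_algebra"
| "f \<in> bump_algebra \<Longrightarrow> g \<in> bump_algebra \<Longrightarrow> (\<lambda>x. f x + g x) \<in> bump_algebra"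
| "f \<in> bump_algebra \<Longrightarrow> g \<in> bump_algebra \<Longrightarrow> (\<lambda>x. f x * g x) \<in> bump_algebra"

lemma bump_algebra_DERIV:
  "f \<in> bump_algebra \<Longrightarrow> \<exists>g\<in>bump_algebra. \<forall>x. (f has_real_derivative g x) (at x)"
proof (induction rule: bump_algebra.induct)
  case (1 c k a)
  have "(\<lambda>x. c * pexp c (k + 2) (x - a) + (- real k) * pexp c (k + 1) (x - a)) \<in> bump_algebra"
    by (intro bump_algebra.intros 1)
  moreover have "((\<lambda>x. pexp c k (x - a)) has_real_derivative (c * pexp c (k + 2) (x - a) + (- real k) * pexp c (k + 1) (x - a))) (at x)" for x
  proof -
    have "((\<lambda>x. x - a) has_real_derivative 1) (at x)" by (auto intro!: derivative_eq_intros)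
    from DERIV_chain2[where f="pexp c k" and g="\<lambda>x. x - a", OF pexp_DERIV[OF 1] this] show ?thesis by simp
  qed
  ultimately show ?case by (intro bexI[of _ "\<lambda>x. c * pexp c (k + 2) (x - a) + (- real k) * pexp c (k + 1) (x - a)"] allI)
next
  case (2 c k b)
  have "(\<lambda>x. (-c) * pexp c (k + 2) (b - x) + real k * pexp c (k + 1) (b - x)) \<in> bump_algebra"
    by (intro bump_algebra.intros 2)
  moreover have "((\<lambda>x. pexp c k (b - x)) has_real_derivative ((-c) * pexp c (k + 2) (b - x) + real k * pexp c (k + 1) (b - x))) (at x)" for x
  proof -
    have "((\<lambda>x. b - x) has_real_derivative -1) (at x)" by (auto intro!: derivative_eq_intros)
    from DERIV_chain2[where f="pexp c k" and g="\<lambda>x. b - x", OF pexp_DERIV[OF 2] this] show ?thesis by simp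
  qed
  ultimately show ?case by (intro bexI[of _ "\<lambda>x. (-c) * pexp c (k + 2) (b - x) + real k * pexp c (k + 1) (b - x)"] allI)
next
  case (3 r)
  have "(\<lambda>x. 0) \<in> bump_algebra" by (rule bump_algebra.intros)
  then show ?case by (rule bexI[rotated]) simp
next
  case (4 f g)
  then obtain f' g' where "f' \<in> bump_algebra" "g' \<in> bump_algebra" 
    "\<And>x. (f has_real_derivative f' x) (at x)" "\<And>x. (g has_real_derivative g' x) (at x)" by blast
  then show ?case by (intro bexI[of _ "\<lambda>x. f' x + g' x"] bump_algebra.intros allI DERIV_add)
next
  case (5 f g)
  then obtain f' g' where "f' \<in> bump_algebra" "g' \<in> bump_algebra" 
    "\<And>x. (f has_real_derivative f' x) (at x)" "\<And>x. (g has_real_derivative g' x) (at x)" by blast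
  with 5 show ?case by (intro bexI[of _ "\<lambda>x. f' x * g x + g' x * f x"] bump_algebra.intros allI DERIV_mult)
qed

lemma bump_algebra_funpow_deriv: "f \<in> bump_algebra \<Longrightarrow> (deriv ^^ k) f \<in> bump_algebra"
proof (induction k)
  case (Suc k)
  then obtain g where g: "g \<in> bump_algebra" "\<And>x. ((deriv ^^ k) f has_real_derivative g x) (at x)"
    using bump_algebra_DERIV by blast
  have "deriv ((deriv ^^ k) f) = g" using g(2) by (auto intro!: ext DERIV_imp_deriv)
  then show ?case using g by simp
qed simp

lemma bump_algebra_differentiable: "f \<in> bump_algebra \<Longrightarrow> ((deriv ^^ k) f) differentiable (at x)"
  using bump_algebra_DERIV[OF bump_algebra_funpow_deriv] by (metis real_differentiable_def)

lemma bump_algebra_continuous: "f \<in> bump_algebra \<Longrightarrow> continuous_on S f"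
  using bump_algebra_differentiable[of f 0]
  by (auto intro!: continuous_at_imp_continuous_on differentiable_imp_continuous_within)

definition bump :: "real \<Rightarrow> real \<Rightarrow> real \<Rightarrow> real \<Rightarrow> real" where
  "bump a b c x = pexp c 0 (x - a) * pexp c 0 (b - x)"

lemma bump_in_algebra: "c > 0 \<Longrightarrow> bump a b c \<in> bump_algebra"
  unfolding bump_def[abs_def] by (intro bump_algebra.intros)

lemma bump_eq: "bump a b c x = (if a < x \<and> x < b then exp (- c / (x - a)) * exp (- c / (b - x)) else 0)"
  by (auto simp: bump_def pexp_def)

lemma bump_nonneg: "0 \<le> bump a b c x" by (simp add: bump_eq)

lemma bump_le_1: "c > 0 \<Longrightarrow> bump a b c x \<le> 1"
  by (auto simp: bump_eq intro!: mult_le_one)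

lemma bump_support: "bump a b c x \<noteq> 0 \<Longrightarrow> x \<in> {a..b}"
  by (auto simp: bump_eq split: if_splits)

lemma integral_bump_pos:
  assumes c: "c > 0" and ab: "a < b" shows "integral {a..b} (bump a b c) > 0"
proof -
  have cont: "continuous_on {a..b} (bump a b c)" by (rule bump_algebra_continuous[OF bump_in_algebra[OF c]])
  have "integral {a..b} (bump a b c) \<noteq> 0"
  proof
    assume "integral {a..b} (bump a b c) = 0"
    then have "\<And>x. x \<in> {a..b} \<Longrightarrow> bump a b c x = 0"
      using integral_eq_0_iff[OF cont ab] bump_nonneg by auto
    then have "bump a b c ((a + b) / 2) = 0" using ab by simp
    then show False using ab by (simp add: bump_eq split: if_splits)
  qed
  moreover have "integral {a..b} (bump a b c) \<ge> 0"
    by (rule integral_nonneg[OF integrable_continuous_interval[OF cont]]) (simp add: bump_nonneg)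
  ultimately show ?thesis by simp
qed

text \<open>A primitive that vanishes to the left of the support stays constant to its right, and
  the constant is the total integral. A vanishing integral is therefore exactly what gives the
  primitive compact support.\<close>

lemma primitive_test_function:
  assumes z: "\<zeta> \<in> bump_algebra" and s: "\<And>x. \<zeta> x \<noteq> 0 \<Longrightarrow> x \<in> {m..M}" and mM: "m \<le> M"
    and i: "integral {m..M} \<zeta> = 0"
  shows "\<exists>\<phi>. test_function \<phi> \<and> deriv \<phi> = \<zeta>"
proof -
  have cont: "continuous_on S \<zeta>" for S by (rule bump_algebra_continuous[OF z])
  have int: "\<zeta> integrable_on {a..b}" for a b by (rule integrable_continuous_interval[OF cont])
  have zero: "integral {a..b} \<zeta> = 0" if "b \<le> m \<or> M \<le> a" for a b
  proof -
    have "integral {a..b} \<zeta> = integral {a..b} (\<lambda>x. 0)"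
    proof (rule integral_spike[of "{m, M}"])
      show "0 = \<zeta> x" if "x \<in> {a..b} - {m, M}" for x using s[of x] that \<open>b \<le> m \<or> M \<le> a\<close> by fastforce
    qed simp
    then show ?thesis by simp
  qed
  \<comment> \<open>Starting the integral one unit to the left of the support makes \<open>m\<close>
    an interior point, so that a single formula covers a neighbourhood of it.\<close>
  define \<phi> where "\<phi> x = (if x \<le> m then 0 else integral {m - 1..x} \<zeta>)" for x
  have phi2: "\<phi> x = integral {m - 1..x} \<zeta>" if "x > m - 1" for x
    using that zero[of x "m - 1"] by (auto simp: \<phi>_def)
  have D: "(\<phi> has_real_derivative \<zeta> x) (at x)" for x
  proof (cases "x < m")
    case True
    have "((\<lambda>x. 0) has_real_derivative 0) (at x)" by simp
    then have "(\<phi> has_real_derivative 0) (at x)"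
      by (rule has_field_derivative_transform_within_open[of _ _ _ "{..<m}"]) (use True in \<open>auto simp: \<phi>_def\<close>)
    then show ?thesis using True s[of x] by force
  next
    case False
    have "((\<lambda>u. integral {m - 1..u} \<zeta>) has_vector_derivative \<zeta> x) (at x within {m - 1..x + 1})"
      by (rule integral_has_vector_derivative[OF cont]) (use False in auto)
    then have "((\<lambda>u. integral {m - 1..u} \<zeta>) has_real_derivative \<zeta> x) (at x within {m - 1..x + 1})"
      by (simp add: has_real_derivative_iff_has_vector_derivative)
    then have "((\<lambda>u. integral {m - 1..u} \<zeta>) has_real_derivative \<zeta> x) (at x)"
      using at_within_Icc_at[of "m - 1" x "x + 1"] False by simp
    then show ?thesis
      by (rule has_field_derivative_transform_within_open[of _ _ _ "{m - 1<..}"]) (use False phi2 in auto)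
  qed
  have dphi: "deriv \<phi> = \<zeta>" using D by (auto intro!: ext DERIV_imp_deriv)
  have supp: "\<phi> x = 0" if "x \<notin> {m..M}" for x
  proof (cases "x \<le> m")
    case False
    then have "x > M" using that by auto
    then have "\<phi> x = integral {m - 1..m} \<zeta> + integral {m..M} \<zeta> + integral {M..x} \<zeta>"
      using False mM Henstock_Kurzweil_Integration.integral_combine[of "m - 1" m x \<zeta>]
        Henstock_Kurzweil_Integration.integral_combine[of m M x \<zeta>] by (simp add: \<phi>_def int)
    then show ?thesis using zero[of m "m - 1"] zero[of x M] i by simp
  qed (simp add: \<phi>_def)
  have "test_function \<phi>"
    unfolding test_function_def
  proof (intro conjI allI)
    fix k x
    show "(deriv ^^ k) \<phi> differentiable at x"
    proof (cases k)
      case 0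
      then show ?thesis using D by (auto simp: real_differentiable_def)
    next
      case (Suc n)
      then have "(deriv ^^ k) \<phi> = (deriv ^^ n) \<zeta>" using dphi by (simp add: funpow_swap1)
      then show ?thesis using bump_algebra_differentiable[OF z] by simp
    qed
    have "closure {x. \<phi> x \<noteq> 0} \<subseteq> {m..M}"
      by (rule closure_minimal) (use supp in blast, simp)
    then show "compact (closure {x. \<phi> x \<noteq> 0})"
      by (meson bounded_subset bounded_closed_interval closed_closure compact_eq_bounded_closed)
  qed
  then show ?thesis using dphi by blast
qed

section \<open>Test functions, weak derivatives and absolute continuity\<close>

lemma test_function_DERIV:
  assumes "test_function \<phi>"
  shows "(\<phi> has_real_derivative deriv \<phi> x) (at x)" "continuous_on S (deriv \<phi>)" "continuous_on S \<phi>"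
    "\<exists>M>0. \<forall>x. x \<notin> {-M..M} \<longrightarrow> \<phi> x = 0 \<and> deriv \<phi> x = 0"
proof -
  have d: "(deriv ^^ k) \<phi> differentiable (at x)" for k x using assms by (simp add: test_function_def)
  show D: "(\<phi> has_real_derivative deriv \<phi> x) (at x)" for x
    using d[of 0 x] DERIV_deriv_iff_real_differentiable by auto
  have "deriv \<phi> differentiable (at x)" for x using d[of 1 x] by simp
  then show "continuous_on S (deriv \<phi>)"
    by (auto intro!: continuous_at_imp_continuous_on differentiable_imp_continuous_within)
  show "continuous_on S \<phi>"
    using d[of 0] by (auto intro!: continuous_at_imp_continuous_on differentiable_imp_continuous_within)
  have "bounded {x. \<phi> x \<noteq> 0}"
    using assms unfolding test_function_def by (meson bounded_subset closure_subset compact_imp_bounded)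
  then obtain M where M: "M > 0" "\<And>x. \<phi> x \<noteq> 0 \<Longrightarrow> \<bar>x\<bar> \<le> M" 
    by (auto simp: bounded_pos)
  have "\<phi> x = 0 \<and> deriv \<phi> x = 0" if x: "x \<notin> {-M..M}" for x
  proof -
    have z: "\<phi> y = 0" if "y \<in> - {-M..M}" for y using M(2)[of y] that by force
    have "((\<lambda>x. 0) has_real_derivative 0) (at x)" by simp
    then have "(\<phi> has_real_derivative 0) (at x)"
      by (rule has_field_derivative_transform_within_open[of _ _ _ "- {-M..M}"]) (use x z in auto)
    then show ?thesis using z[of x] x D[of x] DERIV_unique by blast
  qed
  then show "\<exists>M>0. \<forall>x. x \<notin> {-M..M} \<longrightarrow> \<phi> x = 0 \<and> deriv \<phi> x = 0" using M(1) by blast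
qed

lemma ac_deriv_test_function:
  assumes "test_function \<phi>" shows "ac_deriv (\<lambda>x. of_real (\<phi> x)) (\<lambda>x. of_real (deriv \<phi> x))"
proof (rule ac_deriv_C1)
  show "continuous_on UNIV (\<lambda>x. complex_of_real (deriv \<phi> x))"
    by (intro continuous_intros test_function_DERIV(2)[OF assms])
  show "((\<lambda>x. complex_of_real (\<phi> x)) has_vector_derivative complex_of_real (deriv \<phi> x)) (at x)" for x
    by (intro has_vector_derivative_of_real test_function_DERIV(1)[OF assms])
qed

lemma ac_deriv_imp_weak_deriv:
  assumes f: "ac_deriv f g" shows "is_weak_deriv f g"
  unfolding is_weak_deriv_def
proof (intro allI impI)
  fix \<phi> assume t: "test_function \<phi>"
  obtain M where M: "M > 0" "\<And>x. x \<notin> {-M..M} \<Longrightarrow> \<phi> x = 0 \<and> deriv \<phi> x = 0"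
    using test_function_DERIV(4)[OF t] by blast
  have a: "ac_deriv (\<lambda>x. f x * of_real (\<phi> x)) (\<lambda>x. g x * of_real (\<phi> x) + f x * of_real (deriv \<phi> x))"
    by (rule ac_deriv_mult[OF f ac_deriv_test_function[OF t]])
  have i1: "set_integrable lborel {-(M+1)..M+1} (\<lambda>x. g x * of_real (\<phi> x))"
    by (rule set_integrable_bound_mult[OF ac_deriv_set_integrable[OF f]])
       (intro continuous_intros test_function_DERIV(3)[OF t])
  have c: "continuous_on {-(M+1)..M+1} (\<lambda>x. f x * complex_of_real (deriv \<phi> x))"
    by (intro continuous_intros test_function_DERIV(2)[OF t] ac_deriv_continuous[OF f])
  have i2: "set_integrable lborel {-(M+1)..M+1} (\<lambda>x. f x * of_real (deriv \<phi> x))"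
    by (rule borel_integrable_atLeastAtMost'[OF c])
  \<comment> \<open>\<open>\<phi>\<close> is known to vanish outside \<open>{-M..M}\<close>, hence
    at the endpoints of the interval enlarged by one; the boundary terms disappear there.\<close>
  have e: "0 = (LINT x:{-(M+1)..M+1}|lborel. g x * of_real (\<phi> x)) + (LINT x:{-(M+1)..M+1}|lborel. f x * of_real (deriv \<phi> x))"
    using ac_deriv_eq[OF a, of "-(M+1)" "M+1"] M(1) M(2)[of "M+1"] M(2)[of "-(M+1)"] set_integral_add(2)[OF i1 i2] by simp
  have 1: "(LINT x:{-(M+1)..M+1}|lborel. g x * of_real (\<phi> x)) = (LINT x|lborel. g x * of_real (\<phi> x))"
    unfolding set_lebesgue_integral_def
    by (intro Bochner_Integration.integral_cong refl) (use M(2) in \<open>fastforce simp: indicator_def\<close>)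
  have 2: "(LINT x:{-(M+1)..M+1}|lborel. f x * of_real (deriv \<phi> x)) = (LINT x|lborel. f x * of_real (deriv \<phi> x))"
    unfolding set_lebesgue_integral_def
    by (intro Bochner_Integration.integral_cong refl) (use M(2) in \<open>fastforce simp: indicator_def\<close>)
  show "(LINT x|lborel. f x * of_real (deriv \<phi> x)) = - (LINT x|lborel. g x * of_real (\<phi> x))"
    using e unfolding 1 2 by (simp add: eq_neg_iff_add_eq_0 add.commute)
qed

lemma mult_bump_integrable:
  assumes e: "\<And>a b. set_integrable lborel {a..b} (e :: real \<Rightarrow> complex)" and c: "c > 0"
  shows "integrable lborel (\<lambda>x. e x * of_real (bump a b c x))"
proof -
  have "set_integrable lborel {a..b} (\<lambda>x. e x * of_real (bump a b c x))"
    by (rule set_integrable_bound_mult[OF e]) (intro continuous_intros bump_algebra_continuous bump_in_algebra c)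
  moreover have "(\<lambda>x. indicator {a..b} x *\<^sub>R (e x * of_real (bump a b c x))) = (\<lambda>x. e x * of_real (bump a b c x))"
    using bump_support[of a b c] by (auto simp: fun_eq_iff indicator_def)
  ultimately show ?thesis by (simp add: set_integrable_def)
qed

text \<open>A bump minus the multiple of a fixed bump with the same integral is the derivative of a test
  function.\<close>

lemma zero_weak_deriv_imp_const:
  fixes e :: "real \<Rightarrow> complex"
  assumes [measurable]: "e \<in> borel_measurable borel" and i: "\<And>a b. set_integrable lborel {a..b} e"
    and w: "\<And>\<phi>. test_function \<phi> \<Longrightarrow> (LINT x|lborel. e x * of_real (deriv \<phi> x)) = 0"
  shows "\<exists>K. AE x in lborel. e x = K"
proof -
  define I where "I a b c = integral {a..b} (bump a b c)" for a b c
  have I0: "I 0 1 1 > 0" unfolding I_def by (rule integral_bump_pos) auto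
  \<comment> \<open>If \<open>e\<close> is constant, testing against the fixed bump leaves no other
    value.\<close>
  define K where "K = (LINT x|lborel. e x * of_real (bump 0 1 1 x)) / of_real (I 0 1 1)"
  note mb = mult_bump_integrable[OF i]
  have main: "(LINT x|lborel. e x * of_real (bump a b c x)) = of_real (I a b c) * K" if c: "c > 0" and ab: "a < b" for a b c
  proof -
    define \<kappa> where "\<kappa> = I a b c / I 0 1 1"
    define \<zeta> where "\<zeta> x = bump a b c x + (- \<kappa>) * bump 0 1 1 x" for x
    have z: "\<zeta> \<in> bump_algebra"
      unfolding \<zeta>_def[abs_def] by (intro bump_algebra.intros bump_in_algebra c) simp
    define m M where "m = min a 0" and "M = max b 1"
    have sub: "integral {m..M} (bump a' b' c') = I a' b' c'" if "m \<le> a'" "b' \<le> M" for a' b' c'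
    proof -
      have "bump a' b' c' = (\<lambda>x. if x \<in> {a'..b'} then bump a' b' c' x else 0)"
        using bump_support[of a' b' c'] by (auto simp: fun_eq_iff)
      then have "integral {m..M} (bump a' b' c') = integral ({a'..b'} \<inter> {m..M}) (bump a' b' c')"
        by (metis integral_restrict_Int)
      also have "{a'..b'} \<inter> {m..M} = {a'..b'}" using that by auto
      finally show ?thesis by (simp add: I_def)
    qed
    have int: "bump a' b' c' integrable_on {m..M}" if "c' > 0" for a' b' c'
      by (intro integrable_continuous_interval bump_algebra_continuous bump_in_algebra that)
    have "integral {m..M} \<zeta> = I a b c - \<kappa> * I 0 1 1"
    proof -
      have i2: "(\<lambda>x. (- \<kappa>) * bump 0 1 1 x) integrable_on {m..M}"
        by (intro integrable_continuous_interval continuous_intros bump_algebra_continuous bump_in_algebra) simp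
      have "m \<le> a" "b \<le> M" "m \<le> 0" "1 \<le> M" by (auto simp: m_def M_def)
      then show ?thesis
        unfolding \<zeta>_def Henstock_Kurzweil_Integration.integral_add[OF int[OF c] i2]
        using sub[of a b c] sub[of 0 1 1] by simp
    qed
    then have i0: "integral {m..M} \<zeta> = 0" using I0 by (simp add: \<kappa>_def)
    have s: "x \<in> {m..M}" if "\<zeta> x \<noteq> 0" for x
    proof -
      have "bump a b c x \<noteq> 0 \<or> bump 0 1 1 x \<noteq> 0" using that by (auto simp: \<zeta>_def)
      then show ?thesis using bump_support[of a b c x] bump_support[of 0 1 1 x] by (auto simp: m_def M_def)
    qed
    have mM: "m \<le> M" by (simp add: m_def M_def min_def max_def)
    obtain \<phi> where t: "test_function \<phi>" "deriv \<phi> = \<zeta>"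
      using primitive_test_function[OF z s mM i0] by blast
    have "0 = (LINT x|lborel. e x * of_real (\<zeta> x))" using w[OF t(1)] t(2) by simp
    also have "\<dots> = (LINT x|lborel. e x * of_real (bump a b c x) - of_real \<kappa> * (e x * of_real (bump 0 1 1 x)))"
      by (simp add: \<zeta>_def algebra_simps)
    also have "\<dots> = (LINT x|lborel. e x * of_real (bump a b c x)) - of_real \<kappa> * (LINT x|lborel. e x * of_real (bump 0 1 1 x))"
      using mb[OF c, of a b] mb[of 1 0 1] by simp
    finally show ?thesis using I0 by (simp add: \<kappa>_def K_def)
  qed
  have "AE x in lborel. e x - K = 0"
  proof (rule AE_zero_if_interval_integrals_zero)
    have ik: "set_integrable lborel {a..b} (\<lambda>x. K)" for a b :: real
      by (rule borel_integrable_atLeastAtMost') simp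
    have ie: "set_integrable lborel {a..b} (\<lambda>x. e x - K)" for a b
      by (rule set_integral_diff(1)[OF i ik])
    then show "set_integrable lborel {a..b} (\<lambda>x. e x - K)" for a b .
    fix a b :: real assume "a \<le> b"
    show "(LINT x:{a..b}|lborel. e x - K) = 0"
    proof (cases "a = b")
      case True
      have "(LINT x:{a..b}|lborel. e x - K) = (LINT x::real|lborel. (0::complex))"
        unfolding set_lebesgue_integral_def
      proof (rule integral_cong_AE)
        show "AE x in lborel. indicator {a..b} x *\<^sub>R (e x - K) = 0"
          using AE_lborel_singleton[of a] by eventually_elim (simp add: True)
      qed measurable
      then show ?thesis by simp
    next
      case False
      with \<open>a \<le> b\<close> have ab: "a < b" by simp
      define c where "c n = 1 / real (Suc n)" for n
      have c: "c n > 0" for n by (simp add: c_def)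
      have c0: "c \<longlonglongrightarrow> 0" unfolding c_def by (rule LIMSEQ_Suc[OF lim_1_over_n])
      have z: "(LINT x|lborel. (e x - K) * of_real (bump a b (c n) x)) = 0" for n
      proof -
        have "set_integrable lborel {a..b} (\<lambda>x. bump a b (c n) x)"
          by (intro borel_integrable_atLeastAtMost' bump_algebra_continuous bump_in_algebra c)
        then have "I a b (c n) = (LINT x:{a..b}|lborel. bump a b (c n) x)"
          unfolding I_def by (simp add: set_borel_integral_eq_integral(2))
        also have "\<dots> = (LINT x|lborel. bump a b (c n) x)"
          unfolding set_lebesgue_integral_def using bump_support[of a b "c n"]
          by (intro Bochner_Integration.integral_cong refl) (auto simp: indicator_def)
        finally have "(LINT x|lborel. K * of_real (bump a b (c n) x)) = K * of_real (I a b (c n))" by simp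
        moreover have "(LINT x|lborel. (e x - K) * of_real (bump a b (c n) x)) 
          = (LINT x|lborel. e x * of_real (bump a b (c n) x)) - (LINT x|lborel. K * of_real (bump a b (c n) x))"
          unfolding left_diff_distrib
          by (rule Bochner_Integration.integral_diff[OF mb[OF c] mult_bump_integrable[OF ik c]])
        ultimately show ?thesis using main[OF c ab] by (auto simp: mult.commute)
      qed
      have "(\<lambda>n. LINT x|lborel. (e x - K) * of_real (bump a b (c n) x)) \<longlonglongrightarrow> (LINT x|lborel. indicator {a..b} x *\<^sub>R (e x - K))"
      proof (rule integral_dominated_convergence[where w="\<lambda>x. cmod (indicator {a..b} x *\<^sub>R (e x - K))"])
        show "(\<lambda>x. (e x - K) * of_real (bump a b (c n) x)) \<in> borel_measurable lborel" for n
          using mult_bump_integrable[OF ie c] by (rule borel_measurable_integrable)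
        show "integrable lborel (\<lambda>x. cmod (indicator {a..b} x *\<^sub>R (e x - K)))"
          using ie[of a b] unfolding set_integrable_def by (rule integrable_norm)
        show "AE x in lborel. norm ((e x - K) * of_real (bump a b (c n) x)) \<le> cmod (indicator {a..b} x *\<^sub>R (e x - K))" for n
        proof (rule AE_I2)
          fix x
          show "norm ((e x - K) * of_real (bump a b (c n) x)) \<le> cmod (indicator {a..b} x *\<^sub>R (e x - K))"
            using bump_le_1[OF c, of a b n x] bump_nonneg[of a b "c n" x] bump_support[of a b "c n" x]
            by (cases "x \<in> {a..b}"; cases "bump a b (c n) x = 0") (auto simp: norm_mult mult_left_le)
        qed
        show "AE x in lborel. (\<lambda>n. (e x - K) * of_real (bump a b (c n) x)) \<longlonglongrightarrow> indicator {a..b} x *\<^sub>R (e x - K)"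
          using AE_lborel_singleton[of a] AE_lborel_singleton[of b]
        proof eventually_elim
          case (elim x)
          show ?case
          proof (cases "a < x \<and> x < b")
            case True
            have "(\<lambda>n. exp (- c n / (x - a)) * exp (- c n / (b - x))) \<longlonglongrightarrow> exp (- 0 / (x - a)) * exp (- 0 / (b - x))"
              using True by (intro tendsto_intros c0) auto
            then have "(\<lambda>n. bump a b (c n) x) \<longlonglongrightarrow> 1" using True by (simp add: bump_eq)
            then have "(\<lambda>n. (e x - K) * of_real (bump a b (c n) x)) \<longlonglongrightarrow> (e x - K) * of_real 1"
              by (intro tendsto_intros)
            then show ?thesis using True by simp
          next
            case False
            then show ?thesis using elim by (auto simp: bump_eq)
          qed
        qed
      qed measurable
      then have "0 = (LINT x|lborel. indicator {a..b} x *\<^sub>R (e x - K))" unfolding z by (rule LIMSEQ_unique[OF tendsto_const])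
      then show ?thesis unfolding set_lebesgue_integral_def by (rule sym)
    qed
  qed measurable
  then show ?thesis by auto
qed

text \<open>Du Bois-Reymond: any primitive of \<open>g\<close> has weak derivative \<open>g\<close>
  too, so its difference to \<open>f\<close> has weak derivative zero and is constant almost
  everywhere; the constant is absorbed into the primitive.\<close>

lemma weak_deriv_imp_ac_deriv:
  assumes f: "f \<in> L2" and g: "g \<in> L2" and w: "is_weak_deriv f g"
  shows "\<exists>F. ac_deriv F g \<and> (AE x in lborel. f x = F x)"
proof -
  obtain F where F: "ac_deriv F g" using ac_deriv_exists[OF L2_measurable[OF g] L2_set_integrable[OF g]] by blast
  note [measurable] = L2_measurable[OF f] ac_deriv_borel[OF F]
  have iF: "set_integrable lborel {a..b} F" for a b
    by (rule borel_integrable_atLeastAtMost'[OF ac_deriv_continuous[OF F]])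
  have "\<exists>K. AE x in lborel. f x - F x = K"
  proof (rule zero_weak_deriv_imp_const)
    show "set_integrable lborel {a..b} (\<lambda>x. f x - F x)" for a b
      by (rule set_integral_diff(1)[OF L2_set_integrable[OF f] iF])
    fix \<phi> assume t: "test_function \<phi>"
    obtain M where M: "M > 0" "\<And>x. x \<notin> {-M..M} \<Longrightarrow> \<phi> x = 0 \<and> deriv \<phi> x = 0"
      using test_function_DERIV(4)[OF t] by blast
    have int: "integrable lborel (\<lambda>x. h x * of_real (deriv \<phi> x))" if "set_integrable lborel {-M..M} h" for h :: "real \<Rightarrow> complex"
    proof -
      have "set_integrable lborel {-M..M} (\<lambda>x. h x * of_real (deriv \<phi> x))"
        by (rule set_integrable_bound_mult[OF that]) (intro continuous_intros test_function_DERIV(2)[OF t])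
      moreover have "(\<lambda>x. indicator {-M..M} x *\<^sub>R (h x * of_real (deriv \<phi> x))) = (\<lambda>x. h x * of_real (deriv \<phi> x))"
        using M(2) by (fastforce simp: fun_eq_iff indicator_def)
      ultimately show ?thesis by (simp add: set_integrable_def)
    qed
    have "(LINT x|lborel. (f x - F x) * of_real (deriv \<phi> x)) 
       = (LINT x|lborel. f x * of_real (deriv \<phi> x)) - (LINT x|lborel. F x * of_real (deriv \<phi> x))"
      unfolding left_diff_distrib
      by (rule Bochner_Integration.integral_diff[OF int[OF L2_set_integrable[OF f]] int[OF iF]])
    then show "(LINT x|lborel. (f x - F x) * of_real (deriv \<phi> x)) = 0"
      using w ac_deriv_imp_weak_deriv[OF F] t by (simp add: is_weak_deriv_def)
  qed measurable
  then obtain K where "AE x in lborel. f x - F x = K" by blast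
  then have "AE x in lborel. f x = F x + K" by eventually_elim (simp add: algebra_simps)
  moreover have "ac_deriv (\<lambda>x. F x + K) g" using ac_deriv_add[OF F ac_deriv_const[of K]] by simp
  ultimately show ?thesis by blast
qed

section \<open>The Hilbert space of continuous representatives\<close>

definition h11_set :: "(real \<Rightarrow> complex) set" where
  "h11_set = {f. \<exists>g. ac_deriv f g \<and> f \<in> L2 \<and> g \<in> L2 \<and> (\<lambda>x. of_real x * f x) \<in> L2}"

text \<open>Choosing the continuous representative makes elements genuine functions and point evaluation
  a bounded linear functional, so that integrals of curves can be evaluated pointwise.\<close>

typedef h11 = h11_set morphisms ev mk_h11
proof
  show "(\<lambda>x. 0) \<in> h11_set"
    unfolding h11_set_def using ac_deriv_const[of 0] L2_zero by auto
qed

text \<open>Only determined up to a null set.\<close>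

definition dv :: "h11 \<Rightarrow> real \<Rightarrow> complex" where
  "dv f = (SOME g. ac_deriv (ev f) g \<and> g \<in> L2)"

definition mx :: "h11 \<Rightarrow> real \<Rightarrow> complex" where
  "mx f x = of_real x * ev f x"

lemma h11_setD:
  shows ac_deriv_dv: "ac_deriv (ev f) (dv f)" and dv_L2: "dv f \<in> L2" and ev_L2: "ev f \<in> L2" and mx_L2: "mx f \<in> L2"
proof -
  have "ev f \<in> h11_set" by (rule ev)
  then obtain g where g: "ac_deriv (ev f) g" "ev f \<in> L2" "g \<in> L2" "(\<lambda>x. of_real x * ev f x) \<in> L2"
    by (auto simp: h11_set_def)
  have "ac_deriv (ev f) (dv f) \<and> dv f \<in> L2" unfolding dv_def by (rule someI[of _ g]) (use g in auto)
  then show "ac_deriv (ev f) (dv f)" "dv f \<in> L2" by auto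
  show "ev f \<in> L2" by fact
  show "mx f \<in> L2" using g(4) by (simp add: mx_def[abs_def])
qed

lemmas dv_measurable[measurable] = dv_L2[THEN L2_measurable]
lemmas ev_measurable[measurable] = ev_L2[THEN L2_measurable]
lemmas mx_measurable[measurable] = mx_L2[THEN L2_measurable]

lemma ev_continuous: "continuous_on S (ev f)"
  by (rule ac_deriv_continuous[OF ac_deriv_dv])

lemma dv_AE: "ac_deriv (ev f) g \<Longrightarrow> AE x in lborel. dv f x = g x"
  by (rule ac_deriv_unique[OF ac_deriv_dv])

lemma h11_setI: "ac_deriv f g \<Longrightarrow> f \<in> L2 \<Longrightarrow> g \<in> L2 \<Longrightarrow> (\<lambda>x. of_real x * f x) \<in> L2 \<Longrightarrow> f \<in> h11_set"
  by (auto simp: h11_set_def)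

lemma h11_eqI: "(\<And>x. ev f x = ev g x) \<Longrightarrow> f = g"
  by (simp add: ev_inject[symmetric] fun_eq_iff)

lemma continuous_AE_eq:
  fixes f g :: "real \<Rightarrow> complex"
  assumes "continuous_on UNIV f" "continuous_on UNIV g" "AE x in lborel. f x = g x"
  shows "f x = g x"
proof (rule ccontr)
  assume ne: "f x \<noteq> g x"
  have op: "open {x. f x \<noteq> g x}" using assms(1,2) by (rule open_Collect_neq)
  have "emeasure lborel {x. f x \<noteq> g x} = 0"
    using assms(3) op by (subst AE_iff_measurable[symmetric, where P="\<lambda>x. f x = g x"]) auto
  then have "{x. f x \<noteq> g x} \<in> null_sets lborel" using op by (auto simp: null_sets_def)
  then have "negligible {x. f x \<noteq> g x}"
    by (simp add: negligible_iff_null_sets null_sets_completionI)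
  then show False using open_not_negligible[OF op] ne by auto
qed

text \<open>Decay at infinity need not be established first: if \<open>cmod (p x)\<close> exceeded
  the L1 norm of \<open>q\<close>, then \<open>cmod p\<close> would stay above a positive constant
  on the whole half line to the left of \<open>x\<close>, and \<open>p\<close> would not be
  integrable.\<close>

lemma ac_deriv_sup_bound:
  assumes a: "ac_deriv p q" and p: "integrable lborel p" and q: "integrable lborel q"
  shows "cmod (p x) \<le> (LINT y|lborel. cmod (q y))"
proof (rule ccontr)
  define I where "I = (LINT y|lborel. cmod (q y))"
  assume "\<not> cmod (p x) \<le> (LINT y|lborel. cmod (q y))"
  then have c: "cmod (p x) - I > 0" by (simp add: I_def)
  have low: "cmod (p x) - I \<le> cmod (p y)" if "y \<le> x" for y
  proof -
    have "p x - p y = (LINT z:{y..x}|lborel. q z)" by (rule ac_deriv_eq[OF a that])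
    then have "cmod (p x - p y) \<le> (LINT z|lborel. cmod (indicator {y..x} z *\<^sub>R q z))"
      by (simp add: set_lebesgue_integral_def del: norm_scaleR)
    also have "\<dots> \<le> I"
      unfolding I_def
    proof (rule integral_mono)
      show "integrable lborel (\<lambda>z. cmod (indicator {y..x} z *\<^sub>R q z))"
        by (intro integrable_norm integrable_mult_indicator q) simp
      show "integrable lborel (\<lambda>z. cmod (q z))" by (intro integrable_norm q)
    qed (auto simp: indicator_def)
    finally show ?thesis using norm_triangle_ineq2[of "p x" "p y"] by simp
  qed
  obtain n :: nat where n: "(LINT y|lborel. cmod (p y)) < n * (cmod (p x) - I)"
    using reals_Archimedean3[OF c] by blast
  have "n * (cmod (p x) - I) = (LINT y|lborel. indicator {x - n..x} y * (cmod (p x) - I))"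
    by simp
  also have "\<dots> \<le> (LINT y|lborel. cmod (p y))"
  proof (rule integral_mono)
    show "integrable lborel (\<lambda>y. indicator {x - n..x} y * (cmod (p x) - I))"
      by (intro integrable_mult_left integrable_real_indicator) auto
    show "integrable lborel (\<lambda>y. cmod (p y))" by (intro integrable_norm p)
  qed (use low in \<open>auto simp: indicator_def\<close>)
  finally show False using n by simp
qed

lemma L2_mult_integrable_complex:
  assumes "f \<in> L2" "g \<in> L2" shows "integrable lborel (\<lambda>x. f x * g x)"
  by (rule Bochner_Integration.integrable_bound[OF L2_mult_integrable[OF assms]])
    (use assms[THEN L2_measurable] in \<open>auto simp: norm_mult\<close>)

text \<open>The preceding bound is applied to \<open>|f|\<^sup>2\<close>, whose derivative is at
  most \<open>2 |f| |f'|\<close>; Cauchy-Schwarz does the rest.\<close>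

lemma ev_sup_L2: "(cmod (ev f x))\<^sup>2 \<le> 2 * L2_norm (ev f) * L2_norm (dv f)"
proof -
  define p where "p x = ev f x * cnj (ev f x)" for x
  define q where "q x = dv f x * cnj (ev f x) + ev f x * cnj (dv f x)" for x
  have a: "ac_deriv p q" unfolding p_def[abs_def] q_def[abs_def] by (intro ac_deriv_mult ac_deriv_cnj ac_deriv_dv)
  have ip': "integrable lborel p" unfolding p_def[abs_def] by (intro L2_mult_integrable_complex L2_cnj ev_L2)
  have iq: "integrable lborel q" unfolding q_def[abs_def]
    by (intro Bochner_Integration.integrable_add L2_mult_integrable_complex L2_cnj ev_L2 dv_L2)
  have i: "integrable lborel (\<lambda>y. cmod (ev f y) * cmod (dv f y))" by (intro L2_mult_integrable ev_L2 dv_L2)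
  have "(cmod (ev f x))\<^sup>2 = cmod (p x)" by (simp add: p_def norm_mult power2_eq_square)
  also have "\<dots> \<le> (LINT y|lborel. cmod (q y))" by (rule ac_deriv_sup_bound[OF a ip' iq])
  also have "\<dots> \<le> (LINT y|lborel. 2 * (cmod (ev f y) * cmod (dv f y)))"
  proof (rule integral_mono)
    show "integrable lborel (\<lambda>y. 2 * (cmod (ev f y) * cmod (dv f y)))" using i by simp
    show "cmod (q y) \<le> 2 * (cmod (ev f y) * cmod (dv f y))" for y
      unfolding q_def by (rule norm_triangle_le) (simp add: norm_mult)
  qed (intro integrable_norm iq)
  also have "\<dots> \<le> 2 * (L2_norm (ev f) * L2_norm (dv f))"
    using L2_Cauchy_Schwarz[OF ev_L2 dv_L2, of f f] i by simp
  finally show ?thesis by simp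
qed

lemma mk_h11:
  assumes "ac_deriv f g" "f \<in> L2" "g \<in> L2" "(\<lambda>x. of_real x * f x) \<in> L2"
  shows ev_mk: "ev (mk_h11 f) = f" and dv_mk: "AE x in lborel. dv (mk_h11 f) x = g x"
proof -
  show e: "ev (mk_h11 f) = f" by (rule mk_h11_inverse[OF h11_setI[OF assms]])
  show "AE x in lborel. dv (mk_h11 f) x = g x" by (rule dv_AE) (simp add: e assms)
qed

section \<open>Vector space structure, inner product and completeness\<close>

instantiation h11 :: real_vector
begin

definition "0 = mk_h11 (\<lambda>x. 0)"
definition "f + g = mk_h11 (\<lambda>x. ev f x + ev g x)"
definition "f - g = mk_h11 (\<lambda>x. ev f x - ev g x)"
definition "- f = mk_h11 (\<lambda>x. - ev f x)" for f :: h11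
definition "r *\<^sub>R f = mk_h11 (\<lambda>x. r *\<^sub>R ev f x)"

lemma ev_zero: "ev 0 = (\<lambda>x. 0)"
  unfolding zero_h11_def by (rule ev_mk[OF ac_deriv_const]) (use L2_zero in auto)

lemma ev_add: "ev (f + g) = (\<lambda>x. ev f x + ev g x)"
  unfolding plus_h11_def
  using L2_add[OF mx_L2 mx_L2, of f g]
  by (intro ev_mk[OF ac_deriv_add[OF ac_deriv_dv ac_deriv_dv]] L2_add ev_L2 dv_L2) (simp add: mx_def[abs_def] algebra_simps)

lemma ev_diff: "ev (f - g) = (\<lambda>x. ev f x - ev g x)"
  unfolding minus_h11_def
  using L2_diff[OF mx_L2 mx_L2, of f g]
  by (intro ev_mk[OF ac_deriv_diff[OF ac_deriv_dv ac_deriv_dv]] L2_diff ev_L2 dv_L2) (simp add: mx_def[abs_def] algebra_simps)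

lemma ev_uminus: "ev (- f) = (\<lambda>x. - ev f x)"
  unfolding uminus_h11_def
  using L2_uminus[OF mx_L2, of f] ac_deriv_cmult[OF ac_deriv_dv, of "-1" f]
  by (intro ev_mk[where g="\<lambda>x. - dv f x"] L2_uminus ev_L2 dv_L2) (simp_all add: mx_def[abs_def] algebra_simps)

lemma ev_scaleR: "ev (r *\<^sub>R f) = (\<lambda>x. r *\<^sub>R ev f x)"
  unfolding scaleR_h11_def
  using L2_scaleR[OF mx_L2, of r f] ac_deriv_scaleR[OF ac_deriv_dv, of r f]
  by (intro ev_mk[where g="\<lambda>x. r *\<^sub>R dv f x"] L2_scaleR ev_L2 dv_L2) (simp_all add: mx_def[abs_def] algebra_simps)

instance
  by standard (auto intro!: h11_eqI simp: ev_zero ev_add ev_diff ev_uminus ev_scaleR algebra_simps)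

end

lemma dv_add: "AE x in lborel. dv (f + g) x = dv f x + dv g x"
  by (rule dv_AE) (simp add: ev_add ac_deriv_add ac_deriv_dv)

lemma dv_diff: "AE x in lborel. dv (f - g) x = dv f x - dv g x"
  by (rule dv_AE) (simp add: ev_diff ac_deriv_diff ac_deriv_dv)

lemma dv_scaleR: "AE x in lborel. dv (r *\<^sub>R f) x = r *\<^sub>R dv f x"
  by (rule dv_AE) (simp only: ev_scaleR ac_deriv_scaleR ac_deriv_dv)

lemma mx_add: "mx (f + g) = (\<lambda>x. mx f x + mx g x)"
  by (simp add: fun_eq_iff mx_def ev_add algebra_simps)

lemma mx_diff: "mx (f - g) = (\<lambda>x. mx f x - mx g x)"
  by (simp add: fun_eq_iff mx_def ev_diff algebra_simps)

lemma mx_scaleR: "mx (r *\<^sub>R f) = (\<lambda>x. r *\<^sub>R mx f x)"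
  by (simp add: fun_eq_iff mx_def ev_scaleR algebra_simps)

text \<open>The three summands of the inner product are kept apart because, taken on the profile,
  each obeys its own law: mass, kinetic energy and pseudoconformal moment.\<close>

definition E0 :: "h11 \<Rightarrow> h11 \<Rightarrow> real" where "E0 f g = ip (ev f) (ev g)"
definition E1 :: "h11 \<Rightarrow> h11 \<Rightarrow> real" where "E1 f g = ip (dv f) (dv g)"
definition E2 :: "h11 \<Rightarrow> h11 \<Rightarrow> real" where "E2 f g = ip (mx f) (mx g)"

lemma E_commute: "E0 f g = E0 g f" "E1 f g = E1 g f" "E2 f g = E2 g f"
  by (simp_all add: E0_def E1_def E2_def ip_commute)

lemma E_self: "E0 f f = (L2_norm (ev f))\<^sup>2" "E1 f f = (L2_norm (dv f))\<^sup>2" "E2 f f = (L2_norm (mx f))\<^sup>2"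
  by (simp_all add: E0_def E1_def E2_def ip_self)

lemma E_add_left: "E0 (f + g) h = E0 f h + E0 g h" "E1 (f + g) h = E1 f h + E1 g h" "E2 (f + g) h = E2 f h + E2 g h"
proof -
  show "E0 (f + g) h = E0 f h + E0 g h" by (simp add: E0_def ev_add ip_add_left ev_L2)
  show "E2 (f + g) h = E2 f h + E2 g h" by (simp add: E2_def mx_add ip_add_left mx_L2)
  have "E1 (f + g) h = ip (\<lambda>x. dv f x + dv g x) (dv h)"
    unfolding E1_def by (rule ip_cong_AE) (use dv_add in auto)
  then show "E1 (f + g) h = E1 f h + E1 g h" by (simp add: E1_def ip_add_left dv_L2)
qed

lemma E_scaleR_left: "E0 (r *\<^sub>R f) h = r * E0 f h" "E1 (r *\<^sub>R f) h = r * E1 f h" "E2 (r *\<^sub>R f) h = r * E2 f h"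
proof -
  show "E0 (r *\<^sub>R f) h = r * E0 f h" by (simp only: E0_def ev_scaleR ip_scaleR_left)
  show "E2 (r *\<^sub>R f) h = r * E2 f h" by (simp only: E2_def mx_scaleR ip_scaleR_left)
  have "E1 (r *\<^sub>R f) h = ip (\<lambda>x. r *\<^sub>R dv f x) (dv h)"
    unfolding E1_def by (rule ip_cong_AE) (use dv_scaleR in auto)
  then show "E1 (r *\<^sub>R f) h = r * E1 f h" by (simp only: E1_def ip_scaleR_left)
qed

instantiation h11 :: real_inner
begin

definition "inner f g = E0 f g + E1 f g + E2 f g"
definition "norm (f :: h11) = sqrt (inner f f)"
definition "sgn (f :: h11) = f /\<^sub>R norm f"
definition "dist (f :: h11) g = norm (f - g)"
definition [code del]: "(uniformity :: (h11 \<times> h11) filter) = (INF e\<in>{0 <..}. principal {(x, y). dist x y < e})"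
definition [code del]: "open (U :: h11 set) = (\<forall>x\<in>U. eventually (\<lambda>(x', y). x' = x \<longrightarrow> y \<in> U) uniformity)"

instance
proof
  fix x y z :: h11 and r :: real
  show "inner x y = inner y x" by (simp add: inner_h11_def E_commute[of x y])
  show "inner (x + y) z = inner x z + inner y z" by (simp add: inner_h11_def E_add_left)
  show "inner (r *\<^sub>R x) y = r * inner x y" by (simp add: inner_h11_def E_scaleR_left algebra_simps)
  show "0 \<le> inner x x" by (simp add: inner_h11_def E_self)
  show "inner x x = 0 \<longleftrightarrow> x = 0"
  proof
    assume "inner x x = 0"
    then have "(L2_norm (ev x))\<^sup>2 = 0" by (simp add: inner_h11_def E_self add_nonneg_eq_0_iff)
    then have "AE t in lborel. ev x t = 0" by (intro L2_norm_eq_0_AE ev_L2) simp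
    then have "ev x t = 0" for t by (intro continuous_AE_eq[of "ev x" "\<lambda>t. 0"] ev_continuous) auto
    then show "x = 0" by (intro h11_eqI) (simp add: ev_zero)
  next
    assume "x = 0"
    then have "inner x x = inner (0 *\<^sub>R x) x" by simp
    also have "\<dots> = 0" by (simp only: inner_h11_def E_scaleR_left)
    finally show "inner x x = 0" .
  qed
qed (rule dist_h11_def norm_h11_def sgn_h11_def uniformity_h11_def open_h11_def)+

end

lemma norm_h11_power2: "(norm f)\<^sup>2 = (L2_norm (ev f))\<^sup>2 + (L2_norm (dv f))\<^sup>2 + (L2_norm (mx f))\<^sup>2"
  for f :: h11
  by (simp add: norm_h11_def inner_h11_def E_self)

lemma L2_norm_ev_le: "L2_norm (ev f) \<le> norm f" and L2_norm_dv_le: "L2_norm (dv f) \<le> norm f" 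
  and L2_norm_mx_le: "L2_norm (mx f) \<le> norm f"
  by (rule power2_le_imp_le; simp add: norm_h11_power2)+

lemma norm_h11_le: "norm f \<le> L2_norm (ev f) + L2_norm (dv f) + L2_norm (mx f)" for f :: h11
  by (rule power2_le_imp_le) (simp_all add: norm_h11_power2 power2_sum distrib_left distrib_right)

lemma ev_sup: "cmod (ev f x) \<le> norm f"
proof (rule power2_le_imp_le)
  have "(cmod (ev f x))\<^sup>2 \<le> 2 * L2_norm (ev f) * L2_norm (dv f)" by (rule ev_sup_L2)
  also have "\<dots> \<le> (L2_norm (ev f))\<^sup>2 + (L2_norm (dv f))\<^sup>2" by (rule sum_squares_bound)
  also have "\<dots> \<le> (norm f)\<^sup>2" by (simp add: norm_h11_power2)
  finally show "(cmod (ev f x))\<^sup>2 \<le> (norm f)\<^sup>2" .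
qed simp

lemma bounded_linear_ev: "bounded_linear (\<lambda>f. ev f x)"
  by (rule bounded_linear_intro[where K=1]) (auto simp: ev_add ev_scaleR ev_sup)

lemma E0_bilinear: "bounded_bilinear E0"
proof
  show "E0 (a + a') b = E0 a b + E0 a' b" for a a' b by (rule E_add_left)
  then show "E0 b (a + a') = E0 b a + E0 b a'" for a a' b by (simp only: E_commute(1)[of b])
  show "E0 (r *\<^sub>R a) b = r *\<^sub>R E0 a b" for r a b by (simp add: E_scaleR_left)
  then show "E0 b (r *\<^sub>R a) = r *\<^sub>R E0 b a" for r a b by (simp only: E_commute(1)[of b])
  have "\<bar>E0 a b\<bar> \<le> norm a * norm b" for a b
    unfolding E0_def using ip_le[OF ev_L2 ev_L2] L2_norm_ev_le[of a] L2_norm_ev_le[of b]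
    by (meson L2_norm_nonneg mult_mono norm_ge_zero order_trans)
  then show "\<exists>K. \<forall>a b. norm (E0 a b) \<le> norm a * norm b * K" by (intro exI[of _ 1]) simp
qed

lemma E1_bilinear: "bounded_bilinear E1"
proof
  show "E1 (a + a') b = E1 a b + E1 a' b" for a a' b by (rule E_add_left)
  then show "E1 b (a + a') = E1 b a + E1 b a'" for a a' b by (simp only: E_commute(2)[of b])
  show "E1 (r *\<^sub>R a) b = r *\<^sub>R E1 a b" for r a b by (simp add: E_scaleR_left)
  then show "E1 b (r *\<^sub>R a) = r *\<^sub>R E1 b a" for r a b by (simp only: E_commute(2)[of b])
  have "\<bar>E1 a b\<bar> \<le> norm a * norm b" for a b
    unfolding E1_def using ip_le[OF dv_L2 dv_L2] L2_norm_dv_le[of a] L2_norm_dv_le[of b]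
    by (meson L2_norm_nonneg mult_mono norm_ge_zero order_trans)
  then show "\<exists>K. \<forall>a b. norm (E1 a b) \<le> norm a * norm b * K" by (intro exI[of _ 1]) simp
qed

lemma E2_bilinear: "bounded_bilinear E2"
proof
  show "E2 (a + a') b = E2 a b + E2 a' b" for a a' b by (rule E_add_left)
  then show "E2 b (a + a') = E2 b a + E2 b a'" for a a' b by (simp only: E_commute(3)[of b])
  show "E2 (r *\<^sub>R a) b = r *\<^sub>R E2 a b" for r a b by (simp add: E_scaleR_left)
  then show "E2 b (r *\<^sub>R a) = r *\<^sub>R E2 b a" for r a b by (simp only: E_commute(3)[of b])
  have "\<bar>E2 a b\<bar> \<le> norm a * norm b" for a b
    unfolding E2_def using ip_le[OF mx_L2 mx_L2] L2_norm_mx_le[of a] L2_norm_mx_le[of b]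
    by (meson L2_norm_nonneg mult_mono norm_ge_zero order_trans)
  then show "\<exists>K. \<forall>a b. norm (E2 a b) \<le> norm a * norm b * K" by (intro exI[of _ 1]) simp
qed

lemma L2_norm_dv_diff: "L2_norm (dv (f - g)) = L2_norm (\<lambda>x. dv f x - dv g x)"
  by (rule L2_norm_cong_AE) (use dv_diff in auto)

text \<open>Point evaluation is bounded, so a Cauchy sequence has a pointwise limit
  \<open>f\<close>, while the derivatives have an L2 limit \<open>g\<close> by completeness.
  Cauchy-Schwarz against the indicator of an interval shows that \<open>f\<close> is a primitive of
  \<open>g\<close>. For the function and its weighted version the pointwise limit is already known,
  and Fatou gives the convergence in norm.\<close>

instance h11 :: banach
proof
  fix X :: "nat \<Rightarrow> h11" assume C: "Cauchy X"
  have Ce: "\<exists>N. \<forall>m\<ge>N. \<forall>n\<ge>N. norm (X m - X n) < e" if "e > 0" for e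
    using CauchyD[OF C that] .
  have cx: "\<exists>l. (\<lambda>n. ev (X n) x) \<longlonglongrightarrow> l" for x
    using bounded_linear.Cauchy[OF bounded_linear_ev C] Cauchy_convergent_iff convergent_def by blast
  then obtain f where f: "\<And>x. (\<lambda>n. ev (X n) x) \<longlonglongrightarrow> f x" by metis
  have "\<exists>g\<in>L2. (\<lambda>n. L2_norm (\<lambda>x. dv (X n) x - g x)) \<longlonglongrightarrow> 0"
  proof (rule L2_complete[OF dv_L2])
    fix e :: real assume "e > 0"
    from Ce[OF this] obtain N where "\<forall>m\<ge>N. \<forall>n\<ge>N. norm (X m - X n) < e" by blast
    then show "\<exists>N. \<forall>m\<ge>N. \<forall>n\<ge>N. L2_norm (\<lambda>x. dv (X m) x - dv (X n) x) < e"
      unfolding L2_norm_dv_diff[symmetric] using L2_norm_dv_le le_less_trans by blast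
  qed
  then obtain g where g: "g \<in> L2" and gl: "(\<lambda>n. L2_norm (\<lambda>x. dv (X n) x - g x)) \<longlonglongrightarrow> 0" by blast
  have [measurable]: "f \<in> borel_measurable borel"
    by (rule borel_measurable_LIMSEQ_metric[where f="\<lambda>n. ev (X n)"]) (use f in auto)
  have a: "ac_deriv f g"
    unfolding ac_deriv_def
  proof (intro conjI allI impI)
    show "g \<in> borel_measurable borel" by (rule L2_measurable[OF g])
    fix a b :: real assume ab: "a \<le> b"
    show "set_integrable lborel {a..b} g" by (rule L2_set_integrable[OF g])
    have ind: "(\<lambda>x. indicator {a..b} x :: complex) \<in> L2"
    proof (rule L2I)
      have "integrable lborel (\<lambda>x::real. indicator {a..b} x :: real)" by (rule integrable_real_indicator) (auto simp: emeasure_lborel_Icc_eq)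
      then show "integrable lborel (\<lambda>x::real. (cmod (indicator {a..b} x))\<^sup>2)"
        by (rule Bochner_Integration.integrable_cong[THEN iffD1, rotated 2]) (auto simp: indicator_def)
    qed measurable
    have "(\<lambda>n. ev (X n) b - ev (X n) a) \<longlonglongrightarrow> (LINT x:{a..b}|lborel. g x)"
    proof (rule LIM_zero_cancel, rule Lim_null_comparison)
      show "(\<lambda>n. L2_norm (\<lambda>x::real. indicator {a..b} x) * L2_norm (\<lambda>x. dv (X n) x - g x)) \<longlonglongrightarrow> 0"
        using tendsto_mult_right_zero[OF gl] .
      have "norm (ev (X n) b - ev (X n) a - (LINT x:{a..b}|lborel. g x)) \<le> L2_norm (\<lambda>x::real. indicator {a..b} x) * L2_norm (\<lambda>x. dv (X n) x - g x)" for n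
      proof -
        have d: "(\<lambda>x. dv (X n) x - g x) \<in> L2" by (intro L2_diff dv_L2 g)
        have "ev (X n) b - ev (X n) a - (LINT x:{a..b}|lborel. g x) = (LINT x:{a..b}|lborel. dv (X n) x - g x)"
          using ac_deriv_eq[OF ac_deriv_dv ab, of "X n"] set_integral_diff(2)[OF L2_set_integrable[OF dv_L2] L2_set_integrable[OF g], of a b "X n"] by simp
        then have "norm (ev (X n) b - ev (X n) a - (LINT x:{a..b}|lborel. g x)) \<le> (LINT x|lborel. cmod (indicator {a..b} x *\<^sub>R (dv (X n) x - g x)))"
          by (simp add: set_lebesgue_integral_def del: norm_scaleR)
        also have "\<dots> = (LINT x|lborel. cmod (indicator {a..b} x) * cmod (dv (X n) x - g x))"
          by (intro Bochner_Integration.integral_cong refl) (auto simp: indicator_def)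
        also have "\<dots> \<le> L2_norm (\<lambda>x::real. indicator {a..b} x) * L2_norm (\<lambda>x. dv (X n) x - g x)"
          by (rule L2_Cauchy_Schwarz[OF ind d])
        finally show ?thesis .
      qed
      then show "\<forall>\<^sub>F n in sequentially. norm (ev (X n) b - ev (X n) a - (LINT x:{a..b}|lborel. g x)) \<le> L2_norm (\<lambda>x::real. indicator {a..b} x) * L2_norm (\<lambda>x. dv (X n) x - g x)"
        by simp
    qed
    moreover have "(\<lambda>n. ev (X n) b - ev (X n) a) \<longlonglongrightarrow> f b - f a" by (intro tendsto_intros f)
    ultimately show "f b - f a = (LINT x:{a..b}|lborel. g x)" by (rule LIMSEQ_unique[rotated])
  qed
  have est: "(\<lambda>x. ev (X n) x - f x) \<in> L2 \<and> L2_norm (\<lambda>x. ev (X n) x - f x) \<le> e \<and>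
    (\<lambda>x. of_real x * (ev (X n) x - f x)) \<in> L2 \<and> L2_norm (\<lambda>x. of_real x * (ev (X n) x - f x)) \<le> e"
    if e: "\<forall>m\<ge>N. \<forall>n\<ge>N. norm (X m - X n) < e" and n: "n \<ge> N" for n N e
  proof -
    have b0: "L2_norm (\<lambda>x. ev (X n) x - ev (X m) x) \<le> e" and b1: "L2_norm (\<lambda>x. mx (X n) x - mx (X m) x) \<le> e" if "m \<ge> N" for m
    proof -
      have "norm (X n - X m) < e" using e n that by blast
      then show "L2_norm (\<lambda>x. ev (X n) x - ev (X m) x) \<le> e" "L2_norm (\<lambda>x. mx (X n) x - mx (X m) x) \<le> e"
        using L2_norm_ev_le[of "X n - X m"] L2_norm_mx_le[of "X n - X m"] by (simp_all add: ev_diff mx_diff)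
    qed
    have l0: "AE x in lborel. (\<lambda>m. ev (X n) x - ev (X m) x) \<longlonglongrightarrow> ev (X n) x - f x"
      by (intro AE_I2 tendsto_intros f)
    have l1: "AE x in lborel. (\<lambda>m. mx (X n) x - mx (X m) x) \<longlonglongrightarrow> of_real x * (ev (X n) x - f x)"
      unfolding mx_def right_diff_distrib[symmetric] by (intro AE_I2 tendsto_intros f)
    have v0: "\<forall>\<^sub>F m in sequentially. L2_norm (\<lambda>x. ev (X n) x - ev (X m) x) \<le> e"
      and v1: "\<forall>\<^sub>F m in sequentially. L2_norm (\<lambda>x. mx (X n) x - mx (X m) x) \<le> e"
      using b0 b1 unfolding eventually_sequentially by blast+
    have m0: "(\<lambda>x. ev (X n) x - f x) \<in> borel_measurable borel" 
      and m1: "(\<lambda>x. of_real x * (ev (X n) x - f x)) \<in> borel_measurable borel" by measurable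
    show ?thesis
      using L2_Fatou[OF L2_diff[OF ev_L2 ev_L2] m0 v0 l0] L2_Fatou[OF L2_diff[OF mx_L2 mx_L2] m1 v1 l1] by blast
  qed
  obtain N where N: "\<forall>m\<ge>N. \<forall>n\<ge>N. norm (X m - X n) < 1" using Ce[of 1] by auto
  from est[OF N order_refl] have "(\<lambda>x. ev (X N) x - f x) \<in> L2" "(\<lambda>x. of_real x * (ev (X N) x - f x)) \<in> L2" by auto
  from L2_diff[OF ev_L2[of "X N"] this(1)] L2_diff[OF mx_L2[of "X N"] this(2)]
  have fL: "f \<in> L2" and xL: "(\<lambda>x. of_real x * f x) \<in> L2" by (simp_all add: mx_def algebra_simps)
  define F where "F = mk_h11 f"
  have F: "ev F = f" "AE x in lborel. dv F x = g x" unfolding F_def using mk_h11[OF a fL g xL] by auto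
  have "X \<longlonglongrightarrow> F"
  proof (rule LIMSEQ_I)
    fix e :: real assume e: "e > 0"
    then obtain N1 where N1: "\<forall>m\<ge>N1. \<forall>n\<ge>N1. norm (X m - X n) < e / 4" using Ce[of "e/4"] by auto
    obtain N2 where N2: "\<And>n. n \<ge> N2 \<Longrightarrow> L2_norm (\<lambda>x. dv (X n) x - g x) < e / 4"
      using LIMSEQ_D[OF gl, of "e/4"] e by auto
    have "norm (X n - F) < e" if "n \<ge> max N1 N2" for n
    proof -
      have "L2_norm (dv (X n - F)) = L2_norm (\<lambda>x. dv (X n) x - g x)"
      proof (rule L2_norm_cong_AE)
        show "AE x in lborel. dv (X n - F) x = dv (X n) x - g x"
          using dv_diff[of "X n" F] F(2) by eventually_elim simp
      qed (use L2_measurable[OF g] in measurable)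
      then have 1: "L2_norm (dv (X n - F)) < e / 4" using N2[of n] that by simp
      have 2: "L2_norm (ev (X n - F)) \<le> e / 4" "L2_norm (mx (X n - F)) \<le> e / 4"
        using est[OF N1, of n] that by (simp_all add: ev_diff F(1) mx_def[abs_def])
      show ?thesis using norm_h11_le[of "X n - F"] 1 2 e by linarith
    qed
    then show "\<exists>no. \<forall>n\<ge>no. norm (X n - F) < e" by blast
  qed
  then show "convergent X" by (auto simp: convergent_def)
qed

section \<open>Pointwise products, conjugates and complex multiples\<close>

lemma h11_mult_set:
  shows "ac_deriv (\<lambda>x. ev f x * ev g x) (\<lambda>x. dv f x * ev g x + ev f x * dv g x)"
    "(\<lambda>x. ev f x * ev g x) \<in> L2" "(\<lambda>x. dv f x * ev g x + ev f x * dv g x) \<in> L2"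
    "(\<lambda>x. of_real x * (ev f x * ev g x)) \<in> L2"
proof -
  have b: "(\<lambda>x. h x * ev g x) \<in> L2" if "h \<in> L2" for h g
    using L2_mult_bounded[OF that ev_measurable ev_sup, of g] by (simp add: mult.commute)
  show "ac_deriv (\<lambda>x. ev f x * ev g x) (\<lambda>x. dv f x * ev g x + ev f x * dv g x)"
    by (intro ac_deriv_mult ac_deriv_dv)
  show "(\<lambda>x. ev f x * ev g x) \<in> L2" by (intro b ev_L2)
  show "(\<lambda>x. dv f x * ev g x + ev f x * dv g x) \<in> L2"
    using b[OF dv_L2[of g], of f] by (intro L2_add b dv_L2) (simp add: mult.commute)
  show "(\<lambda>x. of_real x * (ev f x * ev g x)) \<in> L2"
    using b[OF mx_L2[of f], of g] by (simp add: mx_def mult.assoc)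
qed

definition h11_mult :: "h11 \<Rightarrow> h11 \<Rightarrow> h11" where
  "h11_mult f g = mk_h11 (\<lambda>x. ev f x * ev g x)"

lemma ev_mult: "ev (h11_mult f g) = (\<lambda>x. ev f x * ev g x)"
  unfolding h11_mult_def by (rule ev_mk[OF h11_mult_set])

lemma dv_mult: "AE x in lborel. dv (h11_mult f g) x = dv f x * ev g x + ev f x * dv g x"
  unfolding h11_mult_def by (rule dv_mk[OF h11_mult_set])

text \<open>One factor is always estimated by its supremum. The 4 counts one term for the function,
  one for the weight and two for the product rule.\<close>

lemma norm_h11_mult: "norm (h11_mult f g) \<le> 4 * norm f * norm g"
proof -
  have b: "L2_norm (\<lambda>x. h x * ev g x) \<le> norm g * L2_norm h" if "h \<in> L2" for h g
    by (rule L2_norm_mono[OF that]) 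
      (use L2_measurable[OF that] in \<open>auto simp: norm_mult mult.commute[of "norm g"] intro!: AE_I2 mult_left_mono ev_sup\<close>)
  have m: "norm g * L2_norm (ev f) \<le> norm g * norm f" "norm g * L2_norm (dv f) \<le> norm g * norm f" 
    "norm g * L2_norm (mx f) \<le> norm g * norm f" for f g
    by (intro mult_left_mono L2_norm_ev_le L2_norm_dv_le L2_norm_mx_le norm_ge_zero)+
  have 0: "L2_norm (ev (h11_mult f g)) \<le> norm g * norm f"
    unfolding ev_mult using b[OF ev_L2[of f], of g] m(1)[of g f] by linarith
  have 2: "L2_norm (mx (h11_mult f g)) \<le> norm g * norm f"
    using b[OF mx_L2[of f], of g] m(3)[of g f] by (simp add: mx_def[abs_def] ev_mult mult.assoc)
  have L: "(\<lambda>x. dv f x * ev g x) \<in> L2" "(\<lambda>x. dv g x * ev f x) \<in> L2"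
    using L2_mult_bounded[OF dv_L2 ev_measurable ev_sup, of g f] L2_mult_bounded[OF dv_L2 ev_measurable ev_sup, of f g] 
    by (simp_all add: mult.commute)
  have "L2_norm (dv (h11_mult f g)) = L2_norm (\<lambda>x. dv f x * ev g x + dv g x * ev f x)"
    by (rule L2_norm_cong_AE) (use dv_mult[of f g] in \<open>auto simp: mult.commute\<close>)
  also have "\<dots> \<le> L2_norm (\<lambda>x. dv f x * ev g x) + L2_norm (\<lambda>x. dv g x * ev f x)"
    by (rule L2_norm_triangle[OF L])
  also have "\<dots> \<le> norm g * norm f + norm f * norm g"
    using b[OF dv_L2[of f], of g] b[OF dv_L2[of g], of f] m(2)[of g f] m(2)[of f g] by linarith
  finally have 1: "L2_norm (dv (h11_mult f g)) \<le> norm g * norm f + norm f * norm g" .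
  show ?thesis using norm_h11_le[of "h11_mult f g"] 0 1 2 by (simp add: mult.commute[of "norm g"])
qed

lemma h11_mult_bilinear: "bounded_bilinear h11_mult"
proof
  show "\<exists>K. \<forall>a b. norm (h11_mult a b) \<le> norm a * norm b * K"
    using norm_h11_mult by (intro exI[of _ 4]) (simp add: algebra_simps)
qed (auto intro!: h11_eqI simp: ev_mult ev_add ev_scaleR algebra_simps)

definition h11_cnj :: "h11 \<Rightarrow> h11" where "h11_cnj f = mk_h11 (\<lambda>x. cnj (ev f x))"

lemma ev_cnj: "ev (h11_cnj f) = (\<lambda>x. cnj (ev f x))" 
  and dv_cnj: "AE x in lborel. dv (h11_cnj f) x = cnj (dv f x)"
proof -
  have "(\<lambda>x. of_real x * cnj (ev f x)) \<in> L2" using L2_cnj[OF mx_L2[of f]] by (simp add: mx_def)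
  note * = ac_deriv_cnj[OF ac_deriv_dv[of f]] L2_cnj[OF ev_L2[of f]] L2_cnj[OF dv_L2[of f]] this
  show "ev (h11_cnj f) = (\<lambda>x. cnj (ev f x))" unfolding h11_cnj_def by (rule ev_mk[OF *])
  show "AE x in lborel. dv (h11_cnj f) x = cnj (dv f x)" unfolding h11_cnj_def by (rule dv_mk[OF *])
qed

lemma norm_h11_cnj: "norm (h11_cnj f) = norm f"
proof -
  have "L2_norm (dv (h11_cnj f)) = L2_norm (\<lambda>x. cnj (dv f x))"
    by (rule L2_norm_cong_AE) (use dv_cnj L2_measurable[OF L2_cnj[OF dv_L2]] in auto)
  then have "(norm (h11_cnj f))\<^sup>2 = (norm f)\<^sup>2"
    by (simp add: norm_h11_power2 ev_cnj mx_def[abs_def] L2_norm_def norm_mult)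
  then show ?thesis by simp
qed

lemma h11_cnj_linear: "bounded_linear h11_cnj"
  by (rule bounded_linear_intro[where K=1]) (auto intro!: h11_eqI simp: ev_cnj ev_add ev_scaleR norm_h11_cnj)

text \<open>The type is a Hilbert space over the reals only, so multiplication by complex constants,
  above all by \<open>- \<i>\<close>, is a separate operator.\<close>

definition h11_scale :: "complex \<Rightarrow> h11 \<Rightarrow> h11" where "h11_scale c f = mk_h11 (\<lambda>x. c * ev f x)"

lemma ev_scale: "ev (h11_scale c f) = (\<lambda>x. c * ev f x)" 
  and dv_scale: "AE x in lborel. dv (h11_scale c f) x = c * dv f x"
proof -
  have "(\<lambda>x. of_real x * (c * ev f x)) \<in> L2" using L2_cmult[OF mx_L2[of f], of c] by (simp add: mx_def algebra_simps)
  note * = ac_deriv_cmult[OF ac_deriv_dv[of f], of c] L2_cmult[OF ev_L2[of f]] L2_cmult[OF dv_L2[of f]] this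
  show "ev (h11_scale c f) = (\<lambda>x. c * ev f x)" unfolding h11_scale_def by (rule ev_mk[OF *])
  show "AE x in lborel. dv (h11_scale c f) x = c * dv f x" unfolding h11_scale_def by (rule dv_mk[OF *])
qed

lemma mx_scale: "mx (h11_scale c f) = (\<lambda>x. c * mx f x)"
  by (simp add: fun_eq_iff mx_def ev_scale)

lemma norm_h11_scale: "norm (h11_scale c f) = cmod c * norm f"
proof -
  have "L2_norm (dv (h11_scale c f)) = L2_norm (\<lambda>x. c * dv f x)"
    by (rule L2_norm_cong_AE) (use dv_scale in auto)
  then have "(norm (h11_scale c f))\<^sup>2 = (cmod c * norm f)\<^sup>2"
    by (simp add: norm_h11_power2 ev_scale mx_scale L2_norm_cmult power_mult_distrib algebra_simps)
  then show ?thesis by simp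
qed

lemma h11_scale_linear: "bounded_linear (h11_scale c)"
  by (rule bounded_linear_intro[where K="cmod c"]) 
     (auto intro!: h11_eqI simp: ev_scale ev_add ev_scaleR norm_h11_scale algebra_simps)

section \<open>Fourier transform and Gaussian regularisation\<close>

lemma integrable_kernel_pair:
  fixes p q :: "real \<Rightarrow> complex" and k :: "real \<times> real \<Rightarrow> complex"
  assumes p: "integrable lborel p" and q: "integrable lborel q"
    and [measurable]: "k \<in> borel_measurable (borel \<Otimes>\<^sub>M borel)" and b: "\<And>z. cmod (k z) \<le> 1"
  shows "integrable (lborel \<Otimes>\<^sub>M lborel) (\<lambda>(x, y). k (x, y) * (p x * q y))"
proof (rule Bochner_Integration.integrable_bound[OF integrable_product_pair[OF p q]])
  note [measurable] = borel_measurable_integrable[OF p] borel_measurable_integrable[OF q]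
  show "(\<lambda>(x, y). k (x, y) * (p x * q y)) \<in> borel_measurable (lborel \<Otimes>\<^sub>M lborel)" by measurable
  show "AE z in lborel \<Otimes>\<^sub>M lborel. norm (case z of (x, y) \<Rightarrow> k (x, y) * (p x * q y)) \<le> norm (case z of (x, y) \<Rightarrow> p x * q y)"
  proof (rule AE_I2, clarify)
    fix x y :: real
    show "norm (k (x, y) * (p x * q y)) \<le> norm (p x * q y)"
      using mult_right_mono[OF b[of "(x, y)"], of "norm (p x * q y)"] by (simp add: norm_mult)
  qed
qed

lemma exp_ii_norm [simp]: "cmod (exp (\<i> * of_real t)) = 1" "cmod (exp (- (\<i> * of_real t))) = 1"
  using norm_exp_i_times[of t] norm_exp_i_times[of "- t"] by simp_all

lemma fourier_measurable [measurable]: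
  assumes [measurable]: "f \<in> borel_measurable borel" shows "fourier f \<in> borel_measurable borel"
proof -
  have "(\<lambda>\<xi>. LINT x|lborel. exp (- \<i> * of_real (x * \<xi>)) * f x) \<in> borel_measurable borel"
    by (rule sigma_finite_measure.borel_measurable_lebesgue_integral[OF sigma_finite_lborel]) measurable
  then show ?thesis unfolding fourier_def[abs_def] by (intro borel_measurable_times) auto
qed

lemma fourier_integrand:
  assumes "integrable lborel f" shows "integrable lborel (\<lambda>x. exp (- \<i> * of_real (x * \<xi>)) * f x)"
  by (rule Bochner_Integration.integrable_bound[OF assms])
    (use borel_measurable_integrable[OF assms] in \<open>auto simp: norm_mult exp_ii_norm[of "x * \<xi>" for x, simplified]\<close>)

lemma fourier_bound:
  assumes f: "integrable lborel f" 
  shows "cmod (fourier f \<xi>) \<le> 1 / sqrt (2 * pi) * (LINT x|lborel. cmod (f x))"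
proof -
  have "cmod (LINT x|lborel. exp (- \<i> * of_real (x * \<xi>)) * f x) \<le> (LINT x|lborel. cmod (exp (- \<i> * of_real (x * \<xi>)) * f x))"
    by (rule integral_norm_bound)
  also have "\<dots> = (LINT x|lborel. cmod (f x))"
    using exp_ii_norm(2)[of "x * \<xi>" for x] by (simp add: norm_mult)
  finally show ?thesis unfolding fourier_def norm_mult
    by (intro mult_mono) (auto simp: norm_divide)
qed

lemma fourier_add: "integrable lborel f \<Longrightarrow> integrable lborel g \<Longrightarrow> fourier (\<lambda>x. f x + g x) \<xi> = fourier f \<xi> + fourier g \<xi>"
  using fourier_integrand[of f \<xi>] fourier_integrand[of g \<xi>] by (simp add: fourier_def distrib_left)

lemma fourier_diff: "integrable lborel f \<Longrightarrow> integrable lborel g \<Longrightarrow> fourier (\<lambda>x. f x - g x) \<xi> = fourier f \<xi> - fourier g \<xi>"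
  using fourier_integrand[of f \<xi>] fourier_integrand[of g \<xi>] by (simp add: fourier_def right_diff_distrib)

lemma fourier_cmult: "fourier (\<lambda>x. c * f x) \<xi> = c * fourier f \<xi>"
  by (simp add: fourier_def mult.left_commute[of _ c])

lemma fourier_cong_AE:
  assumes "f \<in> borel_measurable borel" "g \<in> borel_measurable borel" "AE x in lborel. f x = g x"
  shows "fourier f \<xi> = fourier g \<xi>"
proof -
  note [measurable] = assms(1,2)
  have "(LINT x|lborel. exp (- \<i> * of_real (x * \<xi>)) * f x) = (LINT x|lborel. exp (- \<i> * of_real (x * \<xi>)) * g x)"
    by (rule integral_cong_AE) (use assms(3) in auto)
  then show ?thesis by (simp add: fourier_def)
qed

text \<open>Fubini with a bounded kernel. The inversion formula, the L2 bound and the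
  differentiation rule below all come from it, by suitable choices of the second function.\<close>

lemma fourier_multiplication_formula:
  assumes p: "integrable lborel p" and q: "integrable lborel q"
  shows "(LINT \<xi>|lborel. q \<xi> * fourier p \<xi>) = (LINT x|lborel. p x * fourier q x)"
    and "integrable lborel (\<lambda>x. p x * fourier q x)"
proof -
  define c where "c = complex_of_real (1 / sqrt (2 * pi))"
  have K: "integrable (lborel \<Otimes>\<^sub>M lborel) (\<lambda>(x, y). exp (- \<i> * of_real (fst (x, y) * snd (x, y))) * (p x * q y))"
  proof (rule integrable_kernel_pair[OF p q, of "\<lambda>z. exp (- \<i> * of_real (fst z * snd z))"])
    show "(\<lambda>z. exp (- \<i> * complex_of_real (fst z * snd z))) \<in> borel_measurable (borel \<Otimes>\<^sub>M borel)" by measurable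
    show "cmod (exp (- \<i> * complex_of_real (fst z * snd z))) \<le> 1" for z
      using exp_ii_norm(2)[of "fst z * snd z"] by simp
  qed
  have e1: "q \<xi> * fourier p \<xi> = c * (LINT x|lborel. exp (- \<i> * of_real (x * \<xi>)) * (p x * q \<xi>))" for \<xi>
  proof -
    have "(LINT x|lborel. exp (- \<i> * of_real (x * \<xi>)) * (p x * q \<xi>)) = (LINT x|lborel. q \<xi> * (exp (- \<i> * of_real (x * \<xi>)) * p x))"
      by (intro Bochner_Integration.integral_cong refl) (simp add: mult_ac)
    then show ?thesis by (simp add: fourier_def c_def)
  qed
  have e2: "p x * fourier q x = c * (LINT \<xi>|lborel. exp (- \<i> * of_real (x * \<xi>)) * (p x * q \<xi>))" for x
  proof -
    have "(LINT \<xi>|lborel. exp (- \<i> * of_real (x * \<xi>)) * (p x * q \<xi>)) = (LINT \<xi>|lborel. p x * (exp (- \<i> * of_real (\<xi> * x)) * q \<xi>))"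
      by (intro Bochner_Integration.integral_cong refl) (simp add: mult_ac)
    then show ?thesis by (simp add: fourier_def c_def)
  qed
  have "(LINT \<xi>|lborel. q \<xi> * fourier p \<xi>) = c * (LINT \<xi>|lborel. LINT x|lborel. exp (- \<i> * of_real (x * \<xi>)) * (p x * q \<xi>))"
    unfolding e1 by (rule integral_mult_right_zero)
  also have "(LINT \<xi>|lborel. LINT x|lborel. exp (- \<i> * of_real (x * \<xi>)) * (p x * q \<xi>)) 
    = (LINT x|lborel. LINT \<xi>|lborel. exp (- \<i> * of_real (x * \<xi>)) * (p x * q \<xi>))"
    by (rule lborel_pair.Fubini_integral) (use K in \<open>simp add: case_prod_beta'\<close>)
  also have "c * \<dots> = (LINT x|lborel. p x * fourier q x)"
    unfolding e2 by (rule integral_mult_right_zero[symmetric])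
  finally show "(LINT \<xi>|lborel. q \<xi> * fourier p \<xi>) = (LINT x|lborel. p x * fourier q x)" .
  have "integrable lborel (\<lambda>x. c * (LINT \<xi>|lborel. exp (- \<i> * of_real (x * \<xi>)) * (p x * q \<xi>)))"
    using lborel_pair.integrable_fst'[OF K] by simp
  then show "integrable lborel (\<lambda>x. p x * fourier q x)" by (simp only: e2)
qed

section \<open>Gaussian regularisation of the inversion integral\<close>

lemma gauss_fourier:
  "(LINT x|lborel. exp (\<i> * of_real (t * x)) * of_real (std_normal_density x)) = of_real (exp (- (t\<^sup>2) / 2))"
proof -
  have "char std_normal_distribution t = (LINT x|lborel. std_normal_density x *\<^sub>R exp (\<i> * of_real (t * x)))"
    unfolding char_def by (subst integral_density) (auto simp: mult.commute)
  then show ?thesis by (simp add: char_std_normal_distribution scaleR_conv_of_real mult.commute)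
qed

lemma gauss_scaled_integrable:
  assumes "e > 0" shows "integrable lborel (\<lambda>\<xi>. std_normal_density (e * \<xi>))"
proof -
  have "integrable lborel (\<lambda>\<xi>. std_normal_density (0 + e * \<xi>))"
    by (rule lborel_integrable_real_affine) (use assms in auto)
  then show ?thesis by simp
qed

lemma gauss_le: "std_normal_density x \<le> 1 / sqrt (2 * pi)"
proof -
  have "exp (- x\<^sup>2 / 2) \<le> 1" by simp
  then have "1 / sqrt (2 * pi) * exp (- x\<^sup>2 / 2) \<le> 1 / sqrt (2 * pi) * 1" by (intro mult_left_mono) auto
  then show ?thesis by (simp add: std_normal_density_def)
qed

text \<open>The transform of a plane wave damped on the scale \<open>1 / e\<close> is a probability
  density concentrated around \<open>y\<close> on the scale \<open>e\<close>, that is, an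
  approximate identity. The same normal density occurs on both sides because its own normalising
  constant is that of the transform.\<close>

lemma gauss_wave:
  assumes e: "e > 0"
  shows "integrable lborel (\<lambda>\<xi>. of_real (std_normal_density (e * \<xi>)) * exp (\<i> * of_real (y * \<xi>)))"
    and "fourier (\<lambda>\<xi>. of_real (std_normal_density (e * \<xi>)) * exp (\<i> * of_real (y * \<xi>))) x 
      = of_real (std_normal_density ((y - x) / e) / e)"
proof -
  show "integrable lborel (\<lambda>\<xi>. of_real (std_normal_density (e * \<xi>)) * exp (\<i> * of_real (y * \<xi>)))"
    by (rule Bochner_Integration.integrable_bound[OF gauss_scaled_integrable[OF e]])
      (use exp_ii_norm(1)[of "y * \<xi>" for \<xi>] in \<open>auto simp: norm_mult\<close>)
  define c where "c = complex_of_real (1 / sqrt (2 * pi))"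
  have "of_real (exp (- (((y - x) / e)\<^sup>2) / 2)) = (LINT \<xi>|lborel. exp (\<i> * of_real ((y - x) / e * \<xi>)) * of_real (std_normal_density \<xi>))"
    by (rule gauss_fourier[symmetric])
  also have "\<dots> = of_real e * (LINT \<xi>|lborel. exp (\<i> * of_real ((y - x) * \<xi>)) * of_real (std_normal_density (e * \<xi>)))"
    by (subst lborel_integral_real_affine[of e _ 0]) (use e in \<open>auto simp: scaleR_conv_of_real\<close>)
  also have "(LINT \<xi>|lborel. exp (\<i> * of_real ((y - x) * \<xi>)) * of_real (std_normal_density (e * \<xi>)))
    = (LINT \<xi>|lborel. exp (- \<i> * of_real (\<xi> * x)) * (of_real (std_normal_density (e * \<xi>)) * exp (\<i> * of_real (y * \<xi>))))"
  proof (intro Bochner_Integration.integral_cong refl)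
    fix \<xi>
    have "exp (\<i> * of_real ((y - x) * \<xi>)) = exp (- \<i> * of_real (\<xi> * x)) * exp (\<i> * of_real (y * \<xi>))"
      by (simp add: exp_add[symmetric] algebra_simps)
    then show "exp (\<i> * of_real ((y - x) * \<xi>)) * of_real (std_normal_density (e * \<xi>)) 
      = exp (- \<i> * of_real (\<xi> * x)) * (of_real (std_normal_density (e * \<xi>)) * exp (\<i> * of_real (y * \<xi>)))"
      by (simp add: mult_ac)
  qed
  finally have "c * (LINT \<xi>|lborel. exp (- \<i> * of_real (\<xi> * x)) * (of_real (std_normal_density (e * \<xi>)) * exp (\<i> * of_real (y * \<xi>))))
     = c * of_real (exp (- (((y - x) / e)\<^sup>2) / 2)) / of_real e" using e by simp
  then show "fourier (\<lambda>\<xi>. of_real (std_normal_density (e * \<xi>)) * exp (\<i> * of_real (y * \<xi>))) x 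
      = of_real (std_normal_density ((y - x) / e) / e)"
    by (simp add: fourier_def c_def std_normal_density_def)
qed

text \<open>The multiplication formula moves the transform from \<open>f\<close> to the damped wave,
  and the substitution \<open>x = y - e * z\<close> displays the result as a Gaussian average of
  \<open>f\<close> around \<open>y\<close>.\<close>

lemma gauss_regularised_inversion:
  assumes f: "integrable lborel f" and e: "e > 0"
  shows "(LINT \<xi>|lborel. of_real (std_normal_density (e * \<xi>)) * exp (\<i> * of_real (y * \<xi>)) * fourier f \<xi>) 
    = (LINT z|lborel. f (y - e * z) * of_real (std_normal_density z))"
proof -
  have "(LINT \<xi>|lborel. of_real (std_normal_density (e * \<xi>)) * exp (\<i> * of_real (y * \<xi>)) * fourier f \<xi>)
     = (LINT x|lborel. f x * of_real (std_normal_density ((y - x) / e) / e))"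
    using fourier_multiplication_formula(1)[OF f gauss_wave(1)[OF e, of y]] by (simp only: gauss_wave(2)[OF e])
  also have "\<dots> = \<bar>- e\<bar> *\<^sub>R (LINT z|lborel. f (y + - e * z) * of_real (std_normal_density ((y - (y + - e * z)) / e) / e))"
    by (rule lborel_integral_real_affine) (use e in simp)
  also have "(LINT z|lborel. f (y + - e * z) * of_real (std_normal_density ((y - (y + - e * z)) / e) / e))
     = (LINT z|lborel. f (y - e * z) * of_real (std_normal_density z) / of_real e)"
    using e by (intro Bochner_Integration.integral_cong refl) simp
  also have "\<bar>- e\<bar> *\<^sub>R \<dots> = (LINT z|lborel. f (y - e * z) * of_real (std_normal_density z))"
    using e by (simp add: scaleR_conv_of_real)
  finally show ?thesis .
qed

lemma L2_shift: 
  assumes f: "f \<in> L2" shows "(\<lambda>x. f (t + x)) \<in> L2" "L2_norm (\<lambda>x. f (t + x)) = L2_norm f"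
proof -
  note [measurable] = L2_measurable[OF f]
  show "(\<lambda>x. f (t + x)) \<in> L2"
    using lborel_integrable_real_affine[OF L2_integrable[OF f], of 1 t] by (intro L2I) auto
  show "L2_norm (\<lambda>x. f (t + x)) = L2_norm f"
    unfolding L2_norm_def using lborel_integral_real_affine[of 1 "\<lambda>x. (cmod (f x))\<^sup>2" t] by simp
qed

lemma L2_reflect: 
  assumes f: "f \<in> L2" shows "(\<lambda>x. f (- x)) \<in> L2" 
proof -
  note [measurable] = L2_measurable[OF f]
  show "(\<lambda>x. f (- x)) \<in> L2"
    using lborel_integrable_real_affine[OF L2_integrable[OF f], of "-1" 0] by (intro L2I) auto
qed

lemma L2_norm_reflect: "L2_norm (\<lambda>x. f (- x)) = L2_norm f"
  unfolding L2_norm_def using lborel_integral_real_affine[of "-1" "\<lambda>x. (cmod (f x))\<^sup>2" 0] by simp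

text \<open>Nothing is known beforehand about the square integrability of the transform, so
  \<open>|fourier f|\<^sup>2\<close> is first damped by a Gaussian. The damped integral is
  \<open>f\<close> paired with a Gaussian average of itself, and Cauchy-Schwarz with translation
  invariance bounds it uniformly in \<open>e\<close>; Fatou removes the damping. The inequality is
  enough here, as equality on H11 follows later from inversion.\<close>

lemma fourier_L2_bound:
  assumes f: "f \<in> L2" and i: "integrable lborel f"
  shows "fourier f \<in> L2" and "L2_norm (fourier f) \<le> L2_norm f"
proof -
  note [measurable] = L2_measurable[OF f]
  define c where "c = 1 / sqrt (2 * pi)"
  have c: "c > 0" by (simp add: c_def)
  obtain B where B: "\<And>\<xi>. cmod (fourier f \<xi>) \<le> B" using fourier_bound[OF i] by blast
  have reg: "(\<integral>\<^sup>+\<xi>. ennreal (std_normal_density (e * \<xi>) * (cmod (fourier f \<xi>))\<^sup>2) \<partial>lborel) \<le> ennreal (c * (L2_norm f)\<^sup>2)"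
    if e: "e > 0" for e
  proof -
    \<comment> \<open>The conjugate makes \<open>q * fourier f\<close> the nonnegative function to
      be integrated, while the Gaussian makes \<open>q\<close> integrable.\<close>
    define q where "q \<xi> = of_real (std_normal_density (e * \<xi>)) * cnj (fourier f \<xi>)" for \<xi>
    have [measurable]: "(\<lambda>\<xi>. cnj (fourier f \<xi>)) \<in> borel_measurable borel"
      by (rule borel_measurable_continuous_on[OF _ fourier_measurable]) (auto intro!: continuous_intros)
    have q: "integrable lborel q"
    proof (rule Bochner_Integration.integrable_bound)
      show "integrable lborel (\<lambda>\<xi>. B * std_normal_density (e * \<xi>))" 
        by (intro integrable_mult_right gauss_scaled_integrable e)
      show "q \<in> borel_measurable lborel" unfolding q_def[abs_def] by measurable
      have "cmod (q \<xi>) \<le> norm (B * std_normal_density (e * \<xi>))" for \<xi>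
      proof -
        have "cmod (q \<xi>) \<le> std_normal_density (e * \<xi>) * B" 
          unfolding q_def norm_mult using B[of \<xi>] by (intro mult_mono) auto
        then show ?thesis by (simp add: mult.commute)
      qed
      then show "AE \<xi> in lborel. cmod (q \<xi>) \<le> norm (B * std_normal_density (e * \<xi>))" by simp
    qed
    define K where "K x = (LINT z|lborel. f (x - e * z) * of_real (std_normal_density z))" for x
    \<comment> \<open>Conjugation reverses the sign in the exponent, so the transform of
      \<open>q\<close> is the conjugate of a regularised inversion integral.\<close>
    have fq: "fourier q x = of_real c * cnj (K x)" for x
    proof -
      have "cnj (K x) = (LINT \<xi>|lborel. cnj (of_real (std_normal_density (e * \<xi>)) * exp (\<i> * of_real (x * \<xi>)) * fourier f \<xi>))"
        unfolding K_def gauss_regularised_inversion[OF i e, symmetric] by (rule Bochner_Integration.integral_cnj[symmetric])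
      also have "\<dots> = (LINT \<xi>|lborel. exp (- \<i> * of_real (\<xi> * x)) * q \<xi>)"
        by (intro Bochner_Integration.integral_cong refl) (simp add: q_def exp_cnj mult_ac)
      finally show ?thesis by (simp add: fourier_def c_def)
    qed
    have int: "integrable lborel (\<lambda>x. f x * fourier q x)"
      by (rule fourier_multiplication_formula(2)[OF i q])
    have shifted: "integrable lborel (\<lambda>z. f (x - e * z) * of_real (std_normal_density z))" for x
    proof (rule Bochner_Integration.integrable_bound)
      show "integrable lborel (\<lambda>z. c * cmod (f (x - e * z)))"
        using lborel_integrable_real_affine[OF i, of "- e" x] e by (intro integrable_mult_right integrable_norm) simp
      show "AE z in lborel. norm (f (x - e * z) * of_real (std_normal_density z)) \<le> norm (c * cmod (f (x - e * z)))"
        using gauss_le c unfolding c_def[symmetric]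
        by (auto simp: norm_mult mult.commute[of c] intro!: AE_I2 mult_left_mono)
    qed measurable
    have "(\<integral>\<^sup>+\<xi>. ennreal (std_normal_density (e * \<xi>) * (cmod (fourier f \<xi>))\<^sup>2) \<partial>lborel) 
        = (\<integral>\<^sup>+\<xi>. ennreal (cmod (q \<xi> * fourier f \<xi>)) \<partial>lborel)"
      by (simp add: q_def norm_mult power2_eq_square mult_ac)
    also have "\<dots> = ennreal (LINT \<xi>|lborel. cmod (q \<xi> * fourier f \<xi>))"
    proof (rule nn_integral_eq_integral)
      show "integrable lborel (\<lambda>\<xi>. cmod (q \<xi> * fourier f \<xi>))"
        by (intro integrable_norm fourier_multiplication_formula(2)[OF q i])
    qed simp
    also have "(LINT \<xi>|lborel. cmod (q \<xi> * fourier f \<xi>)) = cmod (LINT \<xi>|lborel. q \<xi> * fourier f \<xi>)"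
    proof -
      have "q \<xi> * fourier f \<xi> = of_real (cmod (q \<xi> * fourier f \<xi>))" for \<xi>
      proof -
        have "cmod (q \<xi> * fourier f \<xi>) = std_normal_density (e * \<xi>) * (cmod (fourier f \<xi>))\<^sup>2"
          by (simp add: q_def norm_mult power2_eq_square)
        moreover have "q \<xi> * fourier f \<xi> = of_real (std_normal_density (e * \<xi>) * (cmod (fourier f \<xi>))\<^sup>2)"
          using complex_norm_square[of "fourier f \<xi>"] by (simp add: q_def mult_ac)
        ultimately show ?thesis by simp
      qed
      then have "(LINT \<xi>|lborel. q \<xi> * fourier f \<xi>) = of_real (LINT \<xi>|lborel. cmod (q \<xi> * fourier f \<xi>))"
        by (metis (no_types, lifting) Bochner_Integration.integral_cong integral_complex_of_real)
      moreover have "0 \<le> (LINT \<xi>|lborel. cmod (q \<xi> * fourier f \<xi>))" by (rule integral_nonneg_AE) simp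
      ultimately show ?thesis by simp
    qed
    also have "(LINT \<xi>|lborel. q \<xi> * fourier f \<xi>) = (LINT x|lborel. f x * fourier q x)"
      by (rule fourier_multiplication_formula(1)[OF i q])
    also have "ennreal (cmod \<dots>) \<le> (\<integral>\<^sup>+x. ennreal (cmod (f x * fourier q x)) \<partial>lborel)"
      by (rule integral_norm_bound_ennreal[OF int])
    also have "\<dots> \<le> (\<integral>\<^sup>+x. (\<integral>\<^sup>+z. ennreal (c * (cmod (f x) * cmod (f (x - e * z)) * std_normal_density z)) \<partial>lborel) \<partial>lborel)"
    proof (rule nn_integral_mono)
      fix x
      have "ennreal (cmod (f x * fourier q x)) = ennreal (c * cmod (f x)) * ennreal (cmod (K x))"
        using c by (simp add: fq norm_mult mult_ac ennreal_mult[symmetric])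
      also have "\<dots> \<le> ennreal (c * cmod (f x)) * (\<integral>\<^sup>+z. ennreal (cmod (f (x - e * z) * of_real (std_normal_density z))) \<partial>lborel)"
        unfolding K_def by (intro mult_left_mono integral_norm_bound_ennreal shifted) simp
      also have "\<dots> = (\<integral>\<^sup>+z. ennreal (c * cmod (f x)) * ennreal (cmod (f (x - e * z) * of_real (std_normal_density z))) \<partial>lborel)"
        by (rule nn_integral_cmult[symmetric]) measurable
      also have "\<dots> = (\<integral>\<^sup>+z. ennreal (c * (cmod (f x) * cmod (f (x - e * z)) * std_normal_density z)) \<partial>lborel)"
        using c by (intro nn_integral_cong) (simp add: norm_mult ennreal_mult[symmetric] mult_ac)
      finally show "ennreal (cmod (f x * fourier q x)) \<le> (\<integral>\<^sup>+z. ennreal (c * (cmod (f x) * cmod (f (x - e * z)) * std_normal_density z)) \<partial>lborel)" .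
    qed
    also have "\<dots> = (\<integral>\<^sup>+z. (\<integral>\<^sup>+x. ennreal (c * (cmod (f x) * cmod (f (x - e * z)) * std_normal_density z)) \<partial>lborel) \<partial>lborel)"
      by (rule lborel_pair.Fubini') measurable
    \<comment> \<open>For fixed \<open>z\<close> the inner integral pairs \<open>f\<close> with a
      translate of itself, which has the same norm.\<close>
    also have "\<dots> \<le> (\<integral>\<^sup>+z. ennreal (c * (L2_norm f)\<^sup>2 * std_normal_density z) \<partial>lborel)"
    proof (rule nn_integral_mono)
      fix z
      have sh: "(\<lambda>x. f (- (e * z) + x)) \<in> L2" "L2_norm (\<lambda>x. f (- (e * z) + x)) = L2_norm f" 
        by (rule L2_shift[OF f])+
      have "(\<integral>\<^sup>+x. ennreal (c * (cmod (f x) * cmod (f (x - e * z)) * std_normal_density z)) \<partial>lborel)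
         = ennreal (LINT x|lborel. c * (cmod (f x) * cmod (f (- (e * z) + x)) * std_normal_density z))"
      proof (subst nn_integral_eq_integral[symmetric])
        show "integrable lborel (\<lambda>x. c * (cmod (f x) * cmod (f (- (e * z) + x)) * std_normal_density z))"
          by (intro integrable_mult_right integrable_mult_left L2_mult_integrable f sh)
      qed (use c in \<open>auto\<close>)
      also have "(LINT x|lborel. c * (cmod (f x) * cmod (f (- (e * z) + x)) * std_normal_density z))
         = (LINT x|lborel. cmod (f x) * cmod (f (- (e * z) + x))) * (c * std_normal_density z)"
        by (simp add: mult_ac flip: integral_mult_right_zero)
      also have "ennreal \<dots> \<le> ennreal ((L2_norm f * L2_norm f) * (c * std_normal_density z))"
        using L2_Cauchy_Schwarz[OF f sh(1)] sh(2) c by (intro ennreal_leI mult_right_mono) auto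
      finally show "(\<integral>\<^sup>+x. ennreal (c * (cmod (f x) * cmod (f (x - e * z)) * std_normal_density z)) \<partial>lborel) \<le> ennreal (c * (L2_norm f)\<^sup>2 * std_normal_density z)"
        by (simp add: power2_eq_square mult_ac)
    qed
    also have "\<dots> = ennreal (LINT z|lborel. c * (L2_norm f)\<^sup>2 * std_normal_density z)"
      using c by (intro nn_integral_eq_integral) auto
    also have "\<dots> = ennreal (c * (L2_norm f)\<^sup>2)" by simp
    finally show ?thesis .
  qed
  define e where "e n = 1 / real (Suc n)" for n
  have e: "e n > 0" for n by (simp add: e_def)
  have e0: "e \<longlonglongrightarrow> 0" unfolding e_def by (rule LIMSEQ_Suc[OF lim_1_over_n])
  have "(\<integral>\<^sup>+\<xi>. ennreal (c * (cmod (fourier f \<xi>))\<^sup>2) \<partial>lborel) 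
    = (\<integral>\<^sup>+\<xi>. liminf (\<lambda>n. ennreal (std_normal_density (e n * \<xi>) * (cmod (fourier f \<xi>))\<^sup>2)) \<partial>lborel)"
  proof (rule nn_integral_cong)
    fix \<xi>
    have "(\<lambda>n. 1 / sqrt (2 * pi) * exp (- (e n * \<xi>)\<^sup>2 / 2)) \<longlonglongrightarrow> 1 / sqrt (2 * pi) * exp (- (0 * \<xi>)\<^sup>2 / 2)"
      by (intro tendsto_intros e0) auto
    then have "(\<lambda>n. std_normal_density (e n * \<xi>)) \<longlonglongrightarrow> c" by (simp add: std_normal_density_def c_def)
    then have "(\<lambda>n. ennreal (std_normal_density (e n * \<xi>) * (cmod (fourier f \<xi>))\<^sup>2)) \<longlonglongrightarrow> ennreal (c * (cmod (fourier f \<xi>))\<^sup>2)"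
      by (intro tendsto_intros)
    then show "ennreal (c * (cmod (fourier f \<xi>))\<^sup>2) = liminf (\<lambda>n. ennreal (std_normal_density (e n * \<xi>) * (cmod (fourier f \<xi>))\<^sup>2))"
      by (rule lim_imp_Liminf[symmetric, rotated]) simp
  qed
  also have "\<dots> \<le> liminf (\<lambda>n. \<integral>\<^sup>+\<xi>. ennreal (std_normal_density (e n * \<xi>) * (cmod (fourier f \<xi>))\<^sup>2) \<partial>lborel)"
    by (rule nn_integral_liminf) measurable
  also have "\<dots> \<le> liminf (\<lambda>n::nat. ennreal (c * (L2_norm f)\<^sup>2))"
    by (rule Liminf_mono) (use reg[OF e] in auto)
  also have "\<dots> = ennreal (c * (L2_norm f)\<^sup>2)" by (simp add: Liminf_const)
  finally have "(\<integral>\<^sup>+\<xi>. ennreal c * ennreal ((cmod (fourier f \<xi>))\<^sup>2) \<partial>lborel) \<le> ennreal c * ennreal ((L2_norm f)\<^sup>2)"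
    using c by (simp add: ennreal_mult)
  then have "ennreal c * (\<integral>\<^sup>+\<xi>. ennreal ((cmod (fourier f \<xi>))\<^sup>2) \<partial>lborel) \<le> ennreal c * ennreal ((L2_norm f)\<^sup>2)"
    by (subst (asm) nn_integral_cmult) auto
  then have le: "(\<integral>\<^sup>+\<xi>. ennreal ((cmod (fourier f \<xi>))\<^sup>2) \<partial>lborel) \<le> ennreal ((L2_norm f)\<^sup>2)"
    using c by (subst (asm) ennreal_mult_le_mult_iff) auto
  show "fourier f \<in> L2" "L2_norm (fourier f) \<le> L2_norm f"
    by (rule L2I_nn_integral[OF fourier_measurable L2_norm_nonneg le], measurable)+
qed

text \<open>The regularised inversion integral has two limits as the damping disappears: the
  undamped integral, dominated by the integrable transform, and the point value of \<open>f\<close>,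
  by continuity and boundedness.\<close>

lemma fourier_inversion:
  assumes f: "integrable lborel f" and fF: "integrable lborel (fourier f)"
    and cont: "continuous_on UNIV f" and b: "\<And>x. cmod (f x) \<le> B"
  shows "fourier (fourier f) y = f (- y)"
proof -
  note [measurable] = borel_measurable_integrable[OF f]
  have [measurable]: "fourier f \<in> borel_measurable borel" using borel_measurable_integrable[OF fF] by simp
  define c where "c = 1 / sqrt (2 * pi)"
  have c: "c > 0" by (simp add: c_def)
  define e where "e n = 1 / real (Suc n)" for n
  have e: "e n > 0" for n by (simp add: e_def)
  have e0: "e \<longlonglongrightarrow> 0" unfolding e_def by (rule LIMSEQ_Suc[OF lim_1_over_n])
  have "(\<lambda>n. LINT \<xi>|lborel. of_real (std_normal_density (e n * \<xi>)) * exp (\<i> * of_real (- y * \<xi>)) * fourier f \<xi>)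
     \<longlonglongrightarrow> (LINT \<xi>|lborel. of_real c * exp (\<i> * of_real (- y * \<xi>)) * fourier f \<xi>)"
  proof (rule integral_dominated_convergence[where w="\<lambda>\<xi>. c * cmod (fourier f \<xi>)"])
    show "integrable lborel (\<lambda>\<xi>. c * cmod (fourier f \<xi>))" by (intro integrable_mult_right integrable_norm fF)
    show "AE \<xi> in lborel. (\<lambda>n. of_real (std_normal_density (e n * \<xi>)) * exp (\<i> * of_real (- y * \<xi>)) * fourier f \<xi>)
      \<longlonglongrightarrow> of_real c * exp (\<i> * of_real (- y * \<xi>)) * fourier f \<xi>"
    proof (rule AE_I2)
      fix \<xi>
      have "(\<lambda>n. 1 / sqrt (2 * pi) * exp (- (e n * \<xi>)\<^sup>2 / 2)) \<longlonglongrightarrow> 1 / sqrt (2 * pi) * exp (- (0 * \<xi>)\<^sup>2 / 2)"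
        by (intro tendsto_intros e0) auto
      then have "(\<lambda>n. std_normal_density (e n * \<xi>)) \<longlonglongrightarrow> c" by (simp add: std_normal_density_def c_def)
      then show "(\<lambda>n. of_real (std_normal_density (e n * \<xi>)) * exp (\<i> * of_real (- y * \<xi>)) * fourier f \<xi>)
        \<longlonglongrightarrow> of_real c * exp (\<i> * of_real (- y * \<xi>)) * fourier f \<xi>"
        by (intro tendsto_intros)
    qed
    show "AE \<xi> in lborel. norm (of_real (std_normal_density (e n * \<xi>)) * exp (\<i> * of_real (- y * \<xi>)) * fourier f \<xi>) \<le> c * cmod (fourier f \<xi>)" for n
      using gauss_le exp_ii_norm(1)[of "- y * \<xi>" for \<xi>] unfolding c_def[symmetric]
      by (auto simp: norm_mult intro!: AE_I2 mult_right_mono)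
  qed measurable
  moreover have "(\<lambda>n. LINT z|lborel. f (- y - e n * z) * of_real (std_normal_density z)) \<longlonglongrightarrow> (LINT z|lborel. f (- y) * of_real (std_normal_density z))"
  proof (rule integral_dominated_convergence[where w="\<lambda>z. B * std_normal_density z"])
    show "AE z in lborel. (\<lambda>n. f (- y - e n * z) * of_real (std_normal_density z)) \<longlonglongrightarrow> f (- y) * of_real (std_normal_density z)"
    proof (rule AE_I2)
      fix z
      have "(\<lambda>n. - y - e n * z) \<longlonglongrightarrow> - y - 0 * z" by (intro tendsto_intros e0)
      then have "(\<lambda>n. f (- y - e n * z)) \<longlonglongrightarrow> f (- y)"
        using cont by (intro continuous_on_tendsto_compose[OF cont]) auto
      then show "(\<lambda>n. f (- y - e n * z) * of_real (std_normal_density z)) \<longlonglongrightarrow> f (- y) * of_real (std_normal_density z)"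
        by (intro tendsto_intros)
    qed
    show "AE z in lborel. norm (f (- y - e n * z) * of_real (std_normal_density z)) \<le> B * std_normal_density z" for n
      using b by (auto simp: norm_mult intro!: AE_I2 mult_right_mono)
  qed (auto intro!: integrable_mult_right)
  ultimately have "(LINT \<xi>|lborel. of_real c * exp (\<i> * of_real (- y * \<xi>)) * fourier f \<xi>) = (LINT z|lborel. f (- y) * of_real (std_normal_density z))"
    unfolding gauss_regularised_inversion[OF f e] by (rule LIMSEQ_unique)
  also have "\<dots> = f (- y)" by simp
  finally show ?thesis
    by (simp add: fourier_def[of "fourier f"] c_def mult.assoc mult.commute[of y])
qed

section \<open>The Fourier transform on the weighted Sobolev space\<close>

text \<open>Complex counterpart of the weight \<open>(1 + x\<^sup>2) powr (-1/2)\<close>, of the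
  same modulus. Its reciprocal is affine in \<open>x\<close>, so \<open>f\<close> is its product
  with \<open>f + \<i> x f\<close>, which lies in L2 as a linear combination; Cauchy-Schwarz then
  puts \<open>f\<close> into L1.\<close>

definition inv_bracket :: "real \<Rightarrow> complex" where "inv_bracket x = 1 / (1 + \<i> * of_real x)"

lemma one_plus_ii_nonzero: "1 + \<i> * complex_of_real x \<noteq> 0"
  by (simp add: complex_eq_iff)

lemma inv_bracket_L2: "inv_bracket \<in> L2"
proof (rule L2I)
  have "cmod (inv_bracket x) ^ 2 = 1 / (1 + x\<^sup>2)" for x
    by (simp add: inv_bracket_def norm_divide power_divide cmod_power2)
  then show "integrable lborel (\<lambda>x. (cmod (inv_bracket x))\<^sup>2)" using weight_integrable by simp
  show "inv_bracket \<in> borel_measurable borel" unfolding inv_bracket_def[abs_def] by measurable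
qed

lemma weighted_L2_integrable:
  assumes f: "f \<in> L2" and xf: "(\<lambda>x. of_real x * f x) \<in> L2"
  shows "integrable lborel f"
    and "(LINT x|lborel. cmod (f x)) \<le> L2_norm inv_bracket * (L2_norm f + L2_norm (\<lambda>x. of_real x * f x))"
proof -
  note [measurable] = L2_measurable[OF f]
  define v where "v x = f x + \<i> * (of_real x * f x)" for x
  have v: "v \<in> L2" unfolding v_def[abs_def] by (intro L2_add L2_cmult f xf)
  have eq: "cmod (inv_bracket x) * cmod (v x) = cmod (f x)" for x
  proof -
    have "v x = (1 + \<i> * of_real x) * f x" by (simp add: v_def algebra_simps)
    then have "inv_bracket x * v x = f x" using one_plus_ii_nonzero[of x] by (simp add: inv_bracket_def)
    then show ?thesis by (metis norm_mult)
  qed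
  have i: "integrable lborel (\<lambda>x. cmod (f x))" using L2_mult_integrable[OF inv_bracket_L2 v] by (simp add: eq)
  show "integrable lborel f" by (rule integrable_norm_cancel[OF i]) simp
  have "(LINT x|lborel. cmod (f x)) \<le> L2_norm inv_bracket * L2_norm v"
    using L2_Cauchy_Schwarz[OF inv_bracket_L2 v] by (simp add: eq)
  also have "\<dots> \<le> L2_norm inv_bracket * (L2_norm f + L2_norm (\<lambda>x. of_real x * f x))"
    using L2_norm_triangle[OF f L2_cmult[OF xf, of \<i>]] unfolding v_def[abs_def]
    by (intro mult_left_mono) (auto simp: L2_norm_cmult)
  finally show "(LINT x|lborel. cmod (f x)) \<le> L2_norm inv_bracket * (L2_norm f + L2_norm (\<lambda>x. of_real x * f x))" .
qed

lemma ev_integrable: "integrable lborel (ev f)"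
  by (rule weighted_L2_integrable(1)[OF ev_L2]) (use mx_L2 in \<open>simp add: mx_def[abs_def]\<close>)

lemma ev_L1_bound: "(LINT x|lborel. cmod (ev f x)) \<le> 2 * L2_norm inv_bracket * norm f"
proof -
  have "(LINT x|lborel. cmod (ev f x)) \<le> L2_norm inv_bracket * (L2_norm (ev f) + L2_norm (mx f))"
    using weighted_L2_integrable(2)[OF ev_L2, of f] mx_L2[of f] by (simp add: mx_def[abs_def])
  also have "\<dots> \<le> L2_norm inv_bracket * (norm f + norm f)"
    by (intro mult_left_mono add_mono L2_norm_ev_le L2_norm_mx_le) simp
  finally show ?thesis by simp
qed

lemma fourier_ev_bound: "cmod (fourier (ev f) \<xi>) \<le> (1 / sqrt (2 * pi) * (2 * L2_norm inv_bracket)) * norm f"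
proof -
  have "cmod (fourier (ev f) \<xi>) \<le> 1 / sqrt (2 * pi) * (LINT x|lborel. cmod (ev f x))"
    by (rule fourier_bound[OF ev_integrable])
  also have "\<dots> \<le> 1 / sqrt (2 * pi) * (2 * L2_norm inv_bracket * norm f)"
    by (intro mult_left_mono ev_L1_bound) simp
  finally show ?thesis by (simp add: mult.assoc)
qed

text \<open>Instead of showing that \<open>p\<close> vanishes at infinity, the integral of
  \<open>p (x + 1) - p x\<close> is computed twice. Translation invariance gives 0; Fubini gives the
  integral of \<open>q\<close>, because every point lies in unit windows \<open>[x, x + 1]\<close>
  for a set of \<open>x\<close> of length one.\<close>

lemma ac_deriv_integral_zero:
  assumes a: "ac_deriv p q" and p: "integrable lborel p" and q: "integrable lborel q"
  shows "(LINT x|lborel. q x) = 0"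
proof -
  note [measurable] = borel_measurable_integrable[OF q]
  define A where "A = {z :: real \<times> real. fst z \<le> snd z \<and> snd z \<le> fst z + 1}"
  have [measurable]: "A \<in> sets (borel \<Otimes>\<^sub>M borel)"
    unfolding A_def borel_prod by (intro borel_closed closed_Collect_conj closed_Collect_le continuous_intros)
  have ind: "indicator A (x, s) = (indicator {x..x + 1} s :: real)" "indicator A (x, s) = (indicator {s - 1..s} x :: real)" for x s
    by (auto simp: A_def indicator_def)
  have meas: "(\<lambda>(s, x). indicator A (x, s) *\<^sub>R q s) \<in> borel_measurable (lborel \<Otimes>\<^sub>M lborel)" by measurable
  have int: "integrable (lborel \<Otimes>\<^sub>M lborel) (\<lambda>(s, x). indicator A (x, s) *\<^sub>R q s)"
  proof (rule lborel_pair.Fubini_integrable[OF meas])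
    show "integrable lborel (\<lambda>s. LINT x|lborel. norm (case (s, x) of (s, x) \<Rightarrow> indicator A (x, s) *\<^sub>R q s))"
      using q by (simp add: ind(2))
    show "AE s in lborel. integrable lborel (\<lambda>x. case (s, x) of (s, x) \<Rightarrow> indicator A (x, s) *\<^sub>R q s)"
      by (auto simp: ind(2) intro!: AE_I2 integrable_scaleR_left integrable_real_indicator)
  qed
  have "(LINT x|lborel. q x) = (LINT s|lborel. LINT x|lborel. indicator A (x, s) *\<^sub>R q s)"
    by (simp add: ind(2))
  also have "\<dots> = (LINT x|lborel. LINT s|lborel. indicator A (x, s) *\<^sub>R q s)"
    by (rule lborel_pair.Fubini_integral[symmetric]) (use int in simp)
  also have "\<dots> = (LINT x|lborel. p (1 + 1 * x) - p x)"
    using ac_deriv_eq[OF a] by (simp add: ind(1) set_lebesgue_integral_def add.commute[of 1])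
  also have "\<dots> = (LINT x|lborel. p (1 + 1 * x)) - (LINT x|lborel. p x)"
    by (intro Bochner_Integration.integral_diff p lborel_integrable_real_affine) simp
  also have "\<dots> = 0"
    using lborel_integral_real_affine[of 1 p 1] by simp
  finally show ?thesis .
qed

lemma ac_deriv_exp: "ac_deriv (\<lambda>x. exp (- \<i> * of_real (x * \<xi>))) (\<lambda>x. - \<i> * of_real \<xi> * exp (- \<i> * of_real (x * \<xi>)))"
proof (rule ac_deriv_C1)
  fix x :: real
  have "((\<lambda>z. exp (- \<i> * (z * of_real \<xi>))) has_field_derivative (- \<i> * of_real \<xi> * exp (- \<i> * (of_real x * of_real \<xi>)))) (at (of_real x))"
    by (auto intro!: derivative_eq_intros)
  from has_vector_derivative_real_field[OF this]
  show "((\<lambda>x. exp (- \<i> * of_real (x * \<xi>))) has_vector_derivative (- \<i> * of_real \<xi> * exp (- \<i> * of_real (x * \<xi>)))) (at x)"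
    by simp
qed (intro continuous_intros)

lemma fourier_dv:
  assumes "integrable lborel (dv f)"
  shows "fourier (dv f) \<xi> = \<i> * of_real \<xi> * fourier (ev f) \<xi>"
proof -
  have i1: "integrable lborel (\<lambda>x. exp (- \<i> * of_real (x * \<xi>)) * ev f x)" by (rule fourier_integrand[OF ev_integrable])
  have i2: "integrable lborel (\<lambda>x. exp (- \<i> * of_real (x * \<xi>)) * dv f x)" by (rule fourier_integrand[OF assms])
  have i3: "integrable lborel (\<lambda>x. - \<i> * of_real \<xi> * exp (- \<i> * of_real (x * \<xi>)) * ev f x)"
    using integrable_mult_right[OF i1, of "- \<i> * of_real \<xi>"] by (simp add: mult.assoc)
  have "(LINT x|lborel. - \<i> * of_real \<xi> * exp (- \<i> * of_real (x * \<xi>)) * ev f x + exp (- \<i> * of_real (x * \<xi>)) * dv f x) = 0"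
    by (rule ac_deriv_integral_zero[OF ac_deriv_mult[OF ac_deriv_exp ac_deriv_dv] i1 Bochner_Integration.integrable_add[OF i3 i2]])
  then have "(LINT x|lborel. exp (- \<i> * of_real (x * \<xi>)) * dv f x) = \<i> * of_real \<xi> * (LINT x|lborel. exp (- \<i> * of_real (x * \<xi>)) * ev f x)"
    unfolding Bochner_Integration.integral_add[OF i3 i2] by (simp add: mult.assoc add_eq_0_iff)
  then show ?thesis by (simp add: fourier_def)
qed

text \<open>Integrating the claimed derivative over \<open>[a, b]\<close> means pairing it with an
  indicator. The multiplication formula moves the transform onto the indicator, where it is a
  difference of exponentials divided by \<open>- \<i> x\<close>, and the factor
  \<open>- \<i> x\<close> of \<open>g\<close> cancels the denominator.\<close>

lemma ac_deriv_fourier: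
  assumes f: "integrable lborel f" and xf: "integrable lborel (\<lambda>x. of_real x * f x)"
  shows "ac_deriv (fourier f) (fourier (\<lambda>x. - \<i> * (of_real x * f x)))"
proof -
  define g where "g x = - \<i> * (of_real x * f x)" for x
  have g: "integrable lborel g" unfolding g_def[abs_def] by (intro integrable_mult_right xf)
  note [measurable] = borel_measurable_integrable[OF f] borel_measurable_integrable[OF g]
  have gm[measurable]: "fourier g \<in> borel_measurable borel" by measurable
  have "ac_deriv (fourier f) (fourier g)"
    unfolding ac_deriv_def
  proof (intro conjI allI impI gm)
    fix a b :: real assume ab: "a \<le> b"
    define h where "h \<xi> = (indicator {a..b} \<xi> :: complex)" for \<xi>
    have h: "integrable lborel h"
    proof -
      have "integrable lborel (\<lambda>\<xi>. complex_of_real (indicator {a..b} \<xi>))"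
        by (intro integrable_of_real integrable_real_indicator) (auto simp: emeasure_lborel_Icc_eq)
      moreover have "(\<lambda>\<xi>. complex_of_real (indicator {a..b} \<xi>)) = h" by (auto simp: h_def indicator_def)
      ultimately show ?thesis by simp
    qed
    have hg: "(\<lambda>\<xi>. indicator {a..b} \<xi> *\<^sub>R fourier g \<xi>) = (\<lambda>\<xi>. h \<xi> * fourier g \<xi>)"
      by (auto simp: h_def indicator_def)
    show "set_integrable lborel {a..b} (fourier g)"
      unfolding set_integrable_def hg by (rule fourier_multiplication_formula(2)[OF h g])
    have eq: "g x * fourier h x = of_real (1 / sqrt (2 * pi)) * ((exp (- \<i> * of_real (x * b)) - exp (- \<i> * of_real (x * a))) * f x)" for x
    proof -
      have "(LINT \<xi>:{a..b}|lborel. - \<i> * of_real x * exp (- \<i> * of_real (\<xi> * x))) = exp (- \<i> * of_real (b * x)) - exp (- \<i> * of_real (a * x))"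
        by (rule ac_deriv_eq[OF ac_deriv_exp ab, symmetric])
      moreover have "(LINT \<xi>:{a..b}|lborel. - \<i> * of_real x * exp (- \<i> * of_real (\<xi> * x))) 
         = - \<i> * of_real x * (LINT \<xi>|lborel. exp (- \<i> * of_real (\<xi> * x)) * h \<xi>)"
        unfolding set_lebesgue_integral_def integral_mult_right_zero[symmetric]
        by (intro Bochner_Integration.integral_cong refl) (auto simp: h_def indicator_def)
      ultimately have e: "- \<i> * of_real x * (LINT \<xi>|lborel. exp (- \<i> * of_real (\<xi> * x)) * h \<xi>) = exp (- \<i> * of_real (b * x)) - exp (- \<i> * of_real (a * x))"
        by simp
      have "g x * fourier h x = of_real (1 / sqrt (2 * pi)) * ((- \<i> * of_real x * (LINT \<xi>|lborel. exp (- \<i> * of_real (\<xi> * x)) * h \<xi>)) * f x)"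
        by (simp add: fourier_def g_def mult_ac)
      then show ?thesis unfolding e by (simp add: mult.commute)
    qed
    have "(LINT \<xi>:{a..b}|lborel. fourier g \<xi>) = (LINT \<xi>|lborel. h \<xi> * fourier g \<xi>)"
      by (simp only: set_lebesgue_integral_def hg)
    also have "\<dots> = (LINT x|lborel. g x * fourier h x)" by (rule fourier_multiplication_formula(1)[OF g h])
    also have "\<dots> = (LINT x|lborel. of_real (1 / sqrt (2 * pi)) * ((exp (- \<i> * of_real (x * b)) - exp (- \<i> * of_real (x * a))) * f x))"
      by (simp only: eq)
    also have "\<dots> = fourier f b - fourier f a"
      unfolding left_diff_distrib integral_mult_right_zero
      unfolding Bochner_Integration.integral_diff[OF fourier_integrand[OF f] fourier_integrand[OF f]]
      by (simp add: fourier_def right_diff_distrib)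
    finally show "fourier f b - fourier f a = (LINT \<xi>:{a..b}|lborel. fourier g \<xi>)" ..
  qed
  then show ?thesis by (simp add: g_def[abs_def])
qed

text \<open>Controlling all combinations \<open>a x f + b f'\<close> at once records, beyond the isometry, how the Fourier
  transform acts on the operator \<open>x + i t \<partial>\<^sub>x\<close>.\<close>

definition mixed_norm :: "complex \<Rightarrow> complex \<Rightarrow> h11 \<Rightarrow> real" where
  "mixed_norm a b f = L2_norm (\<lambda>x. a * mx f x + b * dv f x)"

lemma mixed_norm_L2: "(\<lambda>x. a * mx f x + b * dv f x) \<in> L2"
  by (intro L2_add L2_cmult mx_L2 dv_L2)

lemma mixed_norm_le: "mixed_norm a b f \<le> (cmod a + cmod b) * norm f"
proof -
  have "mixed_norm a b f \<le> L2_norm (\<lambda>x. a * mx f x) + L2_norm (\<lambda>x. b * dv f x)"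
    unfolding mixed_norm_def by (intro L2_norm_triangle L2_cmult mx_L2 dv_L2)
  also have "\<dots> \<le> cmod a * norm f + cmod b * norm f"
    unfolding L2_norm_cmult by (intro add_mono mult_left_mono L2_norm_mx_le L2_norm_dv_le) auto
  finally show ?thesis by (simp add: distrib_right)
qed

lemma mixed_norm_triangle: "mixed_norm a b f \<le> mixed_norm a b g + mixed_norm a b (f - g)"
proof -
  have "mixed_norm a b f = L2_norm (\<lambda>x. (a * mx g x + b * dv g x) + (a * mx (f - g) x + b * dv (f - g) x))"
    unfolding mixed_norm_def
  proof (rule L2_norm_cong_AE)
    show "AE x in lborel. a * mx f x + b * dv f x = a * mx g x + b * dv g x + (a * mx (f - g) x + b * dv (f - g) x)"
      using dv_diff[of f g] by eventually_elim (simp add: mx_diff right_diff_distrib)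
  qed measurable
  also have "\<dots> \<le> mixed_norm a b g + mixed_norm a b (f - g)"
    unfolding mixed_norm_def by (intro L2_norm_triangle mixed_norm_L2)
  finally show ?thesis .
qed

lemma mixed_norm_tendsto: assumes "X \<longlonglongrightarrow> f" shows "(\<lambda>n. mixed_norm a b (X n)) \<longlonglongrightarrow> mixed_norm a b f"
proof (rule LIM_zero_cancel, rule Lim_null_comparison)
  have "(\<lambda>n. norm (X n - f)) \<longlonglongrightarrow> 0" using assms by (simp add: LIM_zero tendsto_norm_zero)
  then show "(\<lambda>n. (cmod a + cmod b) * norm (X n - f)) \<longlonglongrightarrow> 0" by (rule tendsto_mult_right_zero)
  have "\<bar>mixed_norm a b (X n) - mixed_norm a b f\<bar> \<le> (cmod a + cmod b) * norm (X n - f)" for n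
    using mixed_norm_triangle[of a b "X n" f] mixed_norm_triangle[of a b f "X n"] mixed_norm_le[of a b "X n - f"] mixed_norm_le[of a b "f - X n"]
    by (simp add: norm_minus_commute[of f])
  then show "\<forall>\<^sub>F n in sequentially. norm (mixed_norm a b (X n) - mixed_norm a b f) \<le> (cmod a + cmod b) * norm (X n - f)" by simp
qed

lemma mixed_norm_special: "mixed_norm 0 b f = cmod b * L2_norm (dv f)" "mixed_norm a 0 f = cmod a * L2_norm (mx f)"
  by (simp_all add: mixed_norm_def L2_norm_cmult)

text \<open>On this subspace the rules exchanging multiplication by \<open>x\<close> and differentiation hold with
  absolutely convergent integrals. It is dense because Gaussian cutoffs lie in it.\<close>

definition nice :: "h11 \<Rightarrow> bool" where
  "nice f \<longleftrightarrow> integrable lborel (dv f) \<and> integrable lborel (mx f)"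

text \<open>Write \<open>F\<close> for the transform of \<open>f\<close>. Multiplication by
  \<open>\<xi>\<close> turns it into \<open>- \<i>\<close> times the transform of \<open>f'\<close>,
  and differentiation into \<open>- \<i>\<close> times that of \<open>x f\<close>. Hence
  \<open>b \<i> \<xi> F + a \<i> F'\<close> is the transform of \<open>a x f + b f'\<close>, and
  everything reduces to the L2 bound.\<close>

lemma nice_fourier:
  assumes "nice f"
  defines "F \<equiv> mk_h11 (fourier (ev f))"
  shows "ev F = fourier (ev f)" "L2_norm (ev F) \<le> L2_norm (ev f)" "mixed_norm (b * \<i>) (a * \<i>) F \<le> mixed_norm a b f" "norm F \<le> norm f"
proof -
  have d: "integrable lborel (dv f)" and m: "integrable lborel (mx f)" using assms by (auto simp: nice_def)
  have a: "ac_deriv (fourier (ev f)) (fourier (\<lambda>x. - \<i> * mx f x))"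
    using ac_deriv_fourier[OF ev_integrable] m by (simp add: mx_def[abs_def])
  have L0: "fourier (ev f) \<in> L2" by (rule fourier_L2_bound(1)[OF ev_L2 ev_integrable])
  have L1: "fourier (\<lambda>x. - \<i> * mx f x) \<in> L2"
    by (intro fourier_L2_bound(1) L2_cmult mx_L2 integrable_mult_right m)
  have mf: "of_real \<xi> * fourier (ev f) \<xi> = - \<i> * fourier (dv f) \<xi>" for \<xi>
    by (simp add: fourier_dv[OF d] mult.assoc[symmetric])
  have L2': "(\<lambda>\<xi>. of_real \<xi> * fourier (ev f) \<xi>) \<in> L2"
    unfolding mf by (intro L2_cmult fourier_L2_bound(1) dv_L2 d)
  note mk = mk_h11[OF a L0 L1 L2']
  show eF: "ev F = fourier (ev f)" unfolding F_def by (rule mk)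
  show e0: "L2_norm (ev F) \<le> L2_norm (ev f)" unfolding eF by (rule fourier_L2_bound(2)[OF ev_L2 ev_integrable])
  have *: "mixed_norm (b * \<i>) (a * \<i>) F \<le> mixed_norm a b f" for a b
  proof -
    have i: "integrable lborel (\<lambda>x. a * mx f x + b * dv f x)" using m d by auto
    have "mixed_norm (b * \<i>) (a * \<i>) F = L2_norm (fourier (\<lambda>x. a * mx f x + b * dv f x))"
      unfolding mixed_norm_def
    proof (rule L2_norm_cong_AE)
      show "AE \<xi> in lborel. b * \<i> * mx F \<xi> + a * \<i> * dv F \<xi> = fourier (\<lambda>x. a * mx f x + b * dv f x) \<xi>"
        using mk(2) unfolding F_def[symmetric]
      proof eventually_elim
        case (elim \<xi>)
        have "b * \<i> * mx F \<xi> = b * fourier (dv f) \<xi>" by (simp add: mx_def eF mf complex_eq_iff algebra_simps)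
        moreover have "a * \<i> * dv F \<xi> = a * fourier (mx f) \<xi>" unfolding elim fourier_cmult by (simp add: complex_eq_iff algebra_simps)
        moreover have "fourier (\<lambda>x. a * mx f x + b * dv f x) \<xi> = a * fourier (mx f) \<xi> + b * fourier (dv f) \<xi>"
          using m d by (subst fourier_add) (auto simp: fourier_cmult)
        ultimately show ?case by (simp only: add.commute)
      qed
    qed measurable
    also have "\<dots> \<le> mixed_norm a b f" unfolding mixed_norm_def by (rule fourier_L2_bound(2)[OF mixed_norm_L2 i])
    finally show ?thesis .
  qed
  then show "mixed_norm (b * \<i>) (a * \<i>) F \<le> mixed_norm a b f" .
  have "L2_norm (dv F) \<le> L2_norm (mx f)" using *[of 0 "- \<i>"] by (simp add: mixed_norm_special)
  moreover have "L2_norm (mx F) \<le> L2_norm (dv f)" using *[of "- \<i>" 0] by (simp add: mixed_norm_special)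
  ultimately have "(norm F)\<^sup>2 \<le> (norm f)\<^sup>2"
    using e0 unfolding norm_h11_power2 by (smt (verit) L2_norm_nonneg power_mono)
  then show "norm F \<le> norm f" by (rule power2_le_imp_le) simp
qed

section \<open>Density of the integrable subspace by Gaussian cutoffs\<close>

definition cutoff :: "nat \<Rightarrow> real \<Rightarrow> real" where
  "cutoff n x = exp (- (x\<^sup>2 / real (Suc n)))"

lemma cutoff_bounds: "0 \<le> cutoff n x" "cutoff n x \<le> 1" "\<bar>cutoff n x - 1\<bar> \<le> 1"
proof -
  show 1: "0 \<le> cutoff n x" and 2: "cutoff n x \<le> 1" by (auto simp: cutoff_def)
  then show "\<bar>cutoff n x - 1\<bar> \<le> 1" by linarith
qed

lemma cutoff_tendsto: "(\<lambda>n. cutoff n x) \<longlonglongrightarrow> 1"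
proof -
  have "(\<lambda>n. exp (- (x\<^sup>2 * (1 / real (Suc n))))) \<longlonglongrightarrow> exp (- (x\<^sup>2 * 0))"
    by (intro tendsto_intros LIMSEQ_Suc[OF lim_1_over_n])
  then show ?thesis by (simp add: cutoff_def)
qed

lemma cutoff_L2: "(\<lambda>x. of_real (cutoff n x)) \<in> L2"
proof (rule L2I)
  show "integrable lborel (\<lambda>x. (cmod (of_real (cutoff n x)))\<^sup>2)"
  proof (rule Bochner_Integration.integrable_bound)
    show "integrable lborel (\<lambda>x. real (Suc n) * (1 / (1 + x\<^sup>2)))" by (intro integrable_mult_right weight_integrable)
    have "(cutoff n x)\<^sup>2 \<le> real (Suc n) * (1 / (1 + x\<^sup>2))" for x
    proof -
      have "(cutoff n x)\<^sup>2 \<le> cutoff n x"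
        using cutoff_bounds[of n x] mult_right_mono[of "cutoff n x" 1 "cutoff n x"] by (simp add: power2_eq_square)
      also have "\<dots> = 1 / exp (x\<^sup>2 / real (Suc n))" by (simp add: cutoff_def exp_minus inverse_eq_divide)
      also have "\<dots> \<le> 1 / (1 + x\<^sup>2 / real (Suc n))"
        by (intro divide_left_mono exp_ge_add_one_self mult_pos_pos) (auto intro: add_pos_nonneg)
      also have "\<dots> \<le> real (Suc n) * (1 / (1 + x\<^sup>2))"
      proof -
        have "1 / (1 + x\<^sup>2 / real (Suc n)) = real (Suc n) / (real (Suc n) + x\<^sup>2)" by (simp add: field_simps)
        also have "\<dots> \<le> real (Suc n) / (1 + x\<^sup>2)" by (intro divide_left_mono) (auto intro!: mult_pos_pos add_pos_nonneg)
        finally show ?thesis by simp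
      qed
      finally show ?thesis .
    qed
    then show "AE x in lborel. norm ((cmod (of_real (cutoff n x)))\<^sup>2) \<le> norm (real (Suc n) * (1 / (1 + x\<^sup>2)))"
      by (intro AE_I2) (auto intro: order_trans[OF _ abs_ge_self] simp del: of_nat_Suc)
  qed (simp add: cutoff_def)
qed (simp add: cutoff_def)

lemma cutoff_measurable [measurable]: "cutoff n \<in> borel_measurable borel"
  unfolding cutoff_def[abs_def] by measurable

definition cut :: "nat \<Rightarrow> h11 \<Rightarrow> h11" where
  "cut n f = mk_h11 (\<lambda>x. of_real (cutoff n x) * ev f x)"

lemma cut:
  shows ev_cut: "ev (cut n f) = (\<lambda>x. of_real (cutoff n x) * ev f x)"
    and dv_cut: "AE x in lborel. dv (cut n f) x = of_real (cutoff n x) * (dv f x - of_real (2 / real (Suc n)) * mx f x)"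
proof -
  have bd: "(\<lambda>x. of_real (cutoff n x) * h x) \<in> L2" if "h \<in> L2" for h
    by (rule L2_mult_bounded[OF that, where C=1]) (use cutoff_bounds[of n] in auto)
  have ac: "ac_deriv (\<lambda>x. complex_of_real (cutoff n x)) (\<lambda>x. of_real (- 2 / real (Suc n) * (x * cutoff n x)))"
  proof (rule ac_deriv_C1)
    fix x
    have "(cutoff n has_real_derivative (- 2 / real (Suc n) * (x * cutoff n x))) (at x)"
      unfolding cutoff_def[abs_def] by (auto intro!: derivative_eq_intros simp: field_simps simp del: of_nat_Suc)
    then show "((\<lambda>x. complex_of_real (cutoff n x)) has_vector_derivative of_real (- 2 / real (Suc n) * (x * cutoff n x))) (at x)"
      by (rule has_vector_derivative_of_real)
    show "continuous_on UNIV (\<lambda>x. complex_of_real (- 2 / real (Suc n) * (x * cutoff n x)))"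
      unfolding cutoff_def by (intro continuous_intros) auto
  qed
  have a: "ac_deriv (\<lambda>x. of_real (cutoff n x) * ev f x) (\<lambda>x. of_real (cutoff n x) * (dv f x - of_real (2 / real (Suc n)) * mx f x))"
    by (rule ac_deriv_cong_AE[OF ac_deriv_mult[OF ac ac_deriv_dv]]) (auto simp: mx_def algebra_simps)
  have x: "(\<lambda>x. of_real x * (of_real (cutoff n x) * ev f x)) \<in> L2"
    using bd[OF mx_L2[of f]] by (simp add: mx_def algebra_simps)
  have d: "(\<lambda>x. of_real (cutoff n x) * (dv f x - of_real (2 / real (Suc n)) * mx f x)) \<in> L2"
    by (intro bd L2_diff L2_cmult dv_L2 mx_L2)
  show "ev (cut n f) = (\<lambda>x. of_real (cutoff n x) * ev f x)"
    unfolding cut_def by (rule ev_mk[OF a bd[OF ev_L2] d x])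
  show "AE x in lborel. dv (cut n f) x = of_real (cutoff n x) * (dv f x - of_real (2 / real (Suc n)) * mx f x)"
    unfolding cut_def by (rule dv_mk[OF a bd[OF ev_L2] d x])
qed

lemma nice_cut: "nice (cut n f)"
  unfolding nice_def
proof
  have "integrable lborel (\<lambda>x. of_real (cutoff n x) * (dv f x - of_real (2 / real (Suc n)) * mx f x))"
    by (intro L2_mult_integrable_complex cutoff_L2 L2_diff L2_cmult dv_L2 mx_L2)
  then show "integrable lborel (dv (cut n f))"
    by (rule integrable_cong_AE_imp) (use dv_cut[of n f] in \<open>auto simp: eq_commute\<close>)
  have "integrable lborel (\<lambda>x. of_real (cutoff n x) * mx f x)"
    by (intro L2_mult_integrable_complex cutoff_L2 mx_L2)
  then show "integrable lborel (mx (cut n f))"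
    by (simp add: mx_def[abs_def] ev_cut mult_ac)
qed

text \<open>Differentiating the cutoff costs a term of size \<open>2 / (n + 1)\<close> times
  \<open>x f\<close>, which the weight in the norm controls; all other differences vanish by
  dominated convergence.\<close>

lemma cut_tendsto: "(\<lambda>n. cut n f) \<longlonglongrightarrow> f"
proof -
  have gen: "(\<lambda>n. L2_norm (\<lambda>x. of_real (cutoff n x - 1) * h x)) \<longlonglongrightarrow> 0" if h: "h \<in> L2" for h
  proof (rule L2_norm_dominated_tendsto_0[OF h, where C=1])
    note [measurable] = L2_measurable[OF h]
    show "(\<lambda>x. complex_of_real (cutoff n x - 1) * h x) \<in> borel_measurable borel" for n by measurable
    show "AE x in lborel. cmod (of_real (cutoff n x - 1) * h x) \<le> 1 * cmod (h x)" for n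
      unfolding norm_mult norm_of_real by (intro AE_I2 mult_right_mono cutoff_bounds) simp
    have "(\<lambda>n. of_real (cutoff n x - 1) * h x) \<longlonglongrightarrow> of_real (1 - 1) * h x" for x
      by (intro tendsto_intros cutoff_tendsto)
    then show "AE x in lborel. (\<lambda>n. of_real (cutoff n x - 1) * h x) \<longlonglongrightarrow> 0" by simp
  qed
  have 0: "(\<lambda>n. L2_norm (ev (cut n f - f))) \<longlonglongrightarrow> 0"
    using gen[OF ev_L2[of f]] by (simp add: ev_diff ev_cut left_diff_distrib)
  have 2: "(\<lambda>n. L2_norm (mx (cut n f - f))) \<longlonglongrightarrow> 0"
    using gen[OF mx_L2[of f]] by (simp add: mx_def[abs_def] ev_diff ev_cut algebra_simps)
  have 1: "(\<lambda>n. L2_norm (dv (cut n f - f))) \<longlonglongrightarrow> 0"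
  proof (rule Lim_null_comparison)
    show "(\<lambda>n. L2_norm (\<lambda>x. of_real (cutoff n x - 1) * dv f x) + 2 * (1 / real (Suc n)) * L2_norm (mx f)) \<longlonglongrightarrow> 0"
      by (rule tendsto_eq_intros gen dv_L2 LIMSEQ_Suc[OF lim_1_over_n] refl)+ simp
    have "L2_norm (dv (cut n f - f)) \<le> L2_norm (\<lambda>x. of_real (cutoff n x - 1) * dv f x) + 2 * (1 / real (Suc n)) * L2_norm (mx f)" for n
    proof -
      define k where "k = (2 / real (Suc n))"
      have k: "0 \<le> k" by (simp add: k_def)
      have L1: "(\<lambda>x. complex_of_real (cutoff n x - 1) * dv f x) \<in> L2"
        by (rule L2_mult_bounded[OF dv_L2, where C=1]) (use cutoff_bounds[of n] in \<open>auto simp del: of_real_diff\<close>)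
      have L2: "(\<lambda>x. complex_of_real (cutoff n x) * mx f x) \<in> L2"
        by (rule L2_mult_bounded[OF mx_L2, where C=1]) (use cutoff_bounds[of n] in auto)
      have L3: "L2_norm (\<lambda>x. complex_of_real (cutoff n x) * mx f x) \<le> 1 * L2_norm (mx f)"
        by (rule L2_norm_mono[OF mx_L2]) (use cutoff_bounds[of n] in \<open>auto simp: norm_mult intro!: AE_I2 mult_left_le_one_le\<close>)
      have "L2_norm (dv (cut n f - f)) = L2_norm (\<lambda>x. of_real (cutoff n x - 1) * dv f x - of_real k * (of_real (cutoff n x) * mx f x))"
      proof (rule L2_norm_cong_AE)
        show "AE x in lborel. dv (cut n f - f) x = of_real (cutoff n x - 1) * dv f x - of_real k * (of_real (cutoff n x) * mx f x)"
          using dv_diff[of "cut n f" f] dv_cut[of n f] unfolding k_def[symmetric] 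
          by eventually_elim (simp add: algebra_simps)
      qed measurable
      also have "\<dots> \<le> L2_norm (\<lambda>x. of_real (cutoff n x - 1) * dv f x) + L2_norm (\<lambda>x. of_real k * (of_real (cutoff n x) * mx f x))"
        by (rule L2_norm_diff_triangle[OF L1 L2_cmult[OF L2]])
      also have "L2_norm (\<lambda>x. of_real k * (of_real (cutoff n x) * mx f x)) \<le> k * L2_norm (mx f)"
        unfolding L2_norm_cmult using mult_left_mono[OF L3 k] k by simp
      finally show ?thesis by (simp add: k_def)
    qed
    then show "\<forall>\<^sub>F n in sequentially. norm (L2_norm (dv (cut n f - f))) \<le> L2_norm (\<lambda>x. of_real (cutoff n x - 1) * dv f x) + 2 * (1 / real (Suc n)) * L2_norm (mx f)"
      by simp
  qed
  have "(\<lambda>n. norm (cut n f - f)) \<longlonglongrightarrow> 0"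
  proof (rule Lim_null_comparison)
    show "(\<lambda>n. L2_norm (ev (cut n f - f)) + L2_norm (dv (cut n f - f)) + L2_norm (mx (cut n f - f))) \<longlonglongrightarrow> 0"
      using tendsto_add[OF tendsto_add[OF 0 1] 2] by simp
    show "\<forall>\<^sub>F n in sequentially. norm (norm (cut n f - f)) \<le> L2_norm (ev (cut n f - f)) + L2_norm (dv (cut n f - f)) + L2_norm (mx (cut n f - f))"
      using norm_h11_le by simp
  qed
  then show ?thesis by (simp add: LIM_zero_iff tendsto_norm_zero_iff)
qed

lemma nice_diff: assumes "nice f" "nice g" shows "nice (f - g)"
proof -
  have "integrable lborel (\<lambda>x. dv f x - dv g x)" using assms by (auto simp: nice_def)
  then have "integrable lborel (dv (f - g))"
    by (rule integrable_cong_AE_imp) (use dv_diff[of f g] in \<open>auto simp: eq_commute\<close>)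
  then show ?thesis using assms by (auto simp: nice_def mx_diff)
qed

section \<open>Extension of the transform to the whole space, and its isometry\<close>

definition h11_fourier :: "h11 \<Rightarrow> h11" where "h11_fourier f = mk_h11 (fourier (ev f))"

text \<open>For general \<open>f\<close> it is not clear at first that \<open>fourier (ev f)\<close>
  lies in the space, as \<open>mk_h11\<close> presupposes. The contraction property on the dense
  subspace makes the transforms of the cutoffs a Cauchy sequence, and the pointwise bound
  \<open>fourier_ev_bound\<close> identifies their limit with the integral.\<close>

lemma h11_fourier_cut: "ev (h11_fourier f) = fourier (ev f)" "(\<lambda>n. h11_fourier (cut n f)) \<longlonglongrightarrow> h11_fourier f"
proof -
  have diff: "h11_fourier (cut n f) - h11_fourier (cut m f) = h11_fourier (cut n f - cut m f)" for n m
    unfolding h11_fourier_def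
    by (rule h11_eqI) (simp add: ev_diff nice_fourier(1) nice_cut nice_fourier(1)[OF nice_diff[OF nice_cut nice_cut], unfolded ev_diff] fourier_diff ev_integrable)
  have le: "norm (h11_fourier (cut n f) - h11_fourier (cut m f)) \<le> norm (cut n f - cut m f)" for n m
    unfolding diff unfolding h11_fourier_def by (rule nice_fourier(4)[OF nice_diff[OF nice_cut nice_cut]])
  have "Cauchy (\<lambda>n. cut n f)" using cut_tendsto by (intro convergent_Cauchy) (auto simp: convergent_def)
  have "Cauchy (\<lambda>n. h11_fourier (cut n f))"
  proof (rule CauchyI)
    fix e :: real assume "e > 0"
    then obtain N where "\<forall>m\<ge>N. \<forall>n\<ge>N. norm (cut m f - cut n f) < e" using CauchyD[OF \<open>Cauchy (\<lambda>n. cut n f)\<close>] by blast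
    then show "\<exists>M. \<forall>m\<ge>M. \<forall>n\<ge>M. norm (h11_fourier (cut m f) - h11_fourier (cut n f)) < e" using le le_less_trans by blast
  qed
  then obtain G where G: "(\<lambda>n. h11_fourier (cut n f)) \<longlonglongrightarrow> G" using Cauchy_convergent convergent_def by blast
  have eG: "ev G \<xi> = fourier (ev f) \<xi>" for \<xi>
  proof (rule LIMSEQ_unique)
    show "(\<lambda>n. ev (h11_fourier (cut n f)) \<xi>) \<longlonglongrightarrow> ev G \<xi>" by (rule bounded_linear.tendsto[OF bounded_linear_ev G])
    show "(\<lambda>n. ev (h11_fourier (cut n f)) \<xi>) \<longlonglongrightarrow> fourier (ev f) \<xi>"
    proof (rule LIM_zero_cancel, rule Lim_null_comparison)
      have "(\<lambda>n. norm (cut n f - f)) \<longlonglongrightarrow> 0" using cut_tendsto by (simp add: LIM_zero tendsto_norm_zero)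
      then show "(\<lambda>n. (1 / sqrt (2 * pi) * (2 * L2_norm inv_bracket)) * norm (cut n f - f)) \<longlonglongrightarrow> 0" by (rule tendsto_mult_right_zero)
      have "ev (h11_fourier (cut n f)) \<xi> - fourier (ev f) \<xi> = fourier (ev (cut n f - f)) \<xi>" for n
        by (simp add: h11_fourier_def nice_fourier(1) nice_cut ev_diff fourier_diff ev_integrable)
      then show "\<forall>\<^sub>F n in sequentially. norm (ev (h11_fourier (cut n f)) \<xi> - fourier (ev f) \<xi>) \<le> (1 / sqrt (2 * pi) * (2 * L2_norm inv_bracket)) * norm (cut n f - f)"
        using fourier_ev_bound by simp
    qed
  qed
  then have "fourier (ev f) = ev G" by auto
  then have "h11_fourier f = G" by (simp add: h11_fourier_def ev_inverse)
  then show "ev (h11_fourier f) = fourier (ev f)" "(\<lambda>n. h11_fourier (cut n f)) \<longlonglongrightarrow> h11_fourier f" using eG G by auto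
qed

lemmas ev_h11_fourier = h11_fourier_cut(1)

lemma mixed_norm_h11_fourier_le: "mixed_norm (b * \<i>) (a * \<i>) (h11_fourier f) \<le> mixed_norm a b f"
proof (rule LIMSEQ_le[OF mixed_norm_tendsto[OF h11_fourier_cut(2)] mixed_norm_tendsto[OF cut_tendsto]])
  show "\<exists>N. \<forall>n\<ge>N. mixed_norm (b * \<i>) (a * \<i>) (h11_fourier (cut n f)) \<le> mixed_norm a b (cut n f)"
    unfolding h11_fourier_def by (auto intro!: nice_fourier(3) nice_cut)
qed

lemma L2_norm_ev_h11_fourier_le: "L2_norm (ev (h11_fourier f)) \<le> L2_norm (ev f)"
  unfolding ev_h11_fourier by (rule fourier_L2_bound(2)[OF ev_L2 ev_integrable])

definition h11_refl :: "h11 \<Rightarrow> h11" where "h11_refl f = mk_h11 (\<lambda>x. ev f (- x))"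

lemma ev_refl: "ev (h11_refl f) = (\<lambda>x. ev f (- x))" 
  and dv_refl: "AE x in lborel. dv (h11_refl f) x = - dv f (- x)"
proof -
  have "(\<lambda>x. of_real x * ev f (- x)) \<in> L2" using L2_uminus[OF L2_reflect[OF mx_L2[of f]]] by (simp add: mx_def)
  note * = ac_deriv_reflect[OF ac_deriv_dv[of f]] L2_reflect[OF ev_L2[of f]] L2_uminus[OF L2_reflect[OF dv_L2[of f]]] this
  show "ev (h11_refl f) = (\<lambda>x. ev f (- x))" unfolding h11_refl_def by (rule ev_mk[OF *])
  show "AE x in lborel. dv (h11_refl f) x = - dv f (- x)" unfolding h11_refl_def by (rule dv_mk[OF *])
qed

lemma mixed_norm_refl: "mixed_norm a b (h11_refl f) = mixed_norm a b f"
proof -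
  have "mixed_norm a b (h11_refl f) = L2_norm (\<lambda>x. - (a * mx f (- x) + b * dv f (- x)))"
    unfolding mixed_norm_def
  proof (rule L2_norm_cong_AE)
    show "AE x in lborel. a * mx (h11_refl f) x + b * dv (h11_refl f) x = - (a * mx f (- x) + b * dv f (- x))"
      using dv_refl[of f] by eventually_elim (simp add: mx_def ev_refl algebra_simps)
  qed measurable
  also have "\<dots> = mixed_norm a b f"
    unfolding mixed_norm_def L2_norm_uminus by (rule L2_norm_reflect)
  finally show ?thesis .
qed

lemma L2_norm_ev_refl: "L2_norm (ev (h11_refl f)) = L2_norm (ev f)"
  by (simp add: ev_refl L2_norm_reflect)

lemma norm_refl: "norm (h11_refl f) = norm f"
proof -
  have "L2_norm (dv (h11_refl f)) = L2_norm (dv f)" "L2_norm (mx (h11_refl f)) = L2_norm (mx f)"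
    using mixed_norm_refl[of 0 1 f] mixed_norm_refl[of 1 0 f] by (simp_all add: mixed_norm_special)
  then have "(norm (h11_refl f))\<^sup>2 = (norm f)\<^sup>2" by (simp add: norm_h11_power2 L2_norm_ev_refl)
  then show ?thesis by simp
qed

lemma refl_linear: "bounded_linear h11_refl"
  by (rule bounded_linear_intro[where K=1]) (auto intro!: h11_eqI simp: ev_refl ev_add ev_scaleR norm_refl)

lemma refl_refl: "h11_refl (h11_refl f) = f"
  by (rule h11_eqI) (simp add: ev_refl)

text \<open>Inversion asks for an integrable transform; this is automatic, because the transform
  again belongs to the space.\<close>

lemma h11_fourier_h11_fourier: "h11_fourier (h11_fourier f) = h11_refl f"
proof (rule h11_eqI)
  fix x
  have "fourier (fourier (ev f)) x = ev f (- x)"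
  proof (rule fourier_inversion[OF ev_integrable])
    show "integrable lborel (fourier (ev f))" using ev_integrable[of "h11_fourier f"] by (simp add: ev_h11_fourier)
  qed (rule ev_continuous ev_sup)+
  then show "ev (h11_fourier (h11_fourier f)) x = ev (h11_refl f) x" by (simp add: ev_h11_fourier ev_refl)
qed

text \<open>The Fourier transform is a contraction whose square is an isometry, hence is isometric.\<close>

lemma mixed_norm_h11_fourier: "mixed_norm (b * \<i>) (a * \<i>) (h11_fourier f) = mixed_norm a b f"
proof (rule antisym[OF mixed_norm_h11_fourier_le])
  have "mixed_norm a b f = mixed_norm (- a) (- b) (h11_refl f)"
    unfolding mixed_norm_refl unfolding mixed_norm_def using L2_norm_uminus[of "\<lambda>x. a * mx f x + b * dv f x"] by simp
  also have "\<dots> = mixed_norm (a * \<i> * \<i>) (b * \<i> * \<i>) (h11_fourier (h11_fourier f))" by (simp add: h11_fourier_h11_fourier mult.assoc)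
  also have "\<dots> \<le> mixed_norm (b * \<i>) (a * \<i>) (h11_fourier f)" by (rule mixed_norm_h11_fourier_le)
  finally show "mixed_norm a b f \<le> mixed_norm (b * \<i>) (a * \<i>) (h11_fourier f)" .
qed

lemma L2_norm_ev_h11_fourier: "L2_norm (ev (h11_fourier f)) = L2_norm (ev f)"
proof (rule antisym[OF L2_norm_ev_h11_fourier_le])
  have "L2_norm (ev f) = L2_norm (ev (h11_fourier (h11_fourier f)))" by (simp add: h11_fourier_h11_fourier L2_norm_ev_refl)
  also have "\<dots> \<le> L2_norm (ev (h11_fourier f))" by (rule L2_norm_ev_h11_fourier_le)
  finally show "L2_norm (ev f) \<le> L2_norm (ev (h11_fourier f))" .
qed

lemma L2_norm_dv_h11_fourier: "L2_norm (dv (h11_fourier f)) = L2_norm (mx f)" 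
  and L2_norm_mx_h11_fourier: "L2_norm (mx (h11_fourier f)) = L2_norm (dv f)"
  using mixed_norm_h11_fourier[of 0 "- \<i>" f] mixed_norm_h11_fourier[of "- \<i>" 0 f] by (simp_all add: mixed_norm_special)

lemma norm_h11_fourier: "norm (h11_fourier f) = norm f"
proof -
  have "(norm (h11_fourier f))\<^sup>2 = (norm f)\<^sup>2" by (simp add: norm_h11_power2 L2_norm_ev_h11_fourier L2_norm_dv_h11_fourier L2_norm_mx_h11_fourier)
  then show ?thesis by simp
qed

lemma h11_fourier_linear: "bounded_linear h11_fourier"
proof (rule bounded_linear_intro[where K=1])
  show "h11_fourier (f + g) = h11_fourier f + h11_fourier g" for f g
    by (rule h11_eqI) (simp add: ev_h11_fourier ev_add fourier_add ev_integrable)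
  show "h11_fourier (r *\<^sub>R f) = r *\<^sub>R h11_fourier f" for r f
    by (rule h11_eqI) (simp add: ev_h11_fourier ev_scaleR scaleR_conv_of_real fourier_cmult)
qed (simp add: norm_h11_fourier)

lemma h11_fourier_scale: "h11_fourier (h11_scale c f) = h11_scale c (h11_fourier f)"
  by (rule h11_eqI) (simp add: ev_h11_fourier ev_scale fourier_cmult)

lemma refl_h11_fourier: "h11_refl (h11_fourier f) = h11_fourier (h11_refl f)"
  by (metis h11_fourier_h11_fourier)

section \<open>The Schroedinger group\<close>

definition phase :: "real \<Rightarrow> real \<Rightarrow> complex" where
  "phase t \<xi> = exp (- \<i> * of_real (t * \<xi>\<^sup>2 / 2))"

lemma phase_norm [simp]: "cmod (phase t \<xi>) = 1"
  unfolding phase_def using exp_ii_norm(2)[of "t * \<xi>\<^sup>2 / 2"] by simp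

lemma phase_measurable [measurable]: "phase t \<in> borel_measurable borel"
  unfolding phase_def[abs_def] by measurable

lemma phase_add: "phase s \<xi> * phase t \<xi> = phase (s + t) \<xi>"
  by (simp add: phase_def exp_add[symmetric] algebra_simps add_divide_distrib)

lemma phase_0 [simp]: "phase 0 \<xi> = 1"
  by (simp add: phase_def)

lemma phase_tendsto: assumes "(\<tau> \<longlongrightarrow> t) F" shows "((\<lambda>s. phase (\<tau> s) \<xi>) \<longlongrightarrow> phase t \<xi>) F"
  unfolding phase_def by (intro tendsto_intros assms) simp

lemma phase_minus_1: "cmod (phase h \<xi> - 1) \<le> \<bar>h\<bar> * \<xi>\<^sup>2 / 2"
  using iexp_approx1[of "- (h * \<xi>\<^sup>2 / 2)" 0] by (simp add: phase_def abs_mult)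

definition phase_mult :: "real \<Rightarrow> h11 \<Rightarrow> h11" where "phase_mult t f = mk_h11 (\<lambda>\<xi>. phase t \<xi> * ev f \<xi>)"

lemma phase_mult:
  shows ev_phase_mult: "ev (phase_mult t f) = (\<lambda>\<xi>. phase t \<xi> * ev f \<xi>)"
    and dv_phase_mult: "AE \<xi> in lborel. dv (phase_mult t f) \<xi> = phase t \<xi> * (dv f \<xi> - \<i> * of_real t * mx f \<xi>)"
proof -
  have bd: "(\<lambda>x. phase t x * h x) \<in> L2" if "h \<in> L2" for h
    by (rule L2_mult_bounded[OF that, where C=1]) auto
  have ac: "ac_deriv (phase t) (\<lambda>\<xi>. - \<i> * of_real t * of_real \<xi> * phase t \<xi>)"
  proof (rule ac_deriv_C1)
    fix x :: real
    have "((\<lambda>z. exp (- \<i> * (of_real t * z\<^sup>2 / 2))) has_field_derivative (- \<i> * of_real t * of_real x * exp (- \<i> * (of_real t * (of_real x)\<^sup>2 / 2)))) (at (of_real x))"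
      by (auto intro!: derivative_eq_intros)
    from has_vector_derivative_real_field[OF this]
    show "(phase t has_vector_derivative (- \<i> * of_real t * of_real x * phase t x)) (at x)"
      by (simp add: phase_def[abs_def])
    show "continuous_on UNIV (\<lambda>\<xi>. - \<i> * of_real t * of_real \<xi> * phase t \<xi>)"
      unfolding phase_def by (intro continuous_intros) auto
  qed
  have a: "ac_deriv (\<lambda>x. phase t x * ev f x) (\<lambda>\<xi>. phase t \<xi> * (dv f \<xi> - \<i> * of_real t * mx f \<xi>))"
    by (rule ac_deriv_cong_AE[OF ac_deriv_mult[OF ac ac_deriv_dv]]) (auto simp: mx_def algebra_simps)
  have x: "(\<lambda>x. of_real x * (phase t x * ev f x)) \<in> L2"
    using bd[OF mx_L2[of f]] by (simp add: mx_def algebra_simps)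
  have d: "(\<lambda>\<xi>. phase t \<xi> * (dv f \<xi> - \<i> * of_real t * mx f \<xi>)) \<in> L2"
    by (intro bd L2_diff L2_cmult dv_L2 mx_L2)
  show "ev (phase_mult t f) = (\<lambda>\<xi>. phase t \<xi> * ev f \<xi>)"
    unfolding phase_mult_def by (rule ev_mk[OF a bd[OF ev_L2] d x])
  show "AE \<xi> in lborel. dv (phase_mult t f) \<xi> = phase t \<xi> * (dv f \<xi> - \<i> * of_real t * mx f \<xi>)"
    unfolding phase_mult_def by (rule dv_mk[OF a bd[OF ev_L2] d x])
qed

lemma mx_phase_mult: "mx (phase_mult t f) = (\<lambda>\<xi>. phase t \<xi> * mx f \<xi>)"
  by (simp add: fun_eq_iff mx_def ev_phase_mult)

lemma L2_norm_ev_phase_mult: "L2_norm (ev (phase_mult t f)) = L2_norm (ev f)"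
  and L2_norm_mx_phase_mult: "L2_norm (mx (phase_mult t f)) = L2_norm (mx f)"
  by (simp_all add: ev_phase_mult mx_phase_mult L2_norm_def norm_mult)

lemma L2_norm_dv_phase_mult: "L2_norm (dv (phase_mult t f)) = mixed_norm (- \<i> * of_real t) 1 f"
proof -
  have "L2_norm (dv (phase_mult t f)) = L2_norm (\<lambda>\<xi>. phase t \<xi> * (dv f \<xi> - \<i> * of_real t * mx f \<xi>))"
    by (rule L2_norm_cong_AE) (use dv_phase_mult in auto)
  also have "\<dots> = mixed_norm (- \<i> * of_real t) 1 f"
    by (simp add: mixed_norm_def L2_norm_def norm_mult)
  finally show ?thesis .
qed

text \<open>Differentiating the phase adds \<open>t\<close> times the weighted function, so the
  group cannot be isometric for the full norm. Linear growth in \<open>t\<close> suffices for all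
  estimates below.\<close>

lemma norm_phase_mult: "norm (phase_mult t f) \<le> (1 + \<bar>t\<bar>) * norm f"
proof -
  define a b where "a = L2_norm (dv f)" and "b = L2_norm (mx f)"
  have nn: "0 \<le> a" "0 \<le> b" by (auto simp: a_def b_def)
  have "L2_norm (dv (phase_mult t f)) \<le> L2_norm (\<lambda>x. (- \<i> * of_real t) * mx f x) + L2_norm (\<lambda>x. 1 * dv f x)"
    unfolding L2_norm_dv_phase_mult mixed_norm_def by (intro L2_norm_triangle L2_cmult mx_L2 dv_L2)
  also have "\<dots> = \<bar>t\<bar> * b + a" unfolding L2_norm_cmult by (simp add: a_def b_def norm_mult)
  finally have d: "(L2_norm (dv (phase_mult t f)))\<^sup>2 \<le> (\<bar>t\<bar> * b + a)\<^sup>2" by (intro power_mono) auto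
  have ab: "2 * (a * b) \<le> 2 * (a\<^sup>2 + b\<^sup>2)" 
  proof -
    have "2 * (a * b) \<le> a\<^sup>2 + b\<^sup>2" using sum_squares_bound[of a b] by (simp add: mult.assoc)
    also have "\<dots> \<le> 2 * (a\<^sup>2 + b\<^sup>2)" by simp
    finally show ?thesis .
  qed
  have "(\<bar>t\<bar> * b + a)\<^sup>2 + b\<^sup>2 = t\<^sup>2 * b\<^sup>2 + \<bar>t\<bar> * (2 * (a * b)) + a\<^sup>2 + b\<^sup>2"
    by (simp add: power2_sum power_mult_distrib)
  also have "\<dots> \<le> t\<^sup>2 * (a\<^sup>2 + b\<^sup>2) + \<bar>t\<bar> * (2 * (a\<^sup>2 + b\<^sup>2)) + a\<^sup>2 + b\<^sup>2"
    by (intro add_mono mult_left_mono ab) auto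
  also have "\<dots> = (1 + \<bar>t\<bar>)\<^sup>2 * (a\<^sup>2 + b\<^sup>2)" by (simp add: power2_sum algebra_simps)
  finally have e: "(L2_norm (dv (phase_mult t f)))\<^sup>2 + b\<^sup>2 \<le> (1 + \<bar>t\<bar>)\<^sup>2 * (a\<^sup>2 + b\<^sup>2)" using d by linarith
  have "1 * (L2_norm (ev f))\<^sup>2 \<le> (1 + \<bar>t\<bar>)\<^sup>2 * (L2_norm (ev f))\<^sup>2" by (intro mult_right_mono) auto
  then have "(norm (phase_mult t f))\<^sup>2 \<le> ((1 + \<bar>t\<bar>) * norm f)\<^sup>2"
    using e unfolding power_mult_distrib norm_h11_power2 L2_norm_ev_phase_mult L2_norm_mx_phase_mult a_def[symmetric] b_def[symmetric]
    by (simp add: algebra_simps)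
  then show ?thesis by (rule power2_le_imp_le) simp
qed

lemma phase_mult_linear: "bounded_linear (phase_mult t)"
  by (rule bounded_linear_intro[where K="1 + \<bar>t\<bar>"]) 
    (auto intro!: h11_eqI simp: ev_phase_mult ev_add ev_scaleR algebra_simps intro: order_trans[OF norm_phase_mult])

lemma phase_mult_phase_mult: "phase_mult s (phase_mult t f) = phase_mult (s + t) f"
  by (rule h11_eqI) (simp add: ev_phase_mult phase_add mult.assoc[symmetric])

lemma phase_mult_0: "phase_mult 0 f = f"
  by (rule h11_eqI) (simp add: ev_phase_mult)

lemma phase_mult_tendsto: assumes T: "T \<longlonglongrightarrow> t" shows "(\<lambda>n. phase_mult (T n) f) \<longlonglongrightarrow> phase_mult t f"
proof -
  obtain K where K: "\<And>n. \<bar>T n\<bar> \<le> K" using convergent_imp_Bseq[of T] T by (auto simp: convergent_def Bseq_def)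
  have gen: "(\<lambda>n. L2_norm (\<lambda>x. (phase (T n) x - phase t x) * h x)) \<longlonglongrightarrow> 0" if h: "h \<in> L2" for h
  proof (rule L2_norm_dominated_tendsto_0[OF h, where C=2])
    note [measurable] = L2_measurable[OF h]
    show "(\<lambda>x. (phase (T n) x - phase t x) * h x) \<in> borel_measurable borel" for n by measurable
    show "AE x in lborel. cmod ((phase (T n) x - phase t x) * h x) \<le> 2 * cmod (h x)" for n
    proof (rule AE_I2)
      fix x
      have "cmod (phase (T n) x - phase t x) \<le> 2" using norm_triangle_ineq4[of "phase (T n) x" "phase t x"] by simp
      then show "cmod ((phase (T n) x - phase t x) * h x) \<le> 2 * cmod (h x)"
        unfolding norm_mult by (rule mult_right_mono) simp
    qed
    have "(\<lambda>n. (phase (T n) x - phase t x) * h x) \<longlonglongrightarrow> (phase t x - phase t x) * h x" for x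
      by (intro tendsto_intros phase_tendsto T)
    then show "AE x in lborel. (\<lambda>n. (phase (T n) x - phase t x) * h x) \<longlonglongrightarrow> 0" by simp
  qed
  have 0: "(\<lambda>n. L2_norm (ev (phase_mult (T n) f - phase_mult t f))) \<longlonglongrightarrow> 0"
    using gen[OF ev_L2[of f]] by (simp add: ev_diff ev_phase_mult left_diff_distrib)
  have 2: "(\<lambda>n. L2_norm (mx (phase_mult (T n) f - phase_mult t f))) \<longlonglongrightarrow> 0"
    using gen[OF mx_L2[of f]] by (simp add: mx_diff mx_phase_mult left_diff_distrib)
  have 1: "(\<lambda>n. L2_norm (dv (phase_mult (T n) f - phase_mult t f))) \<longlonglongrightarrow> 0"
  proof (rule Lim_null_comparison)
    \<comment> \<open>With the derivative frozen at the limit time \<open>t\<close>, the remaining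
      error is \<open>(T n - t)\<close> times a function of modulus \<open>|mx f|\<close>.\<close>
    define G where "G x = dv f x - \<i> * of_real t * mx f x" for x
    have G: "G \<in> L2" unfolding G_def[abs_def] by (intro L2_diff L2_cmult dv_L2 mx_L2)
    show "(\<lambda>n. L2_norm (\<lambda>x. (phase (T n) x - phase t x) * G x) + \<bar>T n - t\<bar> * L2_norm (mx f)) \<longlonglongrightarrow> 0"
      by (rule tendsto_eq_intros gen G T refl)+ simp
    have "L2_norm (dv (phase_mult (T n) f - phase_mult t f)) \<le> L2_norm (\<lambda>x. (phase (T n) x - phase t x) * G x) + \<bar>T n - t\<bar> * L2_norm (mx f)" for n
    proof -
      note [measurable] = L2_measurable[OF G]
      define k where "k = - \<i> * of_real (T n - t)"
      have L1: "(\<lambda>x. (phase (T n) x - phase t x) * G x) \<in> L2"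
      proof (rule L2_mult_bounded[OF G, where C=2])
        show "cmod (phase (T n) x - phase t x) \<le> 2" for x using norm_triangle_ineq4[of "phase (T n) x" "phase t x"] by simp
      qed measurable
      have L2: "(\<lambda>x. phase (T n) x * mx f x) \<in> L2"
        by (rule L2_mult_bounded[OF mx_L2, where C=1]) auto
      have "L2_norm (dv (phase_mult (T n) f - phase_mult t f)) = L2_norm (\<lambda>x. (phase (T n) x - phase t x) * G x + k * (phase (T n) x * mx f x))"
      proof (rule L2_norm_cong_AE)
        show "AE x in lborel. dv (phase_mult (T n) f - phase_mult t f) x = (phase (T n) x - phase t x) * G x + k * (phase (T n) x * mx f x)"
          using dv_diff[of "phase_mult (T n) f" "phase_mult t f"] dv_phase_mult[of "T n" f] dv_phase_mult[of t f]
          by eventually_elim (simp add: G_def k_def algebra_simps)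
      qed measurable
      also have "\<dots> \<le> L2_norm (\<lambda>x. (phase (T n) x - phase t x) * G x) + L2_norm (\<lambda>x. k * (phase (T n) x * mx f x))"
        by (rule L2_norm_triangle[OF L1 L2_cmult[OF L2]])
      also have "L2_norm (\<lambda>x. k * (phase (T n) x * mx f x)) = \<bar>T n - t\<bar> * L2_norm (mx f)"
        unfolding L2_norm_cmult by (simp add: k_def norm_mult L2_norm_def del: of_real_diff)
      finally show ?thesis .
    qed
    then show "\<forall>\<^sub>F n in sequentially. norm (L2_norm (dv (phase_mult (T n) f - phase_mult t f))) \<le> L2_norm (\<lambda>x. (phase (T n) x - phase t x) * G x) + \<bar>T n - t\<bar> * L2_norm (mx f)"
      by simp
  qed
  have "(\<lambda>n. norm (phase_mult (T n) f - phase_mult t f)) \<longlonglongrightarrow> 0"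
  proof (rule Lim_null_comparison)
    show "(\<lambda>n. L2_norm (ev (phase_mult (T n) f - phase_mult t f)) + L2_norm (dv (phase_mult (T n) f - phase_mult t f)) + L2_norm (mx (phase_mult (T n) f - phase_mult t f))) \<longlonglongrightarrow> 0"
      using tendsto_add[OF tendsto_add[OF 0 1] 2] by simp
    show "\<forall>\<^sub>F n in sequentially. norm (norm (phase_mult (T n) f - phase_mult t f)) \<le> L2_norm (ev (phase_mult (T n) f - phase_mult t f)) + L2_norm (dv (phase_mult (T n) f - phase_mult t f)) + L2_norm (mx (phase_mult (T n) f - phase_mult t f))"
      using norm_h11_le by simp
  qed
  then show ?thesis by (simp add: LIM_zero_iff tendsto_norm_zero_iff)
qed

text \<open>The reflection after the second transform makes it the inverse Fourier
  transform.\<close>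

definition U :: "real \<Rightarrow> h11 \<Rightarrow> h11" where "U t f = h11_refl (h11_fourier (phase_mult t (h11_fourier f)))"

lemma schroedinger_group_U:
  assumes f: "f \<in> borel_measurable borel" and eq: "AE x in lborel. f x = ev F x"
  shows "schroedinger_group t f = ev (U t F)"
proof
  fix x
  have "fourier f = ev (h11_fourier F)"
    unfolding ev_h11_fourier using fourier_cong_AE[OF f ev_measurable eq] by blast
  then have "schroedinger_group t f x = of_real (1 / sqrt (2 * pi)) * (LINT \<xi>|lborel. exp (\<i> * of_real (x * \<xi>)) * ev (phase_mult t (h11_fourier F)) \<xi>)"
    by (simp only: schroedinger_group_def ev_phase_mult phase_def)
  also have "\<dots> = fourier (ev (phase_mult t (h11_fourier F))) (- x)"
    by (simp add: fourier_def mult.commute)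
  finally show "schroedinger_group t f x = ev (U t F) x"
    by (simp only: U_def ev_refl ev_h11_fourier)
qed

lemma h11_fourier_refl_h11_fourier: "h11_fourier (h11_refl (h11_fourier f)) = f"
  by (metis h11_fourier_h11_fourier refl_h11_fourier refl_refl)

lemma U_U: "U s (U t f) = U (s + t) f"
  by (simp add: U_def h11_fourier_refl_h11_fourier phase_mult_phase_mult)

lemma U_0: "U 0 f = f"
  by (simp add: U_def phase_mult_0 h11_fourier_h11_fourier refl_refl)

lemma U_inv [simp]: "U (- t) (U t f) = f" "U t (U (- t) f) = f"
  by (simp_all add: U_U U_0)

lemma U_linear: "bounded_linear (U t)"
  unfolding U_def[abs_def]
  by (intro bounded_linear_compose[OF refl_linear] bounded_linear_compose[OF h11_fourier_linear] bounded_linear_compose[OF phase_mult_linear] h11_fourier_linear)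

lemma norm_U: "norm (U t f) \<le> (1 + \<bar>t\<bar>) * norm f"
  using norm_phase_mult[of t "h11_fourier f"] by (simp add: U_def norm_refl norm_h11_fourier)

lemma L2_norm_ev_U: "L2_norm (ev (U t f)) = L2_norm (ev f)"
  by (simp add: U_def L2_norm_ev_refl L2_norm_ev_h11_fourier L2_norm_ev_phase_mult)

lemma L2_norm_dv_U: "L2_norm (dv (U t f)) = L2_norm (dv f)"
  using mixed_norm_refl[of 0 1 "h11_fourier (phase_mult t (h11_fourier f))"] 
  by (simp add: U_def mixed_norm_special L2_norm_dv_h11_fourier L2_norm_mx_phase_mult L2_norm_mx_h11_fourier)

text \<open>On the Fourier side, differentiating \<open>phase_mult (- t)\<close> yields the
  coefficients \<open>(\<i> t, 1)\<close>. Moved back by \<open>mixed_norm_h11_fourier\<close> they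
  become \<open>(- \<i>, t)\<close>, which is \<open>- \<i>\<close> times
  \<open>(1, \<i> t)\<close>, the coefficients of \<open>J(t)\<close>.\<close>

lemma L2_norm_mx_U: "L2_norm (mx (U (- t) f)) = mixed_norm 1 (\<i> * of_real t) f"
proof -
  have "L2_norm (mx (U (- t) f)) = L2_norm (dv (phase_mult (- t) (h11_fourier f)))"
    using mixed_norm_refl[of 1 0 "h11_fourier (phase_mult (- t) (h11_fourier f))"] 
    by (simp add: U_def mixed_norm_special L2_norm_mx_h11_fourier)
  also have "\<dots> = mixed_norm (of_real t * \<i>) (- \<i> * \<i>) (h11_fourier f)" by (simp add: L2_norm_dv_phase_mult mult.commute)
  also have "\<dots> = mixed_norm (- \<i>) (of_real t) f" by (rule mixed_norm_h11_fourier)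
  also have "\<dots> = cmod (- \<i>) * mixed_norm 1 (\<i> * of_real t) f"
    unfolding mixed_norm_def L2_norm_cmult[symmetric] by (simp add: algebra_simps)
  finally show ?thesis by simp
qed

text \<open>Strong continuity at a fixed element and the locally uniform bound \<open>norm_U\<close>
  combine to joint continuity in time and argument.\<close>

lemma U_tendsto:
  assumes T: "(\<tau> \<longlongrightarrow> t) F" and w: "(w \<longlongrightarrow> f) F"
  shows "((\<lambda>s. U (\<tau> s) (w s)) \<longlongrightarrow> U t f) F"
proof -
  have "isCont (\<lambda>t. phase_mult t (h11_fourier f)) t"
    unfolding continuous_at_sequentially o_def using phase_mult_tendsto by blast
  then have "((\<lambda>s. phase_mult (\<tau> s) (h11_fourier f)) \<longlongrightarrow> phase_mult t (h11_fourier f)) F" using T by (rule isCont_tendsto_compose)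
  then have 1: "((\<lambda>s. U (\<tau> s) f) \<longlongrightarrow> U t f) F"
    unfolding U_def by (intro bounded_linear.tendsto[OF refl_linear] bounded_linear.tendsto[OF h11_fourier_linear])
  have 2: "((\<lambda>s. U (\<tau> s) (w s - f)) \<longlongrightarrow> 0) F"
  proof (rule Lim_null_comparison)
    show "\<forall>\<^sub>F s in F. norm (U (\<tau> s) (w s - f)) \<le> (1 + \<bar>\<tau> s\<bar>) * norm (w s - f)" using norm_U by simp
    have "((\<lambda>s. (1 + \<bar>\<tau> s\<bar>) * norm (w s - f)) \<longlongrightarrow> (1 + \<bar>t\<bar>) * norm (f - f)) F" by (intro tendsto_intros T w)
    then show "((\<lambda>s. (1 + \<bar>\<tau> s\<bar>) * norm (w s - f)) \<longlongrightarrow> 0) F" by simp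
  qed
  have "U (\<tau> s) (w s - f) + U (\<tau> s) f = U (\<tau> s) (w s)" for s
    by (simp add: linear_simps[OF U_linear])
  with tendsto_add[OF 2 1] show ?thesis by simp
qed

lemma U_continuous_on:
  assumes "continuous_on S \<tau>" "continuous_on S w" shows "continuous_on S (\<lambda>s. U (\<tau> s) (w s))"
  using assms unfolding continuous_on_def by (auto intro: U_tendsto)

lemma U_scale: "U t (h11_scale c f) = h11_scale c (U t f)"
proof -
  have "phase_mult t (h11_scale c g) = h11_scale c (phase_mult t g)" for g
    by (rule h11_eqI) (simp add: ev_phase_mult ev_scale)
  moreover have "h11_refl (h11_scale c g) = h11_scale c (h11_refl g)" for g
    by (rule h11_eqI) (simp add: ev_refl ev_scale)
  ultimately show ?thesis by (simp add: U_def h11_fourier_scale)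
qed

section \<open>Invariance of the bilinear forms and the weak generator\<close>

lemma polarise:
  fixes B B' :: "h11 \<Rightarrow> h11 \<Rightarrow> real"
  assumes B: "bounded_bilinear B" "\<And>f g. B f g = B g f" and B': "bounded_bilinear B'" "\<And>f g. B' f g = B' g f"
    and eq: "\<And>f. B f f = B' f f"
  shows "B f g = B' f g"
proof -
  have "B (f + g) (f + g) = B f f + 2 * B f g + B g g" "B' (f + g) (f + g) = B' f f + 2 * B' f g + B' g g"
    using B(2)[of g f] B'(2)[of g f]
    by (simp_all add: bounded_bilinear.add_left[OF B(1)] bounded_bilinear.add_right[OF B(1)] bounded_bilinear.add_left[OF B'(1)] bounded_bilinear.add_right[OF B'(1)])
  then show ?thesis using eq by simp
qed

lemma E0_h11_fourier: "E0 (h11_fourier f) (h11_fourier g) = E0 f g"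
  by (rule polarise[where B="\<lambda>f g. E0 (h11_fourier f) (h11_fourier g)"])
    (auto intro: bounded_bilinear.comp[OF E0_bilinear h11_fourier_linear h11_fourier_linear] E0_bilinear simp: E_self L2_norm_ev_h11_fourier E_commute)

lemma E2_h11_fourier: "E2 (h11_fourier f) (h11_fourier g) = E1 f g"
  by (rule polarise[where B="\<lambda>f g. E2 (h11_fourier f) (h11_fourier g)"])
    (auto intro: bounded_bilinear.comp[OF E2_bilinear h11_fourier_linear h11_fourier_linear] E1_bilinear simp: E_self L2_norm_mx_h11_fourier E_commute)

lemma E0_U: "E0 (U t f) (U t g) = E0 f g"
  by (rule polarise[where B="\<lambda>f g. E0 (U t f) (U t g)"])
    (auto intro: bounded_bilinear.comp[OF E0_bilinear U_linear U_linear] E0_bilinear simp: E_self L2_norm_ev_U E_commute)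

lemma E1_U: "E1 (U t f) (U t g) = E1 f g"
  by (rule polarise[where B="\<lambda>f g. E1 (U t f) (U t g)"])
    (auto intro: bounded_bilinear.comp[OF E1_bilinear U_linear U_linear] E1_bilinear simp: E_self L2_norm_dv_U E_commute)

text \<open>\<open>J(t) = x + i t \<partial>\<^sub>x = U(t) x U(-t)\<close>.\<close>

definition Jop :: "real \<Rightarrow> h11 \<Rightarrow> real \<Rightarrow> complex" where
  "Jop t f x = mx f x + \<i> * of_real t * dv f x"

lemma Jop_L2: "Jop t f \<in> L2"
  unfolding Jop_def[abs_def] by (intro L2_add L2_cmult mx_L2 dv_L2)

lemmas Jop_measurable[measurable] = Jop_L2[THEN L2_measurable]

lemma L2_norm_Jop: "L2_norm (Jop t f) = L2_norm (mx (U (- t) f))"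
  by (simp add: L2_norm_mx_U mixed_norm_def Jop_def[abs_def])

lemma E2_U: "E2 (U (- t) f) (U (- t) g) = ip (Jop t f) (Jop t g)"
proof -
  have sq: "ip (Jop t f) (Jop t f) = E2 (U (- t) f) (U (- t) f)" for f
    by (simp add: ip_self E_self L2_norm_Jop)
  have add: "ip (Jop t (f + g)) (Jop t (f + g)) = ip (Jop t f) (Jop t f) + 2 * ip (Jop t f) (Jop t g) + ip (Jop t g) (Jop t g)"
  proof -
    have ae: "AE x in lborel. Jop t (f + g) x = Jop t f x + Jop t g x"
      using dv_add[of f g] by eventually_elim (simp add: Jop_def mx_add algebra_simps)
    have "ip (Jop t (f + g)) (Jop t (f + g)) = ip (\<lambda>x. Jop t f x + Jop t g x) (\<lambda>x. Jop t f x + Jop t g x)"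
      by (rule ip_cong_AE) (use ae in auto)
    then show ?thesis
      using ip_commute[of "Jop t g" "Jop t f"] by (simp add: ip_add_left ip_add_right L2_add Jop_L2)
  qed
  have "E2 (U (- t) (f + g)) (U (- t) (f + g)) = E2 (U (- t) f) (U (- t) f) + 2 * E2 (U (- t) f) (U (- t) g) + E2 (U (- t) g) (U (- t) g)"
    using E_commute(3)[of "U (- t) g" "U (- t) f"]
    by (simp add: linear_simps[OF U_linear] bounded_bilinear.add_left[OF E2_bilinear] bounded_bilinear.add_right[OF E2_bilinear])
  then show ?thesis using add unfolding sq by simp
qed

lemma E0_U_diff: "E0 \<psi> (U h a - a) = (LINT \<xi>|lborel. inner (ev (h11_fourier \<psi>) \<xi>) ((phase h \<xi> - 1) * ev (h11_fourier a) \<xi>))"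
proof -
  have "E0 \<psi> (U h a - a) = E0 (h11_fourier \<psi>) (h11_fourier (U h a - a))" by (simp add: E0_h11_fourier)
  also have "h11_fourier (U h a - a) = phase_mult h (h11_fourier a) - h11_fourier a" 
    by (simp add: linear_simps[OF h11_fourier_linear] U_def h11_fourier_refl_h11_fourier)
  finally show ?thesis by (simp add: E0_def ip_def ev_diff ev_phase_mult left_diff_distrib)
qed

text \<open>The factor \<open>\<xi>\<^sup>2\<close> from the phase is split evenly between the two
  arguments, so one derivative of each is enough although the generator has order two.\<close>

lemma E0_U_diff_integrand_bound:
  "\<bar>inner (ev (h11_fourier \<psi>) \<xi>) ((phase h \<xi> - 1) * ev (h11_fourier a) \<xi>)\<bar> \<le> \<bar>h\<bar> / 2 * (cmod (mx (h11_fourier \<psi>) \<xi>) * cmod (mx (h11_fourier a) \<xi>))"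
proof -
  have "\<bar>inner (ev (h11_fourier \<psi>) \<xi>) ((phase h \<xi> - 1) * ev (h11_fourier a) \<xi>)\<bar> \<le> cmod (ev (h11_fourier \<psi>) \<xi>) * (cmod (phase h \<xi> - 1) * cmod (ev (h11_fourier a) \<xi>))"
    using Cauchy_Schwarz_ineq2[of "ev (h11_fourier \<psi>) \<xi>" "(phase h \<xi> - 1) * ev (h11_fourier a) \<xi>"] by (simp add: norm_mult)
  also have "\<dots> \<le> cmod (ev (h11_fourier \<psi>) \<xi>) * ((\<bar>h\<bar> * \<xi>\<^sup>2 / 2) * cmod (ev (h11_fourier a) \<xi>))"
    by (intro mult_left_mono mult_right_mono phase_minus_1) auto
  also have "\<dots> = \<bar>h\<bar> / 2 * (cmod (mx (h11_fourier \<psi>) \<xi>) * cmod (mx (h11_fourier a) \<xi>))"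
    by (simp add: mx_def norm_mult power2_eq_square abs_mult_self_eq)
  finally show ?thesis .
qed

lemma E0_U_diff_bound: "\<bar>E0 \<psi> (U h a - a)\<bar> \<le> \<bar>h\<bar> / 2 * (norm \<psi> * norm a)"
proof -
  have int: "integrable lborel (\<lambda>\<xi>. \<bar>h\<bar> / 2 * (cmod (mx (h11_fourier \<psi>) \<xi>) * cmod (mx (h11_fourier a) \<xi>)))"
    by (intro integrable_mult_right L2_mult_integrable mx_L2)
  have "\<bar>E0 \<psi> (U h a - a)\<bar> \<le> (LINT \<xi>|lborel. \<bar>inner (ev (h11_fourier \<psi>) \<xi>) ((phase h \<xi> - 1) * ev (h11_fourier a) \<xi>)\<bar>)"
    unfolding E0_U_diff by (rule integral_abs_bound)
  also have "\<dots> \<le> (LINT \<xi>|lborel. \<bar>h\<bar> / 2 * (cmod (mx (h11_fourier \<psi>) \<xi>) * cmod (mx (h11_fourier a) \<xi>)))"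
  proof (rule integral_mono)
    show "integrable lborel (\<lambda>\<xi>. \<bar>inner (ev (h11_fourier \<psi>) \<xi>) ((phase h \<xi> - 1) * ev (h11_fourier a) \<xi>)\<bar>)"
      using integrable_abs[OF ip_integrable[OF ev_L2 ev_L2, of "h11_fourier \<psi>" "phase_mult h (h11_fourier a) - h11_fourier a"]]
      by (simp add: ev_diff ev_phase_mult left_diff_distrib)
  qed (rule int E0_U_diff_integrand_bound)+
  also have "\<dots> \<le> \<bar>h\<bar> / 2 * (L2_norm (mx (h11_fourier \<psi>)) * L2_norm (mx (h11_fourier a)))"
    using L2_Cauchy_Schwarz[OF mx_L2 mx_L2, of "h11_fourier \<psi>" "h11_fourier a"] by (simp add: mult_left_mono divide_right_mono)
  also have "\<dots> \<le> \<bar>h\<bar> / 2 * (norm \<psi> * norm a)"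
    unfolding L2_norm_mx_h11_fourier by (intro mult_left_mono mult_mono L2_norm_dv_le) auto
  finally show ?thesis .
qed

text \<open>The group is not differentiable on the whole space; this weak form of its generator
  \<open>(i/2) \<partial>\<^sub>x\<^sup>2\<close> is all that the energy identities need.\<close>

lemma E0_U_difference_quotient:
  "((\<lambda>h. E0 \<psi> (U h a - a) / h) \<longlongrightarrow> - E1 \<psi> (h11_scale \<i> a) / 2) (at 0)"
proof -
  have val: "- E1 \<psi> (h11_scale \<i> a) / 2 = (LINT \<xi>|lborel. inner (ev (h11_fourier \<psi>) \<xi>) ((- \<i> * of_real (\<xi>\<^sup>2 / 2)) * ev (h11_fourier a) \<xi>))"
  proof -
    have "- E1 \<psi> (h11_scale \<i> a) / 2 = - (1 / 2) * E2 (h11_fourier \<psi>) (h11_scale \<i> (h11_fourier a))" by (simp add: E2_h11_fourier[symmetric] h11_fourier_scale)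
    also have "\<dots> = (LINT \<xi>|lborel. - (1 / 2) * inner (mx (h11_fourier \<psi>) \<xi>) (\<i> * mx (h11_fourier a) \<xi>))"
      by (simp add: E2_def ip_def mx_scale)
    also have "\<dots> = (LINT \<xi>|lborel. inner (ev (h11_fourier \<psi>) \<xi>) ((- \<i> * of_real (\<xi>\<^sup>2 / 2)) * ev (h11_fourier a) \<xi>))"
      by (intro Bochner_Integration.integral_cong refl) (simp add: mx_def inner_complex_def power2_eq_square algebra_simps)
    finally show ?thesis .
  qed
  show ?thesis
    unfolding val tendsto_at_iff_sequentially o_def
  proof (intro allI impI)
    fix H :: "nat \<Rightarrow> real" assume H: "\<forall>n. H n \<in> UNIV - {0}" "H \<longlonglongrightarrow> 0"
    have "(\<lambda>n. LINT \<xi>|lborel. inner (ev (h11_fourier \<psi>) \<xi>) ((phase (H n) \<xi> - 1) * ev (h11_fourier a) \<xi>) / H n)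
      \<longlonglongrightarrow> (LINT \<xi>|lborel. inner (ev (h11_fourier \<psi>) \<xi>) ((- \<i> * of_real (\<xi>\<^sup>2 / 2)) * ev (h11_fourier a) \<xi>))"
    proof (rule integral_dominated_convergence[where w="\<lambda>\<xi>. cmod (mx (h11_fourier \<psi>) \<xi>) * cmod (mx (h11_fourier a) \<xi>)"])
      show "integrable lborel (\<lambda>\<xi>. cmod (mx (h11_fourier \<psi>) \<xi>) * cmod (mx (h11_fourier a) \<xi>))" by (intro L2_mult_integrable mx_L2)
      show "AE \<xi> in lborel. norm (inner (ev (h11_fourier \<psi>) \<xi>) ((phase (H n) \<xi> - 1) * ev (h11_fourier a) \<xi>) / H n) \<le> cmod (mx (h11_fourier \<psi>) \<xi>) * cmod (mx (h11_fourier a) \<xi>)" for n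
      proof (rule AE_I2)
        fix \<xi>
        have "H n \<noteq> 0" using H(1) by simp
        have "norm (inner (ev (h11_fourier \<psi>) \<xi>) ((phase (H n) \<xi> - 1) * ev (h11_fourier a) \<xi>) / H n)
          = \<bar>inner (ev (h11_fourier \<psi>) \<xi>) ((phase (H n) \<xi> - 1) * ev (h11_fourier a) \<xi>)\<bar> / \<bar>H n\<bar>"
          by (simp only: real_norm_def abs_divide)
        also have "\<dots> \<le> (\<bar>H n\<bar> / 2 * (cmod (mx (h11_fourier \<psi>) \<xi>) * cmod (mx (h11_fourier a) \<xi>))) / \<bar>H n\<bar>"
          by (intro divide_right_mono E0_U_diff_integrand_bound) simp
        also have "\<dots> = 1 / 2 * (cmod (mx (h11_fourier \<psi>) \<xi>) * cmod (mx (h11_fourier a) \<xi>))"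
          using \<open>H n \<noteq> 0\<close> by simp
        also have "\<dots> \<le> cmod (mx (h11_fourier \<psi>) \<xi>) * cmod (mx (h11_fourier a) \<xi>)" by simp
        finally show "norm (inner (ev (h11_fourier \<psi>) \<xi>) ((phase (H n) \<xi> - 1) * ev (h11_fourier a) \<xi>) / H n) \<le> cmod (mx (h11_fourier \<psi>) \<xi>) * cmod (mx (h11_fourier a) \<xi>)" .
      qed
      show "AE \<xi> in lborel. (\<lambda>n. inner (ev (h11_fourier \<psi>) \<xi>) ((phase (H n) \<xi> - 1) * ev (h11_fourier a) \<xi>) / H n)
         \<longlonglongrightarrow> inner (ev (h11_fourier \<psi>) \<xi>) ((- \<i> * of_real (\<xi>\<^sup>2 / 2)) * ev (h11_fourier a) \<xi>)"
      proof (rule AE_I2)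
        fix \<xi>
        have "((\<lambda>z. exp (- \<i> * (z * (of_real \<xi>)\<^sup>2 / 2))) has_field_derivative (- \<i> * ((of_real \<xi>)\<^sup>2 / 2))) (at (of_real 0))"
          by (auto intro!: derivative_eq_intros)
        then have D: "((\<lambda>z. (exp (- \<i> * (z * (of_real \<xi>)\<^sup>2 / 2)) - 1) / z) \<longlongrightarrow> - \<i> * ((of_real \<xi>)\<^sup>2 / 2)) (at 0)"
          by (simp add: has_field_derivative_iff)
        have "(\<lambda>n. complex_of_real (H n)) \<longlonglongrightarrow> of_real 0" by (intro tendsto_intros H)
        then have "filterlim (\<lambda>n. complex_of_real (H n)) (at 0) sequentially"
          using H(1) by (simp add: filterlim_at)
        from filterlim_compose[OF D this]
        have "(\<lambda>n. (phase (H n) \<xi> - 1) / of_real (H n)) \<longlonglongrightarrow> - \<i> * of_real (\<xi>\<^sup>2 / 2)"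
          by (simp add: phase_def)
        moreover have "(phase (H n) \<xi> - 1) / of_real (H n) = (phase (H n) \<xi> - 1) /\<^sub>R H n" for n
          by (simp add: scaleR_conv_of_real divide_inverse mult.commute)
        ultimately have q: "(\<lambda>n. (phase (H n) \<xi> - 1) /\<^sub>R H n) \<longlonglongrightarrow> - \<i> * of_real (\<xi>\<^sup>2 / 2)"
          by simp
        have "(\<lambda>n. inner (ev (h11_fourier \<psi>) \<xi>) (((phase (H n) \<xi> - 1) /\<^sub>R H n) * ev (h11_fourier a) \<xi>))
           \<longlonglongrightarrow> inner (ev (h11_fourier \<psi>) \<xi>) ((- \<i> * of_real (\<xi>\<^sup>2 / 2)) * ev (h11_fourier a) \<xi>)"
          by (intro tendsto_intros q)
        moreover have "inner A ((z /\<^sub>R h) * B) = inner A (z * B) / h" for A z B :: complex and h :: real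
          by (simp only: mult_scaleR_left inner_scaleR_right divide_inverse_commute)
        ultimately show "(\<lambda>n. inner (ev (h11_fourier \<psi>) \<xi>) ((phase (H n) \<xi> - 1) * ev (h11_fourier a) \<xi>) / H n)
         \<longlonglongrightarrow> inner (ev (h11_fourier \<psi>) \<xi>) ((- \<i> * of_real (\<xi>\<^sup>2 / 2)) * ev (h11_fourier a) \<xi>)"
          by (simp only:)
      qed
    qed measurable
    then show "(\<lambda>n. E0 \<psi> (U (H n) a - a) / H n) \<longlonglongrightarrow> (LINT \<xi>|lborel. inner (ev (h11_fourier \<psi>) \<xi>) ((- \<i> * of_real (\<xi>\<^sup>2 / 2)) * ev (h11_fourier a) \<xi>))"
      by (simp add: E0_U_diff)
  qed
qed

section \<open>Ordinary differential equations in Banach spaces\<close>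

lemma exp_primitive_integral:
  fixes K :: "real \<Rightarrow> real"
  assumes K: "continuous_on {0..} K" and t: "0 \<le> t"
  defines "\<phi> \<equiv> \<lambda>t. 2 * integral {0..t} K"
  shows "((\<lambda>s. K s * exp (\<phi> s)) has_integral (exp (\<phi> t) - 1) / 2) {0..t}"
proof -
  have c: "continuous_on {0..t} K" by (rule continuous_on_subset[OF K]) auto
  have "((\<lambda>s. K s * exp (\<phi> s)) has_integral exp (\<phi> t) / 2 - exp (\<phi> 0) / 2) {0..t}"
  proof (rule fundamental_theorem_of_calculus[OF t])
    fix x assume x: "x \<in> {0..t}"
    have "(\<phi> has_real_derivative 2 * K x) (at x within {0..t})"
      unfolding \<phi>_def by (intro DERIV_cmult integral_has_real_derivative c x)
    then have "((\<lambda>s. exp (\<phi> s) / 2) has_real_derivative K x * exp (\<phi> x)) (at x within {0..t})"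
      by (auto intro!: derivative_eq_intros)
    then show "((\<lambda>s. exp (\<phi> s) / 2) has_vector_derivative K x * exp (\<phi> x)) (at x within {0..t})"
      by (simp add: has_real_derivative_iff_has_vector_derivative)
  qed
  then show ?thesis by (simp add: \<phi>_def diff_divide_distrib)
qed

lemma primitive_continuous_on_halfline:
  fixes f :: "real \<Rightarrow> 'a::banach"
  assumes f: "continuous_on {0..} f" shows "continuous_on {0..} (\<lambda>t. integral {0..t} f)"
proof -
  have "continuous_on {0..<b} (\<lambda>t. integral {0..t} f)" for b
  proof -
    have "continuous_on {0..b} (\<lambda>t. integral {0..t} f)"
      by (intro indefinite_integral_continuous_1 integrable_continuous_real continuous_on_subset[OF f]) auto
    then show ?thesis by (rule continuous_on_subset) auto
  qed
  then show ?thesis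
    unfolding continuous_on_def
  proof (intro ballI)
    fix t :: real assume c: "\<And>b. \<forall>x\<in>{0..<b}. ((\<lambda>t. integral {0..t} f) \<longlongrightarrow> integral {0..x} f) (at x within {0..<b})" and t: "t \<in> {0..}"
    have "at t within {0..} = at t within {0..<t + 1}"
      by (rule at_within_nhd[of _ "{..<t + 1}"]) auto
    then show "((\<lambda>t. integral {0..t} f) \<longlongrightarrow> integral {0..t} f) (at t within {0..})"
      using c[of "t + 1"] t by auto
  qed
qed

text \<open>The weight \<open>exp (- 2 \<integral> K)\<close> turns the Picard map into a contraction on the whole half line.\<close>

lemma global_solution_Lipschitz:
  fixes G :: "real \<Rightarrow> 'a::banach \<Rightarrow> 'a"
  assumes cont: "\<And>w. continuous_on {0..} w \<Longrightarrow> continuous_on {0..} (\<lambda>s. G s (w s))"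
    and lip: "\<And>t x y. 0 \<le> t \<Longrightarrow> norm (G t x - G t y) \<le> K t * norm (x - y)"
    and K: "continuous_on {0..} K" and K0: "\<And>t. 0 \<le> t \<Longrightarrow> 0 \<le> K t"
    and G0: "\<And>t. 0 \<le> t \<Longrightarrow> G t 0 = 0"
  shows "\<exists>w. continuous_on {0..} w \<and> (\<forall>t\<ge>0. w t = w0 + integral {0..t} (\<lambda>s. G s (w s)))"
proof -
  define \<phi> where "\<phi> t = 2 * integral {0..t} K" for t
  have \<phi>c: "continuous_on {0..} \<phi>" unfolding \<phi>_def by (intro continuous_intros primitive_continuous_on_halfline K)
  have Kint: "K integrable_on {0..t}" for t
    by (intro integrable_continuous_real continuous_on_subset[OF K]) auto
  have \<phi>0: "0 \<le> \<phi> t" if "0 \<le> t" for t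
    unfolding \<phi>_def using Kint K0 by (intro mult_nonneg_nonneg Henstock_Kurzweil_Integration.integral_nonneg) auto
  \<comment> \<open>The unknown is the bounded function \<open>z = exp (- \<phi>) w\<close>; the
    supremum norm of \<open>bcontfun\<close> is then the weighted norm of \<open>w\<close>.\<close>
  define W where "W z s = exp (\<phi> s) *\<^sub>R apply_bcontfun z s" for z :: "real \<Rightarrow>\<^sub>C 'a" and s
  have Wc: "continuous_on {0..} (W z)" for z unfolding W_def by (intro continuous_intros \<phi>c continuous_on_apply_bcontfun)
  have GWc: "continuous_on {0..} (\<lambda>s. G s (W z s))" for z by (rule cont[OF Wc])
  have GWi: "(\<lambda>s. G s (W z s)) integrable_on {0..t}" for z t
    by (intro integrable_continuous_real continuous_on_subset[OF GWc]) auto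
  have est: "norm (integral {0..t} (\<lambda>s. G s (W z s)) - integral {0..t} (\<lambda>s. G s (W z' s))) \<le> exp (\<phi> t) / 2 * dist z z'"
    if t: "0 \<le> t" for z z' t
  proof -
    have hi: "((\<lambda>s. K s * exp (\<phi> s)) has_integral (exp (\<phi> t) - 1) / 2) {0..t}"
      unfolding \<phi>_def by (rule exp_primitive_integral[OF K t])
    have hi': "((\<lambda>s. K s * exp (\<phi> s) * dist z z') has_integral (exp (\<phi> t) - 1) / 2 * dist z z') {0..t}"
      by (rule has_integral_mult_left[OF hi])
    have "norm (integral {0..t} (\<lambda>s. G s (W z s) - G s (W z' s))) \<le> integral {0..t} (\<lambda>s. K s * exp (\<phi> s) * dist z z')"
    proof (rule integral_norm_bound_integral)
      show "(\<lambda>s. G s (W z s) - G s (W z' s)) integrable_on {0..t}" by (intro integrable_diff GWi)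
      show "(\<lambda>s. K s * exp (\<phi> s) * dist z z') integrable_on {0..t}" using hi' by blast
      fix s assume s: "s \<in> {0..t}"
      then have "norm (G s (W z s) - G s (W z' s)) \<le> K s * norm (W z s - W z' s)" by (intro lip) auto
      also have "norm (W z s - W z' s) = exp (\<phi> s) * dist (apply_bcontfun z s) (apply_bcontfun z' s)"
        by (simp add: W_def scaleR_diff_right[symmetric] dist_norm)
      also have "K s * \<dots> \<le> K s * (exp (\<phi> s) * dist z z')"
        using K0[of s] s by (intro mult_left_mono dist_bounded) auto
      finally show "norm (G s (W z s) - G s (W z' s)) \<le> K s * exp (\<phi> s) * dist z z'" by (simp add: mult.assoc)
    qed
    also have "\<dots> = (exp (\<phi> t) - 1) / 2 * dist z z'" using hi' by (rule integral_unique)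
    also have "\<dots> \<le> exp (\<phi> t) / 2 * dist z z'" by (intro mult_right_mono) auto
    finally show ?thesis by (simp add: Henstock_Kurzweil_Integration.integral_diff[OF GWi GWi])
  qed
  \<comment> \<open>Elements of \<open>bcontfun\<close> live on the whole line, so curves are
    extended to negative times by their value at 0.\<close>
  define p where "p t = max 0 t" for t :: real
  have p: "0 \<le> p t" for t by (simp add: p_def)
  have pc: "continuous_on UNIV p" unfolding p_def by (intro continuous_intros)
  define \<Psi> where "\<Psi> z t = exp (- \<phi> (p t)) *\<^sub>R (w0 + integral {0..p t} (\<lambda>s. G s (W z s)))" for z t
  have \<Psi>m: "\<Psi> z \<in> bcontfun" for z
  proof (rule bcontfun_normI)
    show "continuous_on UNIV (\<Psi> z)"
    proof -
      have 1: "continuous_on UNIV (\<lambda>t. \<phi> (p t))"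
        by (rule continuous_on_compose2[OF \<phi>c pc]) (use p in auto)
      have 2: "continuous_on UNIV (\<lambda>t. integral {0..p t} (\<lambda>s. G s (W z s)))"
        by (rule continuous_on_compose2[OF primitive_continuous_on_halfline[OF GWc] pc]) (use p in auto)
      show ?thesis unfolding \<Psi>_def by (intro continuous_intros 1 2)
    qed
    fix t
    have z: "integral {0..p t} (\<lambda>s. G s (W 0 s)) = 0"
    proof -
      have "integral {0..p t} (\<lambda>s. G s (W 0 s)) = integral {0..p t} (\<lambda>s. 0)"
        by (rule Henstock_Kurzweil_Integration.integral_cong) (simp add: W_def G0)
      then show ?thesis by simp
    qed
    have "norm (w0 + integral {0..p t} (\<lambda>s. G s (W z s))) \<le> norm w0 + exp (\<phi> (p t)) / 2 * dist z 0"
      using est[OF p, of t z 0] unfolding z by (intro norm_triangle_le) simp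
    also have "\<dots> \<le> exp (\<phi> (p t)) * (norm w0 + dist z 0)"
    proof -
      have "1 * norm w0 \<le> exp (\<phi> (p t)) * norm w0" using \<phi>0[OF p] by (intro mult_right_mono) auto
      moreover have "exp (\<phi> (p t)) / 2 * dist z 0 \<le> exp (\<phi> (p t)) * dist z 0" by (intro mult_right_mono) auto
      ultimately show ?thesis unfolding distrib_left by linarith
    qed
    finally have "exp (- \<phi> (p t)) * norm (w0 + integral {0..p t} (\<lambda>s. G s (W z s))) \<le> exp (- \<phi> (p t)) * (exp (\<phi> (p t)) * (norm w0 + dist z 0))"
      by (intro mult_left_mono) auto
    also have "\<dots> = norm w0 + dist z 0" by (simp add: exp_minus)
    finally show "norm (\<Psi> z t) \<le> norm w0 + dist z 0" by (simp add: \<Psi>_def)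
  qed
  define P where "P z = Bcontfun (\<Psi> z)" for z
  have P: "apply_bcontfun (P z) = \<Psi> z" for z unfolding P_def by (rule Bcontfun_inverse[OF \<Psi>m])
  have "\<exists>!z. P z = z"
  proof (rule banach_fix_type[of "1/2"])
    show "\<forall>x y. dist (P x) (P y) \<le> 1 / 2 * dist x y"
    proof (intro allI dist_bound)
      fix z z' t
      have "dist (\<Psi> z t) (\<Psi> z' t) = exp (- \<phi> (p t)) * norm (integral {0..p t} (\<lambda>s. G s (W z s)) - integral {0..p t} (\<lambda>s. G s (W z' s)))"
        by (simp add: \<Psi>_def dist_norm scaleR_diff_right[symmetric])
      also have "\<dots> \<le> exp (- \<phi> (p t)) * (exp (\<phi> (p t)) / 2 * dist z z')"
        by (intro mult_left_mono est p) auto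
      also have "\<dots> = 1 / 2 * dist z z'" by (simp add: exp_minus field_simps)
      finally show "dist (apply_bcontfun (P z) t) (apply_bcontfun (P z') t) \<le> 1 / 2 * dist z z'" by (simp add: P)
    qed
  qed auto
  then obtain z where z: "P z = z" by blast
  have "W z t = w0 + integral {0..t} (\<lambda>s. G s (W z s))" if "0 \<le> t" for t
  proof -
    have pt: "p t = t" using that by (simp add: p_def)
    have "W z t = exp (\<phi> t) *\<^sub>R \<Psi> z t" using arg_cong[OF z, of apply_bcontfun] by (simp add: W_def P)
    also have "\<dots> = w0 + integral {0..t} (\<lambda>s. G s (W z s))" by (simp add: \<Psi>_def pt exp_minus)
    finally show ?thesis .
  qed
  then show ?thesis using Wc by blast
qed

text \<open>Gronwall by a maximum argument. The difference, weighted by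
  \<open>exp (- 2 L s)\<close>, attains its maximum on the compact interval; inserting this maximum
  into the integral equation bounds it by half of itself.\<close>

lemma integral_equation_unique:
  fixes g1 g2 w1 w2 :: "real \<Rightarrow> 'a::banach"
  assumes w: "continuous_on {0..T} w1" "continuous_on {0..T} w2"
    and g: "continuous_on {0..T} g1" "continuous_on {0..T} g2"
    and eq: "\<And>t. t \<in> {0..T} \<Longrightarrow> w1 t = w0 + integral {0..t} g1" "\<And>t. t \<in> {0..T} \<Longrightarrow> w2 t = w0 + integral {0..t} g2"
    and lip: "\<And>t. t \<in> {0..T} \<Longrightarrow> norm (g1 t - g2 t) \<le> K * norm (w1 t - w2 t)"
    and t: "t \<in> {0..T}"
  shows "w1 t = w2 t"
proof -
  \<comment> \<open>The maximum with 1 makes the rate positive whatever the sign of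
    \<open>K\<close>.\<close>
  define L where "L = max K 1"
  have L: "L > 0" "K \<le> L" by (auto simp: L_def)
  define y where "y s = exp (- (2 * L * s)) * norm (w1 s - w2 s)" for s
  have "continuous_on {0..T} y" unfolding y_def by (intro continuous_intros w)
  moreover have "{0..T} \<noteq> {}" using t by auto
  ultimately obtain s0 where s0: "s0 \<in> {0..T}" "\<And>s. s \<in> {0..T} \<Longrightarrow> y s \<le> y s0"
    using continuous_attains_sup[of "{0..T}" y] by auto
  have ynn: "0 \<le> y s" for s by (simp add: y_def)
  have wy: "norm (w1 s - w2 s) = exp (2 * L * s) * y s" for s by (simp add: y_def exp_minus)
  have i: "g1 integrable_on {0..s}" "g2 integrable_on {0..s}" if "s \<in> {0..T}" for s
    using that by (auto intro!: integrable_continuous_real continuous_on_subset[OF g(1)] continuous_on_subset[OF g(2)])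
  have "w1 s0 - w2 s0 = integral {0..s0} (\<lambda>s. g1 s - g2 s)"
    using eq s0(1) by (simp add: Henstock_Kurzweil_Integration.integral_diff i)
  also have "norm \<dots> \<le> integral {0..s0} (\<lambda>s. L * exp (2 * L * s) * y s0)"
  proof (rule integral_norm_bound_integral)
    show "(\<lambda>s. g1 s - g2 s) integrable_on {0..s0}" by (intro integrable_diff i s0)
    show "(\<lambda>s. L * exp (2 * L * s) * y s0) integrable_on {0..s0}"
      by (intro integrable_continuous_real continuous_intros)
    fix s assume "s \<in> {0..s0}"
    then have s: "s \<in> {0..T}" using s0 by auto
    have "norm (g1 s - g2 s) \<le> K * norm (w1 s - w2 s)" by (rule lip[OF s])
    also have "\<dots> \<le> L * norm (w1 s - w2 s)" using L by (intro mult_right_mono) auto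
    also have "\<dots> \<le> L * (exp (2 * L * s) * y s0)" unfolding wy using L s0(2)[OF s] by (intro mult_left_mono) auto
    finally show "norm (g1 s - g2 s) \<le> L * exp (2 * L * s) * y s0" by (simp add: mult.assoc)
  qed
  also have "\<dots> = (exp (2 * L * s0) - 1) / 2 * y s0"
  proof (rule integral_unique)
    have "((\<lambda>s. L * exp (2 * L * s)) has_integral exp (2 * L * s0) / 2 - exp (2 * L * 0) / 2) {0..s0}"
    proof (rule fundamental_theorem_of_calculus)
      fix x assume "x \<in> {0..s0}"
      have "((\<lambda>s. exp (2 * L * s) / 2) has_real_derivative L * exp (2 * L * x)) (at x within {0..s0})"
        by (auto intro!: derivative_eq_intros)
      then show "((\<lambda>s. exp (2 * L * s) / 2) has_vector_derivative L * exp (2 * L * x)) (at x within {0..s0})"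
        by (simp add: has_real_derivative_iff_has_vector_derivative)
    qed (use s0 in auto)
    from has_integral_mult_left[OF this, of "y s0"]
    show "((\<lambda>s. L * exp (2 * L * s) * y s0) has_integral (exp (2 * L * s0) - 1) / 2 * y s0) {0..s0}"
      by (simp add: diff_divide_distrib)
  qed
  also have "\<dots> \<le> exp (2 * L * s0) / 2 * y s0" using ynn by (intro mult_right_mono) auto
  finally have "exp (2 * L * s0) * y s0 \<le> exp (2 * L * s0) * (y s0 / 2)" unfolding wy by simp
  then have "y s0 \<le> y s0 / 2" by simp
  then have "y s0 \<le> 0" by simp
  then have "y t \<le> 0" using s0(2)[OF t] by simp
  then show ?thesis by (simp add: y_def mult_le_0_iff)
qed

lemma integral_equation_has_vector_derivative:
  fixes g w :: "real \<Rightarrow> 'a::banach"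
  assumes g: "continuous_on {0..T} g" and eq: "\<And>t. t \<in> {0..T} \<Longrightarrow> w t = w0 + integral {0..t} g" and t: "t \<in> {0..T}"
  shows "(w has_vector_derivative g t) (at t within {0..T})"
proof -
  have "((\<lambda>t. w0 + integral {0..t} g) has_vector_derivative 0 + g t) (at t within {0..T})"
    by (intro has_vector_derivative_add has_vector_derivative_const integral_has_vector_derivative g t)
  then have "((\<lambda>t. w0 + integral {0..t} g) has_vector_derivative g t) (at t within {0..T})" by simp
  then show ?thesis
    by (rule has_vector_derivative_transform[OF t, rotated]) (use eq in auto)
qed

lemma nonpos_derivative_imp_le:
  fixes f :: "real \<Rightarrow> real"
  assumes "a \<le> b" and "\<And>x. x \<in> {a..b} \<Longrightarrow> (f has_real_derivative f' x) (at x within {a..b})"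
    and "\<And>x. x \<in> {a..b} \<Longrightarrow> f' x \<le> 0"
  shows "f b \<le> f a"
proof -
  have "(f' has_integral (f b - f a)) {a..b}"
    using assms by (intro fundamental_theorem_of_calculus) (auto simp: has_real_derivative_iff_has_vector_derivative)
  then have "f b - f a \<le> 0"
    by (rule has_integral_le[OF _ has_integral_0]) (use assms in auto)
  then show ?thesis by simp
qed

text \<open>For positive \<open>B\<close> this is the radial retraction onto the closed ball of
  radius \<open>B\<close>.\<close>

definition rball :: "real \<Rightarrow> 'a::real_normed_vector \<Rightarrow> 'a" where
  "rball B x = (if norm x \<le> B then x else (B / norm x) *\<^sub>R x)"

lemma norm_rball: "0 < B \<Longrightarrow> norm (rball B x) \<le> B"
  by (auto simp: rball_def)

lemma rball_eq: "norm x \<le> B \<Longrightarrow> rball B x = x"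
  by (simp add: rball_def)

lemma rball_alt: "0 < B \<Longrightarrow> rball B x = (B / max B (norm x)) *\<^sub>R x"
  by (auto simp: rball_def max_def)

text \<open>The difference splits into a change of the vector at a fixed scaling factor and a change
  of the factor alone. Each contributes at most \<open>norm (x - y)\<close>, the second because the
  norm is 1-Lipschitz.\<close>

lemma rball_lipschitz:
  assumes B: "0 < B" shows "norm (rball B x - rball B y) \<le> 2 * norm (x - y)"
proof -
  define m where "m v = max B (norm v)" for v :: 'a
  have m: "m v > 0" "norm v \<le> m v" "B \<le> m v" for v using B by (auto simp: m_def)
  have md: "\<bar>m y - m x\<bar> \<le> norm (x - y)"
    using norm_triangle_ineq3[of x y] by (auto simp: m_def max_def abs_if split: if_splits)
  have "rball B x - rball B y = (B / m y) *\<^sub>R (x - y) + (B / m x - B / m y) *\<^sub>R x"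
    using B by (simp add: rball_alt m_def algebra_simps)
  also have "norm \<dots> \<le> \<bar>B / m y\<bar> * norm (x - y) + \<bar>B / m x - B / m y\<bar> * norm x"
    by (rule norm_triangle_le) simp
  also have "\<bar>B / m y\<bar> * norm (x - y) \<le> 1 * norm (x - y)"
    using B m[of y] by (intro mult_right_mono) auto
  also have "\<bar>B / m x - B / m y\<bar> * norm x \<le> norm (x - y)"
  proof -
    have "B / m x - B / m y = B / m y * ((m y - m x) / m x)" using m(1)[of x] m(1)[of y] by (simp add: field_simps)
    then have "\<bar>B / m x - B / m y\<bar> * norm x = B / m y * (\<bar>m y - m x\<bar> * (norm x / m x))"
      using B m(1)[of x] m(1)[of y] by (simp add: abs_mult)
    also have "\<dots> \<le> 1 * (norm (x - y) * 1)"
      using B m[of y] m[of x] md by (intro mult_mono) auto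
    finally show ?thesis by simp
  qed
  finally show ?thesis by simp
qed

lemma rball_continuous_on:
  assumes B: "\<And>s. s \<in> S \<Longrightarrow> 0 < B s" and c: "continuous_on S B" "continuous_on S w"
  shows "continuous_on S (\<lambda>s. rball (B s) (w s))"
proof -
  have "continuous_on S (\<lambda>s. (B s / max (B s) (norm (w s))) *\<^sub>R w s)"
  proof (intro continuous_intros c ballI)
    show "max (B s) (norm (w s)) \<noteq> 0" if "s \<in> S" for s using B[OF that] by (auto simp: max_def)
  qed
  then show ?thesis by (rule continuous_on_eq) (use B rball_alt in metis)
qed

section \<open>Mass, energy and pseudoconformal identities\<close>

definition abs2 :: "h11 \<Rightarrow> h11" where "abs2 f = h11_mult f (h11_cnj f)"

text \<open>This is \<open>\<parallel>f\<parallel>\<^sub>4\<^sup>4\<close>, written as a quadratic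
  form in the density \<open>|f|\<^sup>2\<close>.\<close>

definition Q4 :: "h11 \<Rightarrow> real" where "Q4 f = E0 (abs2 f) (abs2 f)"

definition cubic :: "h11 \<Rightarrow> h11" where "cubic f = h11_mult (abs2 f) f"

lemma cmod_square_Re_Im: "(cmod z)\<^sup>2 = Re z * Re z + Im z * Im z"
  unfolding cmod_power2 by (simp add: power2_eq_square)

lemma inner_of_real_of_real: "inner (complex_of_real a) (of_real b) = a * b"
  by (simp add: inner_complex_def)

lemma ev_abs2: "ev (abs2 f) x = of_real ((cmod (ev f x))\<^sup>2)"
  by (simp add: abs2_def ev_mult ev_cnj flip: complex_norm_square)

lemma dv_abs2: "AE x in lborel. dv (abs2 f) x = of_real (2 * inner (ev f x) (dv f x))"
  using dv_mult[of f "h11_cnj f"] dv_cnj[of f] unfolding abs2_def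
  by eventually_elim (simp add: ev_cnj complex_eq_iff inner_complex_def)

lemma ev_cubic: "ev (cubic f) x = ev f x * of_real ((cmod (ev f x))\<^sup>2)"
  by (simp add: cubic_def ev_mult ev_abs2 mult.commute)

lemma dv_cubic: "AE x in lborel. dv (cubic f) x = of_real (2 * inner (ev f x) (dv f x)) * ev f x + of_real ((cmod (ev f x))\<^sup>2) * dv f x"
  using dv_mult[of "abs2 f" f] dv_abs2[of f] unfolding cubic_def
  by eventually_elim (simp add: ev_abs2)

lemma abs2_tendsto: "(f \<longlongrightarrow> l) F \<Longrightarrow> ((\<lambda>x. abs2 (f x)) \<longlongrightarrow> abs2 l) F"
  unfolding abs2_def
  by (intro bounded_bilinear.tendsto[OF h11_mult_bilinear] bounded_linear.tendsto[OF h11_cnj_linear])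

lemma cubic_tendsto: "(f \<longlongrightarrow> l) F \<Longrightarrow> ((\<lambda>x. cubic (f x)) \<longlongrightarrow> cubic l) F"
  unfolding cubic_def by (intro bounded_bilinear.tendsto[OF h11_mult_bilinear] abs2_tendsto)

lemma norm_abs2: "norm (abs2 f) \<le> 4 * (norm f)\<^sup>2"
  using norm_h11_mult[of f "h11_cnj f"] by (simp add: abs2_def norm_h11_cnj power2_eq_square)

lemma norm_mult3: 
  assumes "norm a \<le> A" "norm b \<le> B" "norm c \<le> C" shows "norm (h11_mult (h11_mult a b) c) \<le> 16 * (A * B * C)"
proof -
  have "norm (h11_mult (h11_mult a b) c) \<le> 4 * norm (h11_mult a b) * norm c" by (rule norm_h11_mult)
  also have "\<dots> \<le> 4 * (4 * norm a * norm b) * norm c" by (intro mult_left_mono mult_right_mono norm_h11_mult) auto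
  also have "\<dots> = 16 * (norm a * norm b * norm c)" by simp
  also have "\<dots> \<le> 16 * (A * B * C)"
  proof -
    have "0 \<le> A" "0 \<le> B" using assms norm_ge_zero order_trans by blast+
    then show ?thesis using assms by (intro mult_left_mono mult_mono) auto
  qed
  finally show ?thesis .
qed

text \<open>Replacing the three factors one at a time gives three terms, each a double product that
  costs \<open>4 * 4\<close>; hence 48.\<close>

lemma cubic_lipschitz:
  assumes "norm u \<le> B" "norm v \<le> B" shows "norm (cubic u - cubic v) \<le> 48 * B\<^sup>2 * norm (u - v)"
proof -
  have "cubic u - cubic v = h11_mult (h11_mult (u - v) (h11_cnj u)) u + h11_mult (h11_mult v (h11_cnj (u - v))) u + h11_mult (h11_mult v (h11_cnj v)) (u - v)"
    by (rule h11_eqI) (simp add: cubic_def abs2_def ev_mult ev_diff ev_add ev_cnj algebra_simps)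
  also have "norm \<dots> \<le> norm (h11_mult (h11_mult (u - v) (h11_cnj u)) u) + norm (h11_mult (h11_mult v (h11_cnj (u - v))) u) + norm (h11_mult (h11_mult v (h11_cnj v)) (u - v))"
    by (rule norm_triangle_le, rule add_right_mono, rule norm_triangle_ineq)
  also have "\<dots> \<le> 16 * (norm (u - v) * B * B) + 16 * (B * norm (u - v) * B) + 16 * (B * B * norm (u - v))"
    by (intro add_mono norm_mult3) (simp_all add: norm_h11_cnj assms)
  also have "\<dots> = 48 * B\<^sup>2 * norm (u - v)" by (simp add: power2_eq_square)
  finally show ?thesis .
qed

lemma cubic_0: "cubic 0 = 0"
  by (rule h11_eqI) (simp add: ev_cubic ev_zero)

text \<open>The vector field of the equation for the profile \<open>w(t) = U(-t) u(t)\<close>.\<close>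

definition profile_field :: "real \<Rightarrow> h11 \<Rightarrow> h11" where
  "profile_field t w = h11_scale (- \<i>) (U (- t) (cubic (U t w)))"

text \<open>The four powers of \<open>1 + |t|\<close> come from the outer \<open>U (- t)\<close>,
  from the difference under \<open>U t\<close>, and twice from the radius of the ball after applying
  \<open>U t\<close>.\<close>

lemma profile_field_lipschitz:
  assumes "norm w \<le> B" "norm w' \<le> B"
  shows "norm (profile_field t w - profile_field t w') \<le> 48 * (1 + \<bar>t\<bar>) ^ 4 * B\<^sup>2 * norm (w - w')"
proof -
  have B: "0 \<le> B" using assms(1) norm_ge_zero[of w] by linarith
  have U: "norm (U t w) \<le> (1 + \<bar>t\<bar>) * B" if "norm w \<le> B" for w
    using norm_U[of t w] mult_left_mono[OF that, of "1 + \<bar>t\<bar>"] by linarith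
  have "profile_field t w - profile_field t w' = h11_scale (- \<i>) (U (- t) (cubic (U t w) - cubic (U t w')))"
    by (simp add: profile_field_def linear_simps[OF h11_scale_linear] linear_simps[OF U_linear])
  also have "norm \<dots> = norm (U (- t) (cubic (U t w) - cubic (U t w')))" by (simp add: norm_h11_scale)
  also have "\<dots> \<le> (1 + \<bar>t\<bar>) * norm (cubic (U t w) - cubic (U t w'))" using norm_U[of "- t"] by simp
  also have "\<dots> \<le> (1 + \<bar>t\<bar>) * (48 * ((1 + \<bar>t\<bar>) * B)\<^sup>2 * norm (U t w - U t w'))"
    by (intro mult_left_mono cubic_lipschitz U assms) auto
  also have "U t w - U t w' = U t (w - w')" by (simp add: linear_simps[OF U_linear])
  also have "(1 + \<bar>t\<bar>) * (48 * ((1 + \<bar>t\<bar>) * B)\<^sup>2 * norm (U t (w - w'))) \<le> (1 + \<bar>t\<bar>) * (48 * ((1 + \<bar>t\<bar>) * B)\<^sup>2 * ((1 + \<bar>t\<bar>) * norm (w - w')))"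
    by (intro mult_left_mono norm_U) auto
  also have "\<dots> = 48 * (1 + \<bar>t\<bar>) ^ 4 * B\<^sup>2 * norm (w - w')" by (simp add: power2_eq_square power4_eq_xxxx)
  finally show ?thesis .
qed

lemma profile_field_0: "profile_field t 0 = 0"
  by (simp add: profile_field_def linear_simps[OF U_linear] cubic_0 linear_simps[OF h11_scale_linear])

lemma profile_field_continuous_on: "continuous_on S w \<Longrightarrow> continuous_on S (\<lambda>s. profile_field s (w s))"
proof -
  assume w: "continuous_on S w"
  have "continuous_on S (\<lambda>s. cubic (U s (w s)))"
    using U_continuous_on[OF continuous_on_id w] unfolding continuous_on_def by (auto intro: cubic_tendsto)
  then have "continuous_on S (\<lambda>s. U (- s) (cubic (U s (w s))))"
    by (intro U_continuous_on) (auto intro!: continuous_intros)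
  then show ?thesis unfolding profile_field_def by (rule bounded_linear.continuous_on[OF h11_scale_linear])
qed

lemma E_scale_swap: "E0 f (h11_scale (- \<i>) g) = E0 (h11_scale \<i> f) g" "E1 f (h11_scale (- \<i>) g) = E1 (h11_scale \<i> f) g"
proof -
  have eq: "inner p (- \<i> * q) = inner (\<i> * p) q" for p q by (simp add: inner_complex_def)
  show "E0 f (h11_scale (- \<i>) g) = E0 (h11_scale \<i> f) g"
    by (simp only: E0_def ip_def ev_scale eq)
  have "E1 f (h11_scale (- \<i>) g) = ip (dv f) (\<lambda>x. - \<i> * dv g x)"
    unfolding E1_def by (rule ip_cong_AE) (use dv_scale[of "- \<i>" g] in auto)
  also have "\<dots> = ip (\<lambda>x. \<i> * dv f x) (dv g)" by (simp only: ip_def eq)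
  also have "\<dots> = E1 (h11_scale \<i> f) g"
    unfolding E1_def by (rule ip_cong_AE) (use dv_scale[of "\<i>" f] in auto)
  finally show "E1 f (h11_scale (- \<i>) g) = E1 (h11_scale \<i> f) g" .
qed

text \<open>At each point, \<open>f\<close> and \<open>|f|\<^sup>2 f\<close> are real multiples of
  each other, and rotation by \<open>- \<i>\<close> makes them orthogonal for the real inner
  product. The first identity gives mass conservation; the second removes the nonlinear part of the
  velocity from the derivative of \<open>Q4\<close>.\<close>

lemma E0_cubic_zero: "E0 f (h11_scale (- \<i>) (cubic f)) = 0" "E0 (cubic f) (h11_scale (- \<i>) (cubic f)) = 0"
  by (simp_all add: E0_def ip_def ev_scale ev_cubic inner_complex_def)

text \<open>A discrete gradient of \<open>Q4\<close>. From \<open>|b|\<^sup>4 - |a|\<^sup>4 =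
  (|b|\<^sup>2 + |a|\<^sup>2) (|b|\<^sup>2 - |a|\<^sup>2)\<close>, where the last factor is the real
  inner product of \<open>a + b\<close> and \<open>b - a\<close>, the increment of \<open>Q4\<close>
  becomes an exact pairing with \<open>b - a\<close>. No remainder of second order arises that would
  require \<open>u\<close> to be differentiable.\<close>

definition Q4_cross :: "h11 \<Rightarrow> h11 \<Rightarrow> h11" where
  "Q4_cross a b = h11_mult (abs2 b + abs2 a) (a + b)"

lemma Q4_diff: "Q4 b - Q4 a = E0 (Q4_cross a b) (b - a)"
proof -
  have "Q4 b - Q4 a = E0 (abs2 b + abs2 a) (abs2 b - abs2 a)"
    by (simp add: Q4_def bounded_bilinear.add_left[OF E0_bilinear] bounded_bilinear.diff_right[OF E0_bilinear] E_commute(1)[of "abs2 a" "abs2 b"])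
  also have "\<dots> = E0 (Q4_cross a b) (b - a)"
    unfolding E0_def ip_def Q4_cross_def
  proof (intro Bochner_Integration.integral_cong refl)
    fix x
    define p q where "p = ev a x" and "q = ev b x"
    have "inner (of_real ((cmod q)\<^sup>2) + of_real ((cmod p)\<^sup>2)) (complex_of_real ((cmod q)\<^sup>2) - of_real ((cmod p)\<^sup>2)) 
      = inner ((of_real ((cmod q)\<^sup>2) + of_real ((cmod p)\<^sup>2)) * (p + q)) (q - p)"
      unfolding cmod_square_Re_Im by (simp add: inner_complex_def algebra_simps)
    then show "inner (ev (abs2 b + abs2 a) x) (ev (abs2 b - abs2 a) x) = inner (ev (h11_mult (abs2 b + abs2 a) (a + b)) x) (ev (b - a) x)"
      by (simp add: ev_add ev_diff ev_mult ev_abs2 p_def q_def)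
  qed
  finally show ?thesis .
qed

lemma Q4_cross_self: "Q4_cross a a = 4 *\<^sub>R cubic a"
  by (rule h11_eqI) (simp add: Q4_cross_def cubic_def ev_mult ev_add ev_scaleR scaleR_conv_of_real algebra_simps)

lemma Q4_cross_tendsto: "(f \<longlongrightarrow> a) F \<Longrightarrow> ((\<lambda>s. Q4_cross a (f s)) \<longlongrightarrow> 4 *\<^sub>R cubic a) F"
  unfolding Q4_cross_self[symmetric] Q4_cross_def
  by (intro bounded_bilinear.tendsto[OF h11_mult_bilinear] tendsto_intros abs2_tendsto)

text \<open>The rate of change of \<open>Q4\<close> along the flow. Integration by parts has placed
  one derivative on each side, so it is defined for every element of the space.\<close>

definition Dflux :: "h11 \<Rightarrow> real" where "Dflux u = - 2 * E1 (cubic u) (h11_scale \<i> u)"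

text \<open>The increment of \<open>u\<close> is \<open>(U (s - t) a - a) + U s (w s - w t)\<close>.
  The first part has a difference quotient only in the weak sense: paired with the fixed element
  \<open>4 *\<^sub>R cubic a\<close> it converges to the flux. The second part has a limit in norm,
  and its pairing with \<open>cubic a\<close> vanishes by \<open>E0_cubic_zero\<close>.\<close>

lemma Q4_derivative:
  assumes w: "(w has_vector_derivative profile_field t (w t)) (at t within S)"
  shows "((\<lambda>s. Q4 (U s (w s))) has_real_derivative Dflux (U t (w t))) (at t within S)"
proof -
  define a where "a = U t (w t)"
  define Psi where "Psi s = Q4_cross a (U s (w s))" for s
  have wc: "(w \<longlongrightarrow> w t) (at t within S)"
    using has_vector_derivative_continuous[OF w] by (simp add: continuous_within)
  have uc: "((\<lambda>s. U s (w s)) \<longlongrightarrow> a) (at t within S)"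
    unfolding a_def by (rule U_tendsto[OF tendsto_ident_at wc])
  have Psi: "(Psi \<longlongrightarrow> 4 *\<^sub>R cubic a) (at t within S)" unfolding Psi_def by (rule Q4_cross_tendsto[OF uc])
  have ne: "\<forall>\<^sub>F s in at t within S. s - t \<noteq> 0" by (auto simp: eventually_at_filter)
  have h0: "filterlim (\<lambda>s. s - t) (at 0) (at t within S)"
    using ne by (intro filterlim_atI) (auto intro!: tendsto_eq_intros)
  have l1: "((\<lambda>s. E0 (4 *\<^sub>R cubic a) (U (s - t) a - a) / (s - t)) \<longlongrightarrow> - E1 (4 *\<^sub>R cubic a) (h11_scale \<i> a) / 2) (at t within S)"
    by (rule filterlim_compose[OF E0_U_difference_quotient h0])
  \<comment> \<open>In norm the quotient \<open>(U (s - t) a - a) / (s - t)\<close> may be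
    unbounded. \<open>E0_U_diff_bound\<close> bounds its pairings, and here the other argument tends
    to 0 in norm.\<close>
  have l2: "((\<lambda>s. E0 (Psi s - 4 *\<^sub>R cubic a) (U (s - t) a - a) / (s - t)) \<longlongrightarrow> 0) (at t within S)"
  proof (rule Lim_null_comparison)
    have "((\<lambda>s. 1 / 2 * (norm (Psi s - 4 *\<^sub>R cubic a) * norm a)) \<longlongrightarrow> 1 / 2 * (norm (4 *\<^sub>R cubic a - 4 *\<^sub>R cubic a) * norm a)) (at t within S)"
      by (intro tendsto_intros Psi)
    then show "((\<lambda>s. 1 / 2 * (norm (Psi s - 4 *\<^sub>R cubic a) * norm a)) \<longlongrightarrow> 0) (at t within S)" by simp
    show "\<forall>\<^sub>F s in at t within S. norm (E0 (Psi s - 4 *\<^sub>R cubic a) (U (s - t) a - a) / (s - t)) \<le> 1 / 2 * (norm (Psi s - 4 *\<^sub>R cubic a) * norm a)"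
      using ne
    proof eventually_elim
      case (elim s)
      have "norm (E0 (Psi s - 4 *\<^sub>R cubic a) (U (s - t) a - a) / (s - t)) = \<bar>E0 (Psi s - 4 *\<^sub>R cubic a) (U (s - t) a - a)\<bar> / \<bar>s - t\<bar>"
        by (simp only: real_norm_def abs_divide)
      also have "\<dots> \<le> \<bar>s - t\<bar> / 2 * (norm (Psi s - 4 *\<^sub>R cubic a) * norm a) / \<bar>s - t\<bar>"
        by (intro divide_right_mono E0_U_diff_bound) simp
      also have "\<dots> = 1 / 2 * (norm (Psi s - 4 *\<^sub>R cubic a) * norm a)" using elim by simp
      finally show ?case .
    qed
  qed
  have dq: "((\<lambda>s. (w s - w t) /\<^sub>R (s - t)) \<longlongrightarrow> profile_field t (w t)) (at t within S)"
  proof -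
    have "((\<lambda>s. ((w s - w t) - (s - t) *\<^sub>R profile_field t (w t)) /\<^sub>R (s - t)) \<longlongrightarrow> 0) (at t within S)"
    proof (rule tendsto_norm_zero_cancel)
      have "((\<lambda>s. norm ((w s - w t) - (s - t) *\<^sub>R profile_field t (w t)) / norm (s - t)) \<longlongrightarrow> 0) (at t within S)"
        using w by (simp add: has_vector_derivative_def has_derivative_iff_norm)
      then show "((\<lambda>s. norm (((w s - w t) - (s - t) *\<^sub>R profile_field t (w t)) /\<^sub>R (s - t))) \<longlongrightarrow> 0) (at t within S)"
        by (simp add: divide_inverse mult.commute)
    qed
    from tendsto_add[OF this tendsto_const[of "profile_field t (w t)"]]
    have "((\<lambda>s. ((w s - w t) - (s - t) *\<^sub>R profile_field t (w t)) /\<^sub>R (s - t) + profile_field t (w t)) \<longlongrightarrow> profile_field t (w t)) (at t within S)" by simp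
    then show ?thesis
      by (rule Lim_transform_eventually) (use ne in eventually_elim, simp add: scaleR_diff_right)
  qed
  have l3: "((\<lambda>s. E0 (Psi s) (U s ((w s - w t) /\<^sub>R (s - t)))) \<longlongrightarrow> E0 (4 *\<^sub>R cubic a) (U t (profile_field t (w t)))) (at t within S)"
    by (intro bounded_bilinear.tendsto[OF E0_bilinear] Psi U_tendsto tendsto_ident_at dq)
  have z: "E0 (4 *\<^sub>R cubic a) (U t (profile_field t (w t))) = 0"
    by (simp add: profile_field_def U_scale a_def[symmetric] bounded_bilinear.scaleR_left[OF E0_bilinear] E0_cubic_zero)
  have "((\<lambda>s. E0 (4 *\<^sub>R cubic a) (U (s - t) a - a) / (s - t) + E0 (Psi s - 4 *\<^sub>R cubic a) (U (s - t) a - a) / (s - t) 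
      + E0 (Psi s) (U s ((w s - w t) /\<^sub>R (s - t)))) \<longlongrightarrow> - E1 (4 *\<^sub>R cubic a) (h11_scale \<i> a) / 2 + 0 + 0) (at t within S)"
    using tendsto_add[OF tendsto_add[OF l1 l2] l3] unfolding z .
  moreover have "- E1 (4 *\<^sub>R cubic a) (h11_scale \<i> a) / 2 + 0 + 0 = Dflux a"
    by (simp add: Dflux_def bounded_bilinear.scaleR_left[OF E1_bilinear])
  ultimately have "((\<lambda>s. E0 (4 *\<^sub>R cubic a) (U (s - t) a - a) / (s - t) + E0 (Psi s - 4 *\<^sub>R cubic a) (U (s - t) a - a) / (s - t) 
      + E0 (Psi s) (U s ((w s - w t) /\<^sub>R (s - t)))) \<longlongrightarrow> Dflux a) (at t within S)" by (simp only:)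
  then have "((\<lambda>s. (Q4 (U s (w s)) - Q4 (U t (w t))) / (s - t)) \<longlongrightarrow> Dflux a) (at t within S)"
  proof (rule Lim_transform_eventually)
    show "\<forall>\<^sub>F s in at t within S. E0 (4 *\<^sub>R cubic a) (U (s - t) a - a) / (s - t) + E0 (Psi s - 4 *\<^sub>R cubic a) (U (s - t) a - a) / (s - t) 
      + E0 (Psi s) (U s ((w s - w t) /\<^sub>R (s - t))) = (Q4 (U s (w s)) - Q4 (U t (w t))) / (s - t)"
      using ne
    proof eventually_elim
      case (elim s)
      have d: "U s (w s) - a = (U (s - t) a - a) + U s (w s - w t)"
        by (simp add: a_def U_U linear_simps[OF U_linear])
      have "Q4 (U s (w s)) - Q4 (U t (w t)) = E0 (Psi s) (U s (w s) - a)"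
        unfolding Psi_def a_def by (rule Q4_diff)
      also have "\<dots> = E0 (4 *\<^sub>R cubic a) (U (s - t) a - a) + E0 (Psi s - 4 *\<^sub>R cubic a) (U (s - t) a - a) + E0 (Psi s) (U s (w s - w t))"
        unfolding d bounded_bilinear.add_right[OF E0_bilinear, of "Psi s"]
        by (simp add: bounded_bilinear.diff_left[OF E0_bilinear])
      finally have e: "Q4 (U s (w s)) - Q4 (U t (w t)) = E0 (4 *\<^sub>R cubic a) (U (s - t) a - a) + E0 (Psi s - 4 *\<^sub>R cubic a) (U (s - t) a - a) + E0 (Psi s) (U s (w s - w t))" .
      have "E0 (Psi s) (U s ((w s - w t) /\<^sub>R (s - t))) = E0 (Psi s) (U s (w s - w t)) / (s - t)"
        by (simp only: linear_simps[OF U_linear] bounded_bilinear.scaleR_right[OF E0_bilinear] real_scaleR_def divide_inverse_commute)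
      then show ?case unfolding e by (simp only: add_divide_distrib)
    qed
  qed
  then show ?thesis unfolding a_def[symmetric] has_field_derivative_iff by (simp only: a_def)
qed

section \<open>Conservation laws and the pseudoconformal law on the profile\<close>

lemma mass_derivative:
  assumes w: "(w has_vector_derivative profile_field t (w t)) (at t within S)"
  shows "((\<lambda>s. E0 (w s) (w s)) has_real_derivative 0) (at t within S)"
proof -
  have "((\<lambda>s. E0 (w s) (w s)) has_vector_derivative (E0 (w t) (profile_field t (w t)) + E0 (profile_field t (w t)) (w t))) (at t within S)"
    by (rule bounded_bilinear.has_vector_derivative[OF E0_bilinear w w])
  moreover have "E0 (w t) (profile_field t (w t)) = 0"
    using E0_U[of t "w t" "profile_field t (w t)"] by (simp add: profile_field_def U_scale E0_cubic_zero)
  ultimately show ?thesis by (simp add: has_real_derivative_iff_has_vector_derivative E_commute(1)[of "profile_field t (w t)"])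
qed

text \<open>By invariance of \<open>E1\<close> under the group the velocity can be evaluated at
  \<open>u\<close>. Kinetic energy is lost at the rate at which \<open>Q4\<close> grows;
  \<open>E1 + Q4\<close> is twice the Hamiltonian \<open>\<parallel>\<partial>\<^sub>x
  u\<parallel>\<^sup>2 / 2 + \<parallel>u\<parallel>\<^sub>4\<^sup>4 / 2\<close>.\<close>

lemma E1_derivative:
  assumes w: "(w has_vector_derivative profile_field t (w t)) (at t within S)"
  shows "((\<lambda>s. E1 (w s) (w s)) has_real_derivative - Dflux (U t (w t))) (at t within S)"
proof -
  have "((\<lambda>s. E1 (w s) (w s)) has_vector_derivative (E1 (w t) (profile_field t (w t)) + E1 (profile_field t (w t)) (w t))) (at t within S)"
    by (rule bounded_bilinear.has_vector_derivative[OF E1_bilinear w w])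
  moreover have "E1 (w t) (profile_field t (w t)) = E1 (cubic (U t (w t))) (h11_scale \<i> (U t (w t)))"
    using E1_U[of t "w t" "profile_field t (w t)"] by (simp add: profile_field_def U_scale E_scale_swap(2) E_commute(2))
  ultimately show ?thesis by (simp add: has_real_derivative_iff_has_vector_derivative E_commute(2)[of "profile_field t (w t)"] Dflux_def)
qed

text \<open>Integration by parts: the left side is the integral of \<open>x\<close> times the
  derivative of \<open>|u|\<^sup>4\<close>, and the derivative of \<open>x |u|\<^sup>4\<close> has
  integral zero.\<close>

lemma weighted_parts_abs2: "2 * (LINT x|lborel. x * (2 * inner (ev u x) (dv u x) * (cmod (ev u x))\<^sup>2)) = - Q4 u"
proof -
  define A where "A = abs2 u"
  have a: "ac_deriv (\<lambda>x. of_real x * (ev A x * ev A x)) (\<lambda>x. 1 * (ev A x * ev A x) + of_real x * (dv A x * ev A x + ev A x * dv A x))"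
  proof (intro ac_deriv_mult ac_deriv_dv)
    show "ac_deriv complex_of_real (\<lambda>x. 1)"
      by (rule ac_deriv_C1) (auto intro!: derivative_eq_intros simp: has_vector_derivative_def bounded_linear_of_real scaleR_conv_of_real intro: bounded_linear_imp_has_derivative)
  qed
  have i1: "integrable lborel (\<lambda>x. of_real x * (ev A x * ev A x))"
    using L2_mult_integrable_complex[OF mx_L2 ev_L2, of A A] by (simp add: mx_def mult.assoc)
  have i2: "integrable lborel (\<lambda>x. 1 * (ev A x * ev A x))" using L2_mult_integrable_complex[OF ev_L2 ev_L2, of A A] by simp
  have i3: "integrable lborel (\<lambda>x. of_real x * (dv A x * ev A x + ev A x * dv A x))"
    using Bochner_Integration.integrable_add[OF L2_mult_integrable_complex[OF mx_L2 dv_L2, of A A] L2_mult_integrable_complex[OF mx_L2 dv_L2, of A A]]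
    by (simp add: mx_def algebra_simps)
  have z: "(LINT x|lborel. 1 * (ev A x * ev A x)) + (LINT x|lborel. of_real x * (dv A x * ev A x + ev A x * dv A x)) = 0"
    using ac_deriv_integral_zero[OF a i1 Bochner_Integration.integrable_add[OF i2 i3]] unfolding Bochner_Integration.integral_add[OF i2 i3] .
  have q: "(LINT x|lborel. 1 * (ev A x * ev A x)) = of_real (Q4 u)"
  proof -
    have "(LINT x|lborel. 1 * (ev A x * ev A x)) = (LINT x|lborel. complex_of_real (inner (ev A x) (ev A x)))"
      by (intro Bochner_Integration.integral_cong refl) (simp only: A_def ev_abs2 of_real_mult[symmetric] inner_of_real_of_real mult_1)
    then show ?thesis by (simp add: Q4_def E0_def ip_def A_def)
  qed
  have "(LINT x|lborel. of_real x * (dv A x * ev A x + ev A x * dv A x)) 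
    = (LINT x|lborel. complex_of_real (2 * (x * (2 * inner (ev u x) (dv u x) * (cmod (ev u x))\<^sup>2))))"
  proof (rule integral_cong_AE)
    show "AE x in lborel. of_real x * (dv A x * ev A x + ev A x * dv A x) = complex_of_real (2 * (x * (2 * inner (ev u x) (dv u x) * (cmod (ev u x))\<^sup>2)))"
      using dv_abs2[of u] by eventually_elim (simp add: A_def ev_abs2 algebra_simps)
  qed measurable
  also have "\<dots> = complex_of_real (LINT x|lborel. 2 * (x * (2 * inner (ev u x) (dv u x) * (cmod (ev u x))\<^sup>2)))"
    by (rule integral_complex_of_real)
  also have "\<dots> = complex_of_real (2 * (LINT x|lborel. x * (2 * inner (ev u x) (dv u x) * (cmod (ev u x))\<^sup>2)))"
    by (rule arg_cong[OF integral_mult_right_zero])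
  finally have r: "(LINT x|lborel. of_real x * (dv A x * ev A x + ev A x * dv A x)) = complex_of_real (2 * (LINT x|lborel. x * (2 * inner (ev u x) (dv u x) * (cmod (ev u x))\<^sup>2)))" .
  have "of_real (Q4 u) + complex_of_real (2 * (LINT x|lborel. x * (2 * inner (ev u x) (dv u x) * (cmod (ev u x))\<^sup>2))) = 0"
    using z unfolding q r .
  then have "complex_of_real (Q4 u + 2 * (LINT x|lborel. x * (2 * inner (ev u x) (dv u x) * (cmod (ev u x))\<^sup>2))) = 0" by simp
  then show ?thesis unfolding of_real_eq_0_iff by linarith
qed

text \<open>In the expansion of \<open>J\<close> the product of the two \<open>x\<close> terms
  vanishes, since \<open>u\<close> and \<open>- \<i> |u|\<^sup>2 u\<close> are orthogonal pointwise.
  The product of the two derivative terms is the flux with factor \<open>t\<^sup>2\<close>. The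
  cross terms combine to a quarter of \<open>t x\<close> times the derivative of
  \<open>|u|\<^sup>4\<close>, counted twice, which is integrated by parts.\<close>

lemma pseudoconformal_flux:
  "2 * ip (Jop t u) (Jop t (h11_scale (- \<i>) (cubic u))) = - t\<^sup>2 * Dflux u - t * Q4 u"
proof -
  have "ip (Jop t u) (Jop t (h11_scale (- \<i>) (cubic u))) 
    = (LINT x|lborel. t\<^sup>2 * inner (dv (cubic u) x) (\<i> * dv u x) + t * (x * (2 * inner (ev u x) (dv u x) * (cmod (ev u x))\<^sup>2)))"
    unfolding ip_def
  proof (rule integral_cong_AE)
    show "AE x in lborel. inner (Jop t u x) (Jop t (h11_scale (- \<i>) (cubic u)) x) 
      = t\<^sup>2 * inner (dv (cubic u) x) (\<i> * dv u x) + t * (x * (2 * inner (ev u x) (dv u x) * (cmod (ev u x))\<^sup>2))"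
      using dv_scale[of "- \<i>" "cubic u"] dv_cubic[of u]
    proof eventually_elim
      case (elim x)
      define p q r where "p = ev u x" and "q = dv u x" and "r = dv (cubic u) x"
      have r: "r = of_real (2 * inner p q) * p + of_real ((cmod p)\<^sup>2) * q" using elim(2) by (simp add: p_def q_def r_def)
      have "inner (of_real x * p + \<i> * of_real t * q) (of_real x * (- \<i> * (p * of_real ((cmod p)\<^sup>2))) + \<i> * of_real t * (- \<i> * r))
        = t\<^sup>2 * inner r (\<i> * q) + t * x * (inner p r - inner q (p * of_real ((cmod p)\<^sup>2)))"
        unfolding cmod_square_Re_Im by (simp add: inner_complex_def algebra_simps power2_eq_square)
      also have "inner p r - inner q (p * of_real ((cmod p)\<^sup>2)) = 2 * inner p q * (cmod p)\<^sup>2"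
        unfolding r cmod_square_Re_Im by (simp add: inner_complex_def algebra_simps)
      finally show ?case using elim(1)
        by (simp add: Jop_def mx_def ev_scale ev_cubic p_def q_def r_def mult.assoc)
    qed
  qed measurable
  also have "\<dots> = t\<^sup>2 * (LINT x|lborel. inner (dv (cubic u) x) (\<i> * dv u x)) + t * (LINT x|lborel. x * (2 * inner (ev u x) (dv u x) * (cmod (ev u x))\<^sup>2))"
  proof -
    have i1: "integrable lborel (\<lambda>x. inner (dv (cubic u) x) (\<i> * dv u x))" by (intro ip_integrable L2_cmult dv_L2)
    have "integrable lborel (\<lambda>x. Re (mx (abs2 u) x * dv (abs2 u) x))"
      by (intro integrable_Re L2_mult_integrable_complex mx_L2 dv_L2)
    then have i2: "integrable lborel (\<lambda>x. x * (2 * inner (ev u x) (dv u x) * (cmod (ev u x))\<^sup>2))"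
    proof (rule integrable_cong_AE_imp)
      show "AE x in lborel. Re (mx (abs2 u) x * dv (abs2 u) x) = x * (2 * inner (ev u x) (dv u x) * (cmod (ev u x))\<^sup>2)"
        using dv_abs2[of u] by eventually_elim (simp add: mx_def ev_abs2 flip: of_real_power)
    qed measurable
    show ?thesis using i1 i2 by (subst Bochner_Integration.integral_add) auto
  qed
  also have "(LINT x|lborel. inner (dv (cubic u) x) (\<i> * dv u x)) = E1 (cubic u) (h11_scale \<i> u)"
    unfolding E1_def ip_def[symmetric] by (rule ip_cong_AE) (use dv_scale[of \<i> u] in auto)
  finally show ?thesis using weighted_parts_abs2[of u] by (simp add: Dflux_def algebra_simps)
qed

lemma E2_derivative:
  assumes w: "(w has_vector_derivative profile_field t (w t)) (at t within S)"
  shows "((\<lambda>s. E2 (w s) (w s)) has_real_derivative - t\<^sup>2 * Dflux (U t (w t)) - t * Q4 (U t (w t))) (at t within S)"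
proof -
  have "((\<lambda>s. E2 (w s) (w s)) has_vector_derivative (E2 (w t) (profile_field t (w t)) + E2 (profile_field t (w t)) (w t))) (at t within S)"
    by (rule bounded_bilinear.has_vector_derivative[OF E2_bilinear w w])
  moreover have "E2 (w t) (profile_field t (w t)) = ip (Jop t (U t (w t))) (Jop t (h11_scale (- \<i>) (cubic (U t (w t)))))"
    using E2_U[of t "U t (w t)" "h11_scale (- \<i>) (cubic (U t (w t)))"] by (simp add: profile_field_def U_scale)
  ultimately show ?thesis 
    using pseudoconformal_flux[of t "U t (w t)"]
    by (simp add: has_real_derivative_iff_has_vector_derivative E_commute(3)[of "profile_field t (w t)"])
qed

section \<open>Global solutions and decay\<close>

text \<open>Bound for \<open>E1 + Q4\<close> at time 0 in terms of the data:
  \<open>r\<^sup>2\<close> for the kinetic form and \<open>16 r ^ 4\<close> from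
  \<open>Q4_le\<close>.\<close>

definition energy_bound :: "real \<Rightarrow> real" where "energy_bound r = r\<^sup>2 + 16 * r ^ 4"

lemma energy_bound_nonneg: "0 \<le> energy_bound r"
  by (simp add: energy_bound_def)

lemma Q4_nonneg: "0 \<le> Q4 f"
  by (simp add: Q4_def E_self)

lemma norm_h11_power2_E: "(norm f)\<^sup>2 = E0 f f + E1 f f + E2 f f"
  by (simp add: norm_h11_power2 E_self)

lemma E_self_nonneg: "0 \<le> E0 f f" "0 \<le> E1 f f" "0 \<le> E2 f f"
  by (simp_all add: E_self)

lemma Q4_le: "Q4 f \<le> 16 * norm f ^ 4"
proof -
  have "Q4 f \<le> (norm (abs2 f))\<^sup>2"
    unfolding Q4_def E_self by (intro power_mono L2_norm_ev_le) simp
  also have "\<dots> \<le> (4 * (norm f)\<^sup>2)\<^sup>2" by (intro power_mono norm_abs2) simp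
  also have "\<dots> = 16 * norm f ^ 4" by (simp add: power_mult_distrib)
  finally show ?thesis .
qed

text \<open>The quantity \<open>E(t)\<close> of the overview: by \<open>L2_norm_Jop\<close>, the
  form \<open>E2\<close> of the profile is \<open>\<parallel>J u\<parallel>\<^sup>2\<close>.\<close>

definition pseudo :: "(real \<Rightarrow> h11) \<Rightarrow> real \<Rightarrow> real" where
  "pseudo w t = E2 (w t) (w t) + t\<^sup>2 * Q4 (U t (w t))"

section \<open>A priori bounds on a finite time interval\<close>

context
  fixes w :: "real \<Rightarrow> h11" and T r :: real
  assumes w: "\<And>t. t \<in> {0..T} \<Longrightarrow> (w has_vector_derivative profile_field t (w t)) (at t within {0..T})"
    and r: "norm (w 0) \<le> r" and T: "0 \<le> T"
begin

lemma mass_bound: assumes t: "t \<in> {0..T}" shows "E0 (w t) (w t) \<le> r\<^sup>2"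
proof -
  have "\<exists>c. \<forall>t\<in>{0..T}. E0 (w t) (w t) = c"
    by (rule has_field_derivative_zero_constant) (use mass_derivative[OF w] in auto)
  then have "E0 (w t) (w t) = E0 (w 0) (w 0)" using t T by force
  also have "\<dots> \<le> (norm (w 0))\<^sup>2" using E_self_nonneg[of "w 0"] by (simp add: norm_h11_power2_E)
  also have "\<dots> \<le> r\<^sup>2" using r by (intro power_mono) auto
  finally show ?thesis .
qed

lemma energy_conservation: assumes t: "t \<in> {0..T}" shows "E1 (w t) (w t) + Q4 (U t (w t)) \<le> energy_bound r"
proof -
  have "\<exists>c. \<forall>t\<in>{0..T}. E1 (w t) (w t) + Q4 (U t (w t)) = c"
  proof (rule has_field_derivative_zero_constant)
    fix t assume "t \<in> {0..T}"
    from DERIV_add[OF E1_derivative[OF w[OF this]] Q4_derivative[OF w[OF this]]]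
    show "((\<lambda>t. E1 (w t) (w t) + Q4 (U t (w t))) has_real_derivative 0) (at t within {0..T})" by simp
  qed simp
  then have "E1 (w t) (w t) + Q4 (U t (w t)) = E1 (w 0) (w 0) + Q4 (w 0)" using t T by (force simp: U_0)
  also have "E1 (w 0) (w 0) \<le> (norm (w 0))\<^sup>2" using E_self_nonneg[of "w 0"] by (simp add: norm_h11_power2_E)
  also have "(norm (w 0))\<^sup>2 \<le> r\<^sup>2" using r by (intro power_mono) auto
  also have "Q4 (w 0) \<le> 16 * norm (w 0) ^ 4" by (rule Q4_le)
  also have "16 * norm (w 0) ^ 4 \<le> 16 * r ^ 4" using r by (intro mult_left_mono power_mono) auto
  finally show ?thesis by (simp add: energy_bound_def)
qed

text \<open>Differentiating \<open>t\<^sup>2 Q4\<close> gives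
  \<open>2 t Q4 + t\<^sup>2 Dflux\<close>, and \<open>E2\<close> contributes
  \<open>- t\<^sup>2 Dflux - t Q4\<close>; the flux cancels and one \<open>t Q4\<close>
  remains.\<close>

lemma pseudo_derivative:
  assumes t: "t \<in> {0..T}" shows "(pseudo w has_real_derivative t * Q4 (U t (w t))) (at t within {0..T})"
proof -
  have "((\<lambda>t. t\<^sup>2) has_real_derivative 2 * t) (at t within {0..T})" by (auto intro!: derivative_eq_intros)
  from DERIV_add[OF E2_derivative[OF w[OF t]] DERIV_mult[OF this Q4_derivative[OF w[OF t]]]]
  show ?thesis unfolding pseudo_def[abs_def] by (simp add: algebra_simps)
qed

text \<open>Conservation of energy bounds \<open>Q4\<close> by a constant, so the derivative is at
  most linear in \<open>t\<close>. This covers the times near 0, supplies the value at time 1 from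
  which \<open>pseudo_growth\<close> starts, and bounds the moment in
  \<open>norm_bound\<close>.\<close>

lemma pseudo_bound: assumes t: "t \<in> {0..T}" shows "pseudo w t \<le> r\<^sup>2 + energy_bound r * t\<^sup>2 / 2"
proof -
  have "pseudo w t - energy_bound r * t\<^sup>2 / 2 \<le> pseudo w 0 - energy_bound r * 0\<^sup>2 / 2"
  proof (rule nonpos_derivative_imp_le[where f="\<lambda>a. pseudo w a - energy_bound r * a\<^sup>2 / 2" and f'="\<lambda>s. s * Q4 (U s (w s)) - energy_bound r * s"])
    fix s assume s: "s \<in> {0..t}"
    then have sT: "s \<in> {0..T}" using t by auto
    have "(pseudo w has_real_derivative s * Q4 (U s (w s))) (at s within {0..t})"
      by (rule DERIV_subset[OF pseudo_derivative[OF sT]]) (use t in auto)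
    then show "((\<lambda>a. pseudo w a - energy_bound r * a\<^sup>2 / 2) has_real_derivative s * Q4 (U s (w s)) - energy_bound r * s) (at s within {0..t})"
      by (auto intro!: derivative_eq_intros)
    have "Q4 (U s (w s)) \<le> energy_bound r" using energy_conservation[OF sT] E_self_nonneg(2)[of "w s"] by linarith
    then have "s * Q4 (U s (w s)) \<le> s * energy_bound r" using s by (intro mult_left_mono) auto
    then show "s * Q4 (U s (w s)) - energy_bound r * s \<le> 0" by (simp add: mult.commute)
  qed (use t in auto)
  also have "pseudo w 0 - energy_bound r * 0\<^sup>2 / 2 = E2 (w 0) (w 0)" by (simp add: pseudo_def)
  also have "\<dots> \<le> (norm (w 0))\<^sup>2" using E_self_nonneg[of "w 0"] by (simp add: norm_h11_power2_E)
  also have "\<dots> \<le> r\<^sup>2" using r by (intro power_mono) auto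
  finally show ?thesis by simp
qed

text \<open>The squared norm is the sum of mass, kinetic form and moment, bounded by
  \<open>r\<^sup>2\<close>, \<open>M\<close> and \<open>r\<^sup>2 + M t\<^sup>2 / 2\<close>. The
  constant is explicit because the truncation radius in \<open>global_solution\<close> is built from
  it.\<close>

lemma norm_bound: assumes t: "t \<in> {0..T}" shows "norm (w t) \<le> sqrt (2 * r\<^sup>2 + energy_bound r) * (1 + t)"
proof -
  define M where "M = energy_bound r"
  have M: "0 \<le> M" by (simp add: M_def energy_bound_nonneg)
  have "E1 (w t) (w t) \<le> M" unfolding M_def using energy_conservation[OF t] Q4_nonneg[of "U t (w t)"] by linarith
  moreover have "E2 (w t) (w t) \<le> r\<^sup>2 + M * t\<^sup>2 / 2"
    unfolding M_def using pseudo_bound[OF t] Q4_nonneg[of "U t (w t)"] by (simp add: pseudo_def) (smt (verit) mult_nonneg_nonneg zero_le_power2)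
  ultimately have "(norm (w t))\<^sup>2 \<le> r\<^sup>2 + M + (r\<^sup>2 + M * t\<^sup>2 / 2)"
    using mass_bound[OF t] by (simp add: norm_h11_power2_E)
  also have "\<dots> = (2 * r\<^sup>2 + M) + M * t\<^sup>2 / 2" by simp
  also have "\<dots> \<le> (2 * r\<^sup>2 + M) * (1 + t)\<^sup>2"
  proof -
    have "M * t\<^sup>2 / 2 \<le> (2 * r\<^sup>2 + M) * t\<^sup>2"
    proof -
      have "M / 2 * t\<^sup>2 \<le> (2 * r\<^sup>2 + M) * t\<^sup>2" using M by (intro mult_right_mono) auto
      then show ?thesis by simp
    qed
    moreover have "0 \<le> (2 * r\<^sup>2 + M) * (2 * t)" using M t by (intro mult_nonneg_nonneg) auto
    moreover have "(2 * r\<^sup>2 + M) * (1 + t)\<^sup>2 = (2 * r\<^sup>2 + M) + (2 * r\<^sup>2 + M) * (2 * t) + (2 * r\<^sup>2 + M) * t\<^sup>2"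
      by (simp add: power2_sum distrib_left)
    ultimately show ?thesis by linarith
  qed
  also have "\<dots> = (sqrt (2 * r\<^sup>2 + M) * (1 + t))\<^sup>2" using M by (simp add: power_mult_distrib)
  finally show ?thesis unfolding M_def[symmetric]
    by (rule power2_le_imp_le) (use M t in auto)
qed

lemma pseudo_growth:
  assumes t: "1 \<le> t" "t \<le> T" shows "pseudo w t \<le> (r\<^sup>2 + energy_bound r / 2) * t"
proof -
  have "pseudo w t / t \<le> pseudo w 1 / 1"
  proof (rule nonpos_derivative_imp_le[where f="\<lambda>s. pseudo w s / s" and f'="\<lambda>s. (s * Q4 (U s (w s)) * s - pseudo w s * 1) / (s * s)"])
    fix s assume s: "s \<in> {1..t}"
    then have sT: "s \<in> {0..T}" using t by auto
    have "(pseudo w has_real_derivative s * Q4 (U s (w s))) (at s within {1..t})"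
      by (rule DERIV_subset[OF pseudo_derivative[OF sT]]) (use t in auto)
    then show "((\<lambda>s. pseudo w s / s) has_real_derivative (s * Q4 (U s (w s)) * s - pseudo w s * 1) / (s * s)) (at s within {1..t})"
      by (rule DERIV_divide) (use s in auto)
    \<comment> \<open>\<open>s\<^sup>2 Q4\<close> is one of the two summands of
      \<open>pseudo\<close>, and the other one, \<open>E2\<close>, is nonnegative.\<close>
    have "s * Q4 (U s (w s)) * s - pseudo w s * 1 \<le> 0"
      using E_self_nonneg(3)[of "w s"] by (simp add: pseudo_def power2_eq_square mult_ac)
    then show "(s * Q4 (U s (w s)) * s - pseudo w s * 1) / (s * s) \<le> 0" by (intro divide_nonpos_nonneg) auto
  qed (rule t)
  also have "pseudo w 1 / 1 \<le> r\<^sup>2 + energy_bound r / 2" using pseudo_bound[of 1] t by simp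
  finally show ?thesis using t by (simp add: divide_le_eq)
qed

end

text \<open>As \<open>i x f\<close> is orthogonal to \<open>f\<close>, the derivative of \<open>|f|\<^sup>2\<close> is
  \<open>2 Re (conj f (J f) / (i t))\<close>; integrate that of \<open>|f|\<^sup>4\<close>.\<close>

lemma sup_cubed_bound:
  assumes t: "t > 0"
  shows "cmod (ev f x) ^ 3 \<le> 4 / t * (L2_norm (ev (abs2 f)) * L2_norm (Jop t f))"
proof -
  define A where "A = abs2 f"
  define c where "c = 4 / t * (L2_norm (ev A) * L2_norm (Jop t f))"
  define S where "S = (SUP x. cmod (ev f x))"
  have bdd: "bdd_above (range (\<lambda>x. cmod (ev f x)))" using ev_sup[of f] by (intro bdd_aboveI[of _ "norm f"]) auto
  have le_S: "cmod (ev f x) \<le> S" for x unfolding S_def by (rule cSUP_upper[OF _ bdd]) simp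
  have S: "0 \<le> S" using le_S[of 0] norm_ge_zero order_trans by blast
  have c: "0 \<le> c" using t by (simp add: c_def)
  \<comment> \<open>One of the factors \<open>|f|\<close> in the derivative of
    \<open>|f|\<^sup>4\<close> is estimated by the supremum \<open>S\<close>, to be cancelled after
    the supremum is taken on the left. This uses that \<open>S\<close> is finite.\<close>
  have fourth: "cmod (ev f x) ^ 4 \<le> S * c" for x
  proof -
    define q where "q x = dv A x * ev A x + ev A x * dv A x" for x
    have a: "ac_deriv (\<lambda>x. ev A x * ev A x) q" unfolding q_def[abs_def] by (intro ac_deriv_mult ac_deriv_dv)
    have i1: "integrable lborel (\<lambda>x. ev A x * ev A x)" by (intro L2_mult_integrable_complex ev_L2)
    have i2: "integrable lborel q" unfolding q_def[abs_def]
      by (intro Bochner_Integration.integrable_add L2_mult_integrable_complex ev_L2 dv_L2)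
    have i3: "integrable lborel (\<lambda>x. 4 / t * S * (cmod (ev A x) * cmod (Jop t f x)))"
      by (intro integrable_mult_right L2_mult_integrable ev_L2 Jop_L2)
    have "cmod (ev f x) ^ 4 = cmod (ev A x * ev A x)"
      by (simp add: A_def ev_abs2 norm_mult power4_eq_xxxx power2_eq_square)
    also have "\<dots> \<le> (LINT y|lborel. cmod (q y))" by (rule ac_deriv_sup_bound[OF a i1 i2])
    also have "\<dots> \<le> (LINT y|lborel. 4 / t * S * (cmod (ev A y) * cmod (Jop t f y)))"
    proof (rule integral_mono_AE)
      show "AE y in lborel. cmod (q y) \<le> 4 / t * S * (cmod (ev A y) * cmod (Jop t f y))"
        using dv_abs2[of f]
      proof eventually_elim
        case (elim y)
        define p d j where "p = ev f y" and "d = dv f y" and "j = Jop t f y"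
        have "inner p d = inner p (- \<i> * j) / t"
          using t by (simp add: j_def p_def d_def Jop_def mx_def inner_complex_def field_simps)
        also have "\<bar>\<dots>\<bar> \<le> cmod p * cmod j / t"
          using Cauchy_Schwarz_ineq2[of p "- \<i> * j"] t by (simp add: norm_mult divide_right_mono)
        also have "\<dots> \<le> S * cmod j / t"
          using t le_S[of y] by (intro divide_right_mono mult_right_mono) (auto simp: p_def)
        finally have pd: "\<bar>inner p d\<bar> \<le> S * cmod j / t" .
        have "cmod (q y) = 2 * (cmod (ev A y) * cmod (dv A y))"
          by (simp add: q_def mult.commute[of "dv A y"] norm_mult flip: mult_2)
        also have "cmod (dv A y) = 2 * \<bar>inner p d\<bar>" using elim by (simp add: A_def p_def d_def abs_mult)
        also have "2 * (cmod (ev A y) * (2 * \<bar>inner p d\<bar>)) \<le> 2 * (cmod (ev A y) * (2 * (S * cmod j / t)))"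
          by (intro mult_left_mono pd) auto
        finally show ?case by (simp add: j_def mult_ac)
      qed
    qed (intro integrable_norm i2, rule i3)
    also have "\<dots> = 4 / t * S * (LINT y|lborel. cmod (ev A y) * cmod (Jop t f y))" by (rule integral_mult_right_zero)
    also have "\<dots> \<le> 4 / t * S * (L2_norm (ev A) * L2_norm (Jop t f))"
      using t S by (intro mult_left_mono L2_Cauchy_Schwarz ev_L2 Jop_L2) auto
    finally show ?thesis by (simp add: c_def mult_ac)
  qed
  have "S \<le> root 4 (S * c)"
    unfolding S_def
  proof (rule cSUP_least)
    fix x
    have "cmod (ev f x) = root 4 (cmod (ev f x) ^ 4)" by (simp add: real_root_power_cancel)
    also have "\<dots> \<le> root 4 (S * c)" by (intro real_root_le_mono fourth) simp
    finally show "cmod (ev f x) \<le> root 4 ((SUP x. cmod (ev f x)) * c)" by (simp add: S_def)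
  qed simp
  then have "S ^ 4 \<le> root 4 (S * c) ^ 4" using S by (intro power_mono) auto
  also have "root 4 (S * c) ^ 4 = S * c" using S c by (intro real_root_pow_pos2) auto
  also have "S ^ 4 = S * S ^ 3" by (simp add: power4_eq_xxxx power3_eq_cube)
  finally have S4: "S * S ^ 3 \<le> S * c" .
  have "S ^ 3 \<le> c"
  proof (cases "S = 0")
    case False
    then show ?thesis using S4 S by simp
  qed (use c in simp)
  moreover have "cmod (ev f x) ^ 3 \<le> S ^ 3" using le_S by (intro power_mono) auto
  ultimately show ?thesis by (simp add: c_def A_def)
qed

lemma decay_estimate:
  assumes w: "\<And>t. t \<in> {0..T} \<Longrightarrow> (w has_vector_derivative profile_field t (w t)) (at t within {0..T})"
    and r: "norm (w 0) \<le> r" and T: "1 \<le> T"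
  shows "cmod (ev (U T (w T)) x) \<le> (4 * (r\<^sup>2 + energy_bound r / 2)) powr (1 / 3) * T powr (- 1 / 3)"
proof -
  define P where "P = r\<^sup>2 + energy_bound r / 2"
  have P: "0 \<le> P" using energy_bound_nonneg[of r] by (simp add: P_def)
  define a j where "a = L2_norm (ev (abs2 (U T (w T))))" and "j = L2_norm (Jop T (U T (w T)))"
  have aj: "0 \<le> a" "0 \<le> j" by (simp_all add: a_def j_def)
  have "pseudo w T \<le> P * T" unfolding P_def by (rule pseudo_growth[OF w r]) (use T in auto)
  moreover have "pseudo w T = j\<^sup>2 + T\<^sup>2 * a\<^sup>2"
    unfolding j_def L2_norm_Jop by (simp add: pseudo_def Q4_def E_self a_def)
  ultimately have le: "j\<^sup>2 + (T * a)\<^sup>2 \<le> P * T" by (simp add: power_mult_distrib)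
  \<comment> \<open>The arithmetic-geometric mean inequality converts the bound on \<open>E\<close>
    into one on the product \<open>a * j\<close>; the linear growth of \<open>E\<close> is used up
    by the factor \<open>T\<close>, so the product stays bounded.\<close>
  have "2 * (T * (a * j)) \<le> j\<^sup>2 + (T * a)\<^sup>2" using sum_squares_bound[of j "T * a"] by (simp add: mult_ac)
  then have "T * (a * j) \<le> T * P" using le P T aj
    by (smt (verit) mult.commute mult_nonneg_nonneg)
  then have ajP: "a * j \<le> P" using T by simp
  have "cmod (ev (U T (w T)) x) ^ 3 \<le> 4 / T * (a * j)"
    unfolding a_def j_def by (rule sup_cubed_bound) (use T in simp)
  also have "\<dots> \<le> 4 / T * P" using T by (intro mult_left_mono ajP) auto
  finally have c3: "cmod (ev (U T (w T)) x) ^ 3 \<le> 4 * P / T" by simp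
  \<comment> \<open>Passing from the third power to \<open>powr\<close> needs a positive base, hence
    the case distinction.\<close>
  have "cmod (ev (U T (w T)) x) = (cmod (ev (U T (w T)) x) ^ 3) powr (1 / 3)"
  proof (cases "cmod (ev (U T (w T)) x) = 0")
    case False
    define c where "c = cmod (ev (U T (w T)) x)"
    have "c powr 3 = c ^ 3" using powr_realpow[of c 3] False by (simp add: c_def)
    then have "(c ^ 3) powr (1 / 3) = (c powr 3) powr (1 / 3)" by (simp only:)
    also have "\<dots> = c powr (3 * (1 / 3))" by (rule powr_powr)
    also have "\<dots> = c" by (simp add: c_def)
    finally show ?thesis by (simp add: c_def)
  qed simp
  also have "\<dots> \<le> (4 * P / T) powr (1 / 3)" by (intro powr_mono2 c3) auto
  also have "\<dots> = (4 * P) powr (1 / 3) * T powr (- 1 / 3)"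
    using P T by (simp add: powr_divide powr_minus_divide)
  finally show ?thesis by (simp add: P_def)
qed

text \<open>Truncating the field radially outside the a priori bound makes it Lipschitz; the solution of the
  truncated equation never reaches the truncation radius.\<close>

lemma global_solution:
  assumes r: "norm w0 \<le> r" and r0: "0 < r"
  shows "\<exists>w. continuous_on {0..} w \<and> (\<forall>t\<ge>0. w t = w0 + integral {0..t} (\<lambda>s. profile_field s (w s)))"
proof -
  define b where "b = sqrt (2 * r\<^sup>2 + energy_bound r)"
  have rb: "r \<le> b" unfolding b_def using energy_bound_nonneg[of r] r0 by (intro real_le_rsqrt) auto
  \<comment> \<open>The radius lies strictly above the a priori bound \<open>b * (1 + t)\<close>, so
    that a solution on the sphere would contradict \<open>norm_bound\<close>.\<close>
  define B where "B t = (b + 1) * (1 + t)" for t :: real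
  have B: "0 < B t" if "0 \<le> t" for t using that rb r0 by (simp add: B_def)
  define G where "G t x = profile_field t (rball (B t) x)" for t x
  have "\<exists>w. continuous_on {0..} w \<and> (\<forall>t\<ge>0. w t = w0 + integral {0..t} (\<lambda>s. G s (w s)))"
  proof (rule global_solution_Lipschitz[where K="\<lambda>t. 96 * (1 + \<bar>t\<bar>) ^ 4 * (B t)\<^sup>2"])
    fix w :: "real \<Rightarrow> h11" assume "continuous_on {0..} w"
    then show "continuous_on {0..} (\<lambda>s. G s (w s))"
      unfolding G_def by (intro profile_field_continuous_on rball_continuous_on) (use B in \<open>auto simp: B_def intro!: continuous_intros\<close>)
  next
    fix t :: real and x y :: h11 assume t: "0 \<le> t"
    have "norm (G t x - G t y) \<le> 48 * (1 + \<bar>t\<bar>) ^ 4 * (B t)\<^sup>2 * norm (rball (B t) x - rball (B t) y)"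
      unfolding G_def by (intro profile_field_lipschitz norm_rball B t)
    also have "\<dots> \<le> 48 * (1 + \<bar>t\<bar>) ^ 4 * (B t)\<^sup>2 * (2 * norm (x - y))"
      by (intro mult_left_mono rball_lipschitz B t) auto
    finally show "norm (G t x - G t y) \<le> 96 * (1 + \<bar>t\<bar>) ^ 4 * (B t)\<^sup>2 * norm (x - y)" by simp
  next
    show "continuous_on {0..} (\<lambda>t. 96 * (1 + \<bar>t\<bar>) ^ 4 * (B t)\<^sup>2)" unfolding B_def by (intro continuous_intros)
    show "0 \<le> 96 * (1 + \<bar>t\<bar>) ^ 4 * (B t)\<^sup>2" for t by simp
    show "G t 0 = 0" if "0 \<le> t" for t using B[OF that] by (simp add: G_def rball_eq profile_field_0)
  qed
  then obtain w where wc: "continuous_on {0..} w" and weq: "\<And>t. 0 \<le> t \<Longrightarrow> w t = w0 + integral {0..t} (\<lambda>s. G s (w s))" by blast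
  have w_0: "w 0 = w0" using weq[of 0] by simp
  have inside: "norm (w t) < B t" if t: "0 \<le> t" for t
  proof (rule ccontr)
    assume "\<not> norm (w t) < B t"
    define g where "g s = norm (w s) - B s" for s
    have gc: "continuous_on {0..} g" unfolding g_def B_def by (intro continuous_intros wc)
    have gc': "continuous_on {0..s} g" for s by (rule continuous_on_subset[OF gc]) auto
    define A where "A = {s \<in> {0..t}. 0 \<le> g s}"
    have "compact A"
    proof -
      have "A = {0..t} \<inter> g -` {0..}" by (auto simp: A_def)
      then have "closed A" using continuous_closed_preimage[OF gc' closed_atLeastAtMost closed_atLeast, of t 0] by simp
      moreover have "bounded A" unfolding A_def by (rule bounded_subset[OF bounded_closed_interval[of 0 t]]) auto
      ultimately show ?thesis by (simp add: compact_eq_bounded_closed)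
    qed
    moreover have "A \<noteq> {}" using t \<open>\<not> norm (w t) < B t\<close> by (auto simp: A_def g_def)
    \<comment> \<open>The first time at which the radius is reached: on \<open>{0..s}\<close> the
      curve solves the original equation, so the a priori bound is available up to
      \<open>s\<close>.\<close>
    ultimately obtain s where s: "s \<in> A" "\<And>s'. s' \<in> A \<Longrightarrow> s \<le> s'" using compact_attains_inf by metis
    have s0: "0 \<le> s" "s \<le> t" "0 \<le> g s" using s(1) by (auto simp: A_def)
    \<comment> \<open>Membership in \<open>A\<close> gives only \<open>0 \<le> g s\<close>. The
      intermediate value theorem sharpens this to equality, so the truncation is inactive at
      \<open>s\<close> itself as well.\<close>
    have "g 0 \<le> 0" using r rb by (simp add: g_def B_def w_0)
    from IVT'[OF this s0(3) s0(1) gc'] obtain s' where s': "0 \<le> s'" "s' \<le> s" "g s' = 0" by auto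
    then have "s' \<in> A" using s0 by (auto simp: A_def)
    then have gs: "g s = 0" using s(2)[of s'] s' by force
    have le: "norm (w s') \<le> B s'" if "s' \<in> {0..s}" for s'
    proof (cases "s' = s")
      case False
      then have "s' \<notin> A" using s(2)[of s'] that by force
      then show ?thesis using that s0 by (auto simp: A_def g_def)
    qed (use gs in \<open>simp add: g_def\<close>)
    have Geq: "G s' (w s') = profile_field s' (w s')" if "s' \<in> {0..s}" for s'
      unfolding G_def by (simp add: rball_eq[OF le[OF that]])
    have D: "(w has_vector_derivative profile_field s' (w s')) (at s' within {0..s})" if "s' \<in> {0..s}" for s'
    proof (rule integral_equation_has_vector_derivative[OF _ _ that])
      show "continuous_on {0..s} (\<lambda>s'. profile_field s' (w s'))"
        by (rule profile_field_continuous_on[OF continuous_on_subset[OF wc]]) auto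
      fix x assume x: "x \<in> {0..s}"
      have "integral {0..x} (\<lambda>s. G s (w s)) = integral {0..x} (\<lambda>s. profile_field s (w s))"
        by (rule Henstock_Kurzweil_Integration.integral_cong) (use Geq x in auto)
      then show "w x = w0 + integral {0..x} (\<lambda>s'. profile_field s' (w s'))" using weq[of x] x by simp
    qed
    have "norm (w s) \<le> b * (1 + s)"
      unfolding b_def by (rule norm_bound[OF D]) (use r s0 in \<open>auto simp: w_0\<close>)
    also have "\<dots> < B s" using s0 by (simp add: B_def distrib_right)
    finally show False using gs by (simp add: g_def)
  qed
  have "w t = w0 + integral {0..t} (\<lambda>s. profile_field s (w s))" if "0 \<le> t" for t
  proof -
    have "integral {0..t} (\<lambda>s. G s (w s)) = integral {0..t} (\<lambda>s. profile_field s (w s))"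
      by (rule Henstock_Kurzweil_Integration.integral_cong) (auto simp: G_def rball_eq less_imp_le[OF inside])
    then show ?thesis using weq[OF that] by simp
  qed
  then show ?thesis using wc by blast
qed

lemma profile_unique:
  assumes w1: "continuous_on {0..} w1" "\<And>t. 0 \<le> t \<Longrightarrow> w1 t = w0 + integral {0..t} (\<lambda>s. profile_field s (w1 s))"
    and w2: "continuous_on {0..} w2" "\<And>t. 0 \<le> t \<Longrightarrow> w2 t = w0 + integral {0..t} (\<lambda>s. profile_field s (w2 s))"
    and t: "0 \<le> t"
  shows "w1 t = w2 t"
proof -
  have c: "continuous_on {0..t} w1" "continuous_on {0..t} w2"
    by (auto intro: continuous_on_subset[OF w1(1)] continuous_on_subset[OF w2(1)])
  have "bounded (w1 ` {0..t})" "bounded (w2 ` {0..t})"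
    by (intro compact_imp_bounded compact_continuous_image c compact_Icc)+
  then obtain B1 B2 where B: "\<And>s. s \<in> {0..t} \<Longrightarrow> norm (w1 s) \<le> B1" "\<And>s. s \<in> {0..t} \<Longrightarrow> norm (w2 s) \<le> B2"
    unfolding bounded_iff by blast
  show ?thesis
  proof (rule integral_equation_unique[OF c profile_field_continuous_on[OF c(1)] profile_field_continuous_on[OF c(2)]])
    show "w1 s = w0 + integral {0..s} (\<lambda>s. profile_field s (w1 s))" "w2 s = w0 + integral {0..s} (\<lambda>s. profile_field s (w2 s))" if "s \<in> {0..t}" for s
      using that w1(2) w2(2) by auto
    fix s assume s: "s \<in> {0..t}"
    have "norm (profile_field s (w1 s) - profile_field s (w2 s)) \<le> 48 * (1 + \<bar>s\<bar>) ^ 4 * (max B1 B2)\<^sup>2 * norm (w1 s - w2 s)"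
      by (rule profile_field_lipschitz) (use B[OF s] in auto)
    also have "\<dots> \<le> 48 * (1 + t) ^ 4 * (max B1 B2)\<^sup>2 * norm (w1 s - w2 s)"
      using s by (intro mult_right_mono mult_left_mono power_mono) auto
    finally show "norm (profile_field s (w1 s) - profile_field s (w2 s)) \<le> 48 * (1 + t) ^ 4 * (max B1 B2)\<^sup>2 * norm (w1 s - w2 s)" .
  qed (use t in auto)
qed

section \<open>Translation between H11 functions and their continuous representatives\<close>

lemma H11_representative: assumes "f \<in> H11" shows "\<exists>F. AE x in lborel. f x = ev F x"
proof -
  have f: "f \<in> L2" and xf: "(\<lambda>x. of_real x * f x) \<in> L2" using assms by (auto simp: H11_def H1_def)
  obtain g where g: "g \<in> L2" "is_weak_deriv f g" using assms by (auto simp: H11_def H1_def)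
  obtain F where F: "ac_deriv F g" "AE x in lborel. f x = F x" using weak_deriv_imp_ac_deriv[OF f g] by blast
  note [measurable] = ac_deriv_borel[OF F(1)]
  have "F \<in> L2" by (rule L2_cong_AE[OF f _ F(2)]) measurable
  moreover have "(\<lambda>x. of_real x * F x) \<in> L2"
    by (rule L2_cong_AE[OF xf]) (use F(2) in auto)
  ultimately have "ev (mk_h11 F) = F" by (intro ev_mk[OF F(1)] g) auto
  then show ?thesis using F(2) by metis
qed

lemma ev_AE_eq: assumes "AE x in lborel. ev F x = ev G x" shows "F = G"
  by (rule h11_eqI, rule continuous_AE_eq[OF ev_continuous ev_continuous assms])

text \<open>The weighted norm contains the L2 norm once more, and the two norms in
  \<open>H11_norm\<close> are added rather than combined quadratically, so the Hilbert norm is only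
  equivalent to it. Since the lower bound has constant 1, the radius \<open>R\<close> of the data
  carries over without loss.\<close>

lemma H11_norm_equivalence:
  assumes f[measurable]: "f \<in> borel_measurable borel" and eq: "AE x in lborel. f x = ev F x"
  shows "f \<in> H11" "norm F \<le> H11_norm f" "H11_norm f \<le> 2 * norm F"
proof -
  have eq': "AE x in lborel. ev F x = f x" using eq by eventually_elim simp
  have fL: "f \<in> L2" by (rule L2_cong_AE[OF ev_L2 f eq'])
  have wd: "is_weak_deriv f (dv F)"
    unfolding is_weak_deriv_def
  proof (intro allI impI)
    fix \<phi> assume t: "test_function \<phi>"
    have [measurable]: "deriv \<phi> \<in> borel_measurable borel"
      by (rule borel_measurable_continuous_onI[OF test_function_DERIV(2)[OF t]])
    have "(LINT x|lborel. f x * of_real (deriv \<phi> x)) = (LINT x|lborel. ev F x * of_real (deriv \<phi> x))"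
      by (rule integral_cong_AE) (use eq in auto)
    then show "(LINT x|lborel. f x * of_real (deriv \<phi> x)) = - (LINT x|lborel. dv F x * of_real (\<phi> x))"
      using ac_deriv_imp_weak_deriv[OF ac_deriv_dv, of F] t by (simp add: is_weak_deriv_def)
  qed
  have xf: "(\<lambda>x. of_real x * f x) \<in> L2"
    by (rule L2_cong_AE[OF mx_L2[of F]]) (use eq in \<open>auto simp: mx_def\<close>)
  show "f \<in> H11" unfolding H11_def H1_def using fL wd dv_L2 xf by blast
  \<comment> \<open>The weak derivative is an arbitrary choice. Its primitive agrees with
    \<open>f\<close> almost everywhere, hence with \<open>ev F\<close> everywhere, and uniqueness of
    almost everywhere derivatives identifies the choice with \<open>dv F\<close>.\<close>
  have sw: "weak_deriv f \<in> L2 \<and> is_weak_deriv f (weak_deriv f)"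
    unfolding weak_deriv_def by (rule someI[of _ "dv F"]) (use wd dv_L2 in auto)
  then obtain F' where F': "ac_deriv F' (weak_deriv f)" "AE x in lborel. f x = F' x" using weak_deriv_imp_ac_deriv[OF fL] by blast
  have "F' x = ev F x" for x
  proof (rule continuous_AE_eq[OF ac_deriv_continuous[OF F'(1)] ev_continuous])
    show "AE x in lborel. F' x = ev F x" using eq F'(2) by eventually_elim simp
  qed
  then have "F' = ev F" by auto
  then have "AE x in lborel. dv F x = weak_deriv f x" using dv_AE F'(1) by simp
  then have d: "L2_norm (weak_deriv f) = L2_norm (dv F)"
    using sw by (intro L2_norm_cong_AE) (auto simp: L2_measurable)
  have a: "L2_norm f = L2_norm (ev F)" by (rule L2_norm_cong_AE[OF _ _ eq]) auto
  have m: "(L2_norm (\<lambda>x. of_real (sqrt (1 + x\<^sup>2)) * f x))\<^sup>2 = (L2_norm (ev F))\<^sup>2 + (L2_norm (mx F))\<^sup>2"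
  proof -
    have "(L2_norm (\<lambda>x. of_real (sqrt (1 + x\<^sup>2)) * f x))\<^sup>2 = (LINT x|lborel. (cmod (ev F x))\<^sup>2 + (cmod (mx F x))\<^sup>2)"
      unfolding L2_norm_power2
    proof (rule integral_cong_AE)
      show "AE x in lborel. (cmod (of_real (sqrt (1 + x\<^sup>2)) * f x))\<^sup>2 = (cmod (ev F x))\<^sup>2 + (cmod (mx F x))\<^sup>2"
        using eq by eventually_elim (simp add: norm_mult power_mult_distrib mx_def distrib_right)
    qed measurable
    then show ?thesis by (simp add: L2_norm_power2 L2_integrable ev_L2 mx_L2)
  qed
  define p q where "p = H1_norm f" and "q = L2_norm (\<lambda>x. of_real (sqrt (1 + x\<^sup>2)) * f x)"
  have p: "p\<^sup>2 = (L2_norm (ev F))\<^sup>2 + (L2_norm (dv F))\<^sup>2" by (simp add: p_def H1_norm_def a d)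
  have q: "q\<^sup>2 = (L2_norm (ev F))\<^sup>2 + (L2_norm (mx F))\<^sup>2" unfolding q_def by (rule m)
  have pq: "0 \<le> p" "0 \<le> q" by (simp_all add: p_def q_def H1_norm_def)
  have H: "H11_norm f = p + q" by (simp add: H11_norm_def p_def q_def)
  have "(norm F)\<^sup>2 \<le> p\<^sup>2 + q\<^sup>2" unfolding p q norm_h11_power2 by simp
  also have "\<dots> \<le> (p + q)\<^sup>2" using pq by (simp add: power2_sum)
  finally show "norm F \<le> H11_norm f" unfolding H by (rule power2_le_imp_le) (use pq in simp)
  have "p \<le> norm F" by (rule power2_le_imp_le) (simp_all add: p norm_h11_power2)
  moreover have "q \<le> norm F" by (rule power2_le_imp_le) (simp_all add: q norm_h11_power2)
  ultimately show "H11_norm f \<le> 2 * norm F" unfolding H by simp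
qed

lemma continuous_H11_iff:
  assumes v: "\<And>t. 0 \<le> t \<Longrightarrow> v t \<in> borel_measurable borel" and V: "\<And>t. 0 \<le> t \<Longrightarrow> AE x in lborel. v t x = ev (V t) x"
  shows "continuous_H11 v \<longleftrightarrow> continuous_on {0..} V"
proof -
  have eqv: "norm (V s - V t) \<le> H11_norm (\<lambda>x. v s x - v t x)" "H11_norm (\<lambda>x. v s x - v t x) \<le> 2 * norm (V s - V t)" if "0 \<le> s" "0 \<le> t" for s t
  proof -
    have "AE x in lborel. v s x - v t x = ev (V s - V t) x"
      using V[OF that(1)] V[OF that(2)] by eventually_elim (simp add: ev_diff)
    from H11_norm_equivalence(2,3)[OF _ this] v[OF that(1)] v[OF that(2)]
    show "norm (V s - V t) \<le> H11_norm (\<lambda>x. v s x - v t x)" "H11_norm (\<lambda>x. v s x - v t x) \<le> 2 * norm (V s - V t)" by auto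
  qed
  have ev0: "\<forall>\<^sub>F s in at t within {0..}. 0 \<le> s" for t :: real by (auto simp: eventually_at_filter)
  have "((\<lambda>s. H11_norm (\<lambda>x. v s x - v t x)) \<longlongrightarrow> 0) (at t within {0..}) \<longleftrightarrow> (V \<longlongrightarrow> V t) (at t within {0..})" if t: "0 \<le> t" for t
  proof
    assume l: "((\<lambda>s. H11_norm (\<lambda>x. v s x - v t x)) \<longlongrightarrow> 0) (at t within {0..})"
    have "((\<lambda>s. V s - V t) \<longlongrightarrow> 0) (at t within {0..})"
      by (rule Lim_null_comparison[OF _ l]) (use ev0 in eventually_elim, rule eqv(1)[OF _ t])
    then show "(V \<longlongrightarrow> V t) (at t within {0..})" by (rule LIM_zero_cancel)
  next
    assume "(V \<longlongrightarrow> V t) (at t within {0..})"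
    then have "((\<lambda>s. norm (V s - V t)) \<longlongrightarrow> 0) (at t within {0..})" by (simp add: LIM_zero tendsto_norm_zero)
    from tendsto_mult_right_zero[OF this, of 2]
    show "((\<lambda>s. H11_norm (\<lambda>x. v s x - v t x)) \<longlongrightarrow> 0) (at t within {0..})"
    proof (rule Lim_null_comparison[rotated])
      show "\<forall>\<^sub>F s in at t within {0..}. norm (H11_norm (\<lambda>x. v s x - v t x)) \<le> 2 * norm (V s - V t)"
        using ev0
      proof eventually_elim
        case (elim s)
        show ?case using eqv[OF elim t] norm_ge_zero[of "V s - V t"] by simp
      qed
    qed
  qed
  then show ?thesis
    unfolding continuous_H11_def continuous_on_def using H11_norm_equivalence(1)[OF v V] by auto
qed

text \<open>Evaluation at a point is bounded and linear, so the pointwise time integral is the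
  vector-valued one evaluated at \<open>x\<close>. Applying \<open>U (- t)\<close> and using
  \<open>U (- t) U (t - \<tau>) = U (- \<tau>)\<close> removes \<open>t\<close> from the integrand,
  which leaves the integral form of the equation for the profile.\<close>

lemma Duhamel_iff:
  assumes v: "\<And>t. 0 \<le> t \<Longrightarrow> v t \<in> borel_measurable borel" and V: "\<And>t. 0 \<le> t \<Longrightarrow> AE x in lborel. v t x = ev (V t) x"
    and u0: "u0 \<in> borel_measurable borel" "AE x in lborel. u0 x = ev F x"
    and Vc: "continuous_on {0..} V" and t: "0 \<le> t"
  shows "(AE x in lborel. v t x = schroedinger_group t u0 x - \<i> * (LINT \<tau>:{0..t}|lborel.
                schroedinger_group (t - \<tau>) (\<lambda>y. v \<tau> y * of_real ((cmod (v \<tau> y))\<^sup>2)) x))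
    \<longleftrightarrow> U (- t) (V t) = F + integral {0..t} (\<lambda>s. profile_field s (U (- s) (V s)))"
proof -
  define g where "g \<tau> = U (t - \<tau>) (cubic (V \<tau>))" for \<tau>
  have Nc: "continuous_on {0..t} (\<lambda>\<tau>. cubic (V \<tau>))"
    using continuous_on_subset[OF Vc, of "{0..t}"] unfolding continuous_on_def by (auto intro: cubic_tendsto)
  have gc: "continuous_on {0..t} g" unfolding g_def by (intro U_continuous_on Nc continuous_intros)
  have gi: "g integrable_on {0..t}" by (rule integrable_continuous_real[OF gc])
  have inner_eq: "schroedinger_group (t - \<tau>) (\<lambda>y. v \<tau> y * of_real ((cmod (v \<tau> y))\<^sup>2)) x = ev (g \<tau>) x" if "\<tau> \<in> {0..t}" for \<tau> x
  proof -
    have [measurable]: "v \<tau> \<in> borel_measurable borel" using v that by simp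
    have "AE y in lborel. v \<tau> y = ev (V \<tau>) y" using V that by simp
    then have "AE y in lborel. v \<tau> y * of_real ((cmod (v \<tau> y))\<^sup>2) = ev (cubic (V \<tau>)) y"
      by eventually_elim (simp add: ev_cubic)
    then show ?thesis unfolding g_def by (subst schroedinger_group_U) auto
  qed
  have int_eq: "(LINT \<tau>:{0..t}|lborel. schroedinger_group (t - \<tau>) (\<lambda>y. v \<tau> y * of_real ((cmod (v \<tau> y))\<^sup>2)) x) = ev (integral {0..t} g) x" for x
  proof -
    have "(LINT \<tau>:{0..t}|lborel. schroedinger_group (t - \<tau>) (\<lambda>y. v \<tau> y * of_real ((cmod (v \<tau> y))\<^sup>2)) x) = (LINT \<tau>:{0..t}|lborel. ev (g \<tau>) x)"
      by (rule set_lebesgue_integral_cong) (use inner_eq in auto)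
    also have "\<dots> = integral {0..t} (\<lambda>\<tau>. ev (g \<tau>) x)"
      by (intro set_borel_integral_eq_integral(2) borel_integrable_atLeastAtMost' bounded_linear.continuous_on[OF bounded_linear_ev gc])
    also have "\<dots> = ev (integral {0..t} g) x"
      using integral_linear[OF gi bounded_linear_ev, of x] by (simp add: o_def)
    finally show ?thesis .
  qed
  define rhs where "rhs = U t F + h11_scale (- \<i>) (integral {0..t} g)"
  have "(AE x in lborel. v t x = schroedinger_group t u0 x - \<i> * (LINT \<tau>:{0..t}|lborel.
                schroedinger_group (t - \<tau>) (\<lambda>y. v \<tau> y * of_real ((cmod (v \<tau> y))\<^sup>2)) x))
    \<longleftrightarrow> (AE x in lborel. v t x = ev rhs x)"
    unfolding int_eq schroedinger_group_U[OF u0] rhs_def by (simp add: ev_add ev_scale)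
  also have "\<dots> \<longleftrightarrow> V t = rhs"
  proof
    assume "AE x in lborel. v t x = ev rhs x"
    then have "AE x in lborel. ev (V t) x = ev rhs x" using V[OF t] by eventually_elim simp
    then show "V t = rhs" by (rule ev_AE_eq)
  qed (use V[OF t] in simp)
  also have "\<dots> \<longleftrightarrow> U (- t) (V t) = U (- t) rhs" by (metis U_inv(2))
  also have "U (- t) rhs = F + integral {0..t} (\<lambda>s. profile_field s (U (- s) (V s)))"
  proof -
    have L: "bounded_linear (\<lambda>f. h11_scale (- \<i>) (U (- t) f))"
      by (rule bounded_linear_compose[OF h11_scale_linear U_linear])
    have "U (- t) rhs = F + h11_scale (- \<i>) (U (- t) (integral {0..t} g))"
      by (simp add: rhs_def linear_simps[OF U_linear] U_scale)
    also have "h11_scale (- \<i>) (U (- t) (integral {0..t} g)) = integral {0..t} (\<lambda>s. h11_scale (- \<i>) (U (- t) (g s)))"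
      using integral_linear[OF gi L] by (simp add: o_def)
    also have "(\<lambda>s. h11_scale (- \<i>) (U (- t) (g s))) = (\<lambda>s. profile_field s (U (- s) (V s)))"
      by (simp add: g_def profile_field_def U_U U_0)
    finally show ?thesis .
  qed
  finally show ?thesis .
qed

theorem theorem2p3:
  fixes R :: real
  assumes "R > 0"
  shows "\<exists>C::real. \<forall>u0. u0 \<in> H11 \<and> H11_norm u0 \<le> R \<longrightarrow>
    (\<exists>u. mild_NLS_solution u0 u \<and>
       (\<forall>v. mild_NLS_solution u0 v \<longrightarrow> (\<forall>t\<ge>0. AE x in lborel. v t x = u t x)) \<and>
       (\<forall>t\<ge>1. Linf_norm (u t) \<le> ereal (C * t powr (- 1 / 3))))"
proof (rule exI, intro allI impI)
  \<comment> \<open>The constant of \<open>decay_estimate\<close> with \<open>r = R\<close>; it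
    depends on the data only through this radius.\<close>
  let ?C = "(4 * (R\<^sup>2 + energy_bound R / 2)) powr (1 / 3)"
  fix u0 assume u0: "u0 \<in> H11 \<and> H11_norm u0 \<le> R"
  have u0m: "u0 \<in> borel_measurable borel" using u0 by (auto simp: H11_def H1_def L2_def)
  obtain F where F: "AE x in lborel. u0 x = ev F x" using H11_representative u0 by blast
  have nF: "norm F \<le> R" using H11_norm_equivalence(2)[OF u0m F] u0 by simp
  obtain w where wc: "continuous_on {0..} w" and weq: "\<And>t. 0 \<le> t \<Longrightarrow> w t = F + integral {0..t} (\<lambda>s. profile_field s (w s))"
    using global_solution[OF nF assms] by blast
  define u where "u t = ev (U t (w t))" for t
  have uc: "continuous_on {0..} (\<lambda>t. U t (w t))" by (intro U_continuous_on wc continuous_on_id)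
  have um: "u t \<in> borel_measurable borel" for t unfolding u_def by measurable
  have uA: "AE x in lborel. u t x = ev (U t (w t)) x" for t by (simp add: u_def)
  have sol: "mild_NLS_solution u0 u"
    unfolding mild_NLS_solution_def
  proof (intro conjI allI impI)
    show "continuous_H11 u" by (rule continuous_H11_iff[where v=u and V="\<lambda>t. U t (w t)", OF um uA, THEN iffD2, OF uc])
    fix t :: real assume t: "0 \<le> t"
    have "U (- t) (U t (w t)) = F + integral {0..t} (\<lambda>s. profile_field s (U (- s) (U s (w s))))"
      unfolding U_inv by (rule weq[OF t])
    then show "AE x in lborel. u t x = schroedinger_group t u0 x - \<i> * (LINT \<tau>:{0..t}|lborel.
                schroedinger_group (t - \<tau>) (\<lambda>y. u \<tau> y * of_real ((cmod (u \<tau> y))\<^sup>2)) x)"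
      by (rule Duhamel_iff[where v=u and V="\<lambda>t. U t (w t)", OF um uA u0m F uc t, THEN iffD2])
  qed
  have unique: "AE x in lborel. v t x = u t x" if v: "mild_NLS_solution u0 v" and t: "0 \<le> t" for v t
  proof -
    have vc: "continuous_H11 v" using v by (simp add: mild_NLS_solution_def)
    then have vH: "v t \<in> H11" if "0 \<le> t" for t using that by (simp add: continuous_H11_def)
    then have vm: "v t \<in> borel_measurable borel" if "0 \<le> t" for t
      using that by (auto simp: H11_def H1_def L2_def)
    \<comment> \<open>A competing solution is given only up to null sets at each time. Its
      continuous representatives form a curve in the Hilbert space, to which uniqueness for the
      profile equation applies.\<close>
    define V where "V t = (SOME G. AE x in lborel. v t x = ev G x)" for t
    have V: "AE x in lborel. v t x = ev (V t) x" if "0 \<le> t" for t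
      unfolding V_def by (rule someI_ex[OF H11_representative[OF vH[OF that]]])
    have Vc: "continuous_on {0..} V" by (rule continuous_H11_iff[where v=v, OF vm V, THEN iffD1, OF _ _ vc])
    have "U (- s) (V s) = F + integral {0..s} (\<lambda>s. profile_field s (U (- s) (V s)))" if "0 \<le> s" for s
    proof (rule Duhamel_iff[where v=v and V=V, OF vm V u0m F Vc that, THEN iffD1])
      show "AE x in lborel. v s x = schroedinger_group s u0 x - \<i> * (LINT \<tau>:{0..s}|lborel.
                schroedinger_group (s - \<tau>) (\<lambda>y. v \<tau> y * of_real ((cmod (v \<tau> y))\<^sup>2)) x)"
        using v that unfolding mild_NLS_solution_def by blast
    qed
    note eq = this
    have "continuous_on {0..} (\<lambda>s. U (- s) (V s))" by (intro U_continuous_on Vc continuous_intros)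
    from profile_unique[OF this eq wc weq t] have "U (- t) (V t) = w t" .
    then have "V t = U t (w t)" by (metis U_inv(2))
    then show ?thesis using V[OF t] by (simp add: u_def)
  qed
  have decay: "Linf_norm (u t) \<le> ereal (?C * t powr (- 1 / 3))" if t: "1 \<le> t" for t
  proof -
    \<comment> \<open>\<open>decay_estimate\<close> speaks about the right end of its time interval,
      so the interval is chosen to end at the given \<open>t\<close>.\<close>
    have "(w has_vector_derivative profile_field s (w s)) (at s within {0..t})" if "s \<in> {0..t}" for s
    proof (rule integral_equation_has_vector_derivative[OF _ _ that])
      show "continuous_on {0..t} (\<lambda>s. profile_field s (w s))" by (rule profile_field_continuous_on[OF continuous_on_subset[OF wc]]) auto
      show "w x = F + integral {0..x} (\<lambda>s. profile_field s (w s))" if "x \<in> {0..t}" for x using weq that by simp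
    qed
    moreover have "norm (w 0) \<le> R" using weq[of 0] nF by simp
    ultimately have "cmod (u t x) \<le> ?C * t powr (- 1 / 3)" for x
      unfolding u_def by (intro decay_estimate t)
    then show ?thesis unfolding Linf_norm_def
      by (intro esssup_I) (use um in auto)
  qed
  show "\<exists>u. mild_NLS_solution u0 u \<and>
       (\<forall>v. mild_NLS_solution u0 v \<longrightarrow> (\<forall>t\<ge>0. AE x in lborel. v t x = u t x)) \<and>
       (\<forall>t\<ge>1. Linf_norm (u t) \<le> ereal (?C * t powr (- 1 / 3)))"
    by (rule exI[of _ u], intro conjI allI impI sol, erule (1) unique, erule decay)
qed

end
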